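(* Let $d=d(n)\geq 3$ and let $G=G(n)$ be a graph on $[n]$ with maximum degree $d$. \begin{itemize} \item There exists a constant $C>0$ such that, for all $d\leq \ln n/\ln\ln n$ and all large enough $n$, ${\sf S}(G)\leq C\, n^{1-2/d} d^2(\ln n)^{2+4/d}$. \item For all $d$ and all $n$, ${\sf S}(G)\leq n-\lceil n/(2d)\rceil+1$. \end{itemize}
   Context: For a graph $G$ and an abelian group $(H,+)$, ${\sf S}_H(G)$ denotes the minimum, over all injections $A:V(G)\to H$, of the cardinality of the set $\{A(u)+A(v):\{u,v\}\in E(G)\}$. Define ${\sf S}(G):=\min_H {\sf S}_H(G)$, the minimum over all abelian groups $H$. $[n]=\{1,\ldots,n\}$ and $\ln$ is the natural logarithm. *)

theory Defs
  imports "HOL-Algebra.Generated_Groups" "HOL-Algebra.Weak_Morphisms"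
    "HOL-Library.Countable_Set" "HOL-Library.Extended_Real"
begin

definition simple_graph :: "'v set \<Rightarrow> 'v set set \<Rightarrow> bool" where
  "simple_graph V E \<longleftrightarrow> finite V \<and> E \<subseteq> {{u, v} | u v. u \<in> V \<and> v \<in> V \<and> u \<noteq> v}"

definition vertex_degree :: "'v set set \<Rightarrow> 'v \<Rightarrow> nat" where
  "vertex_degree E v = card {e \<in> E. v \<in> e}"

text \<open>Inserting 0 only fixes the value for the graph without vertices.\<close>

definition max_degree :: "'v set \<Rightarrow> 'v set set \<Rightarrow> nat" where
  "max_degree V E = Max (insert 0 (vertex_degree E ` V))"

definition edge_sums :: "('h, 'm) monoid_scheme \<Rightarrow> 'v set set \<Rightarrow> ('v \<Rightarrow> 'h) \<Rightarrow> 'h set" where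
  "edge_sums H E A = {A u \<otimes>\<^bsub>H\<^esub> A v | u v. {u, v} \<in> E}"

text \<open>The abelian group \<open>H\<close> is written multiplicatively, as everywhere in HOL-Algebra.
  If no injection from \<open>V\<close> to \<open>H\<close> exists, the infimum is \<open>\<infinity>\<close>, so that groups that are too small
  do not contribute to \<open>sum_number\<close>; otherwise it is a minimum, as \<open>enat\<close> is well-ordered.\<close>

definition sum_number_in ::
    "('h, 'm) monoid_scheme \<Rightarrow> 'v set \<Rightarrow> 'v set set \<Rightarrow> enat" where
  "sum_number_in H V E =
    (INF A \<in> {A. A \<in> V \<rightarrow> carrier H \<and> inj_on A V}. enat (card (edge_sums H E A)))"

text \<open>HOL has no quantification over all types inside a formula, so the minimum is taken over the
  abelian groups whose carrier is a set of natural numbers, i.e. over all countable abelian groups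
  up to isomorphism. For finite \<open>V\<close> this is the minimum over all abelian groups, because only the
  finitely generated subgroup generated by the image of the injection matters; this is
  \<open>sum_number_le\<close> below.\<close>

definition sum_number :: "'v set \<Rightarrow> 'v set set \<Rightarrow> enat" where
  "sum_number V E = (INF H \<in> {H :: nat monoid. comm_group H}. sum_number_in H V E)"

lemma (in group) countable_generate:
  assumes "finite S" "S \<subseteq> carrier G"
  shows "countable (generate G S)"
proof -
  let ?T = "S \<union> (\<lambda>x. inv x) ` S"
  let ?p = "\<lambda>xs. foldr (\<otimes>) xs \<one>"
  have T: "?T \<subseteq> carrier G" using assms by auto
  have closed: "?p xs \<in> carrier G" if "xs \<in> lists ?T" for xs
    using that T by (induction xs) auto
  have app: "?p (xs @ ys) = ?p xs \<otimes> ?p ys" if "xs \<in> lists ?T" "ys \<in> lists ?T" for xs ys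
    using that(1)
  proof (induction xs)
    case Nil
    then show ?case using closed[OF that(2)] by simp
  next
    case (Cons x xs)
    then have "x \<in> carrier G" "?p xs \<in> carrier G" "?p ys \<in> carrier G"
      using closed[OF that(2)] closed[of xs] T by auto
    with Cons show ?case by (simp add: m_assoc)
  qed
  have "x \<in> ?p ` lists ?T" if "x \<in> generate G S" for x
    using that
  proof (induction rule: generate.induct)
    case one
    show ?case by (rule image_eqI[of _ _ "[]"]) auto
  next
    case (incl h)
    then show ?case using assms by (intro image_eqI[of _ _ "[h]"]) auto
  next
    case (inv h)
    then show ?case using assms by (intro image_eqI[of _ _ "[inv h]"]) auto
  next
    case (eng a b)
    then obtain xs ys where "xs \<in> lists ?T" "ys \<in> lists ?T" "a = ?p xs" "b = ?p ys" by auto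
    then show ?case using app by (intro image_eqI[of _ _ "xs @ ys"]) auto
  qed
  moreover have "countable (?p ` lists ?T)"
    using assms(1) by (intro countable_image countable_lists) (auto intro: countable_finite)
  ultimately show ?thesis by (meson countable_subset subsetI)
qed

lemma comm_group_image_group:
  assumes "comm_group G" "inj_on f (carrier G)"
  shows "comm_group (image_group f G)"
proof -
  interpret comm_group G by fact
  show ?thesis
    using iso_imp_img_comm_group[OF inj_imp_image_group_iso[OF assms(2)]]
    by (simp add: image_group_def)
qed

lemma sum_number_le_card:
  fixes H :: "('h, 'm) monoid_scheme"
  assumes "simple_graph V E" "comm_group H" "A \<in> V \<rightarrow> carrier H" "inj_on A V"
  shows "sum_number V E \<le> enat (card (edge_sums H E A))"
proof -
  interpret H: comm_group H by fact
  let ?K = "subgroup_generated H (A ` V)"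
  have AV: "A ` V \<subseteq> carrier H" using assms by auto
  have K: "carrier ?K = generate H (A ` V)"
    using AV by (simp add: carrier_subgroup_generated Int_absorb1)
  have fin: "finite V" using assms by (simp add: simple_graph_def)
  have "countable (carrier ?K)" unfolding K using fin AV by (intro H.countable_generate) auto
  then obtain f :: "'h \<Rightarrow> nat" where f: "inj_on f (carrier ?K)" by (auto simp: countable_def)
  have cK: "comm_group ?K"
    using H.abelian_subgroup_generated[OF assms(2)] .
  let ?I = "image_group f ?K"
  have cI: "comm_group ?I" using cK f by (rule comm_group_image_group)
  have iso: "f \<in> iso ?K ?I" using f by (rule inj_imp_image_group_iso)
  have AK: "A v \<in> carrier ?K" if "v \<in> V" for v unfolding K using that by (auto intro: generate.incl)
  have "f \<circ> A \<in> V \<rightarrow> carrier ?I" using AK iso by (auto simp: iso_def hom_def)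
  moreover have "inj_on (f \<circ> A) V"
    using assms(4) f AK by (intro comp_inj_on) (auto intro: inj_on_subset)
  ultimately have "sum_number_in ?I V E \<le> enat (card (edge_sums ?I E (f \<circ> A)))"
    unfolding sum_number_in_def by (intro INF_lower) auto
  moreover have "edge_sums ?I E (f \<circ> A) = f ` edge_sums H E A"
  proof -
    have "f (A u) \<otimes>\<^bsub>?I\<^esub> f (A v) = f (A u \<otimes>\<^bsub>H\<^esub> A v)" if "{u, v} \<in> E" for u v
    proof -
      have "u \<in> V" "v \<in> V"
        using that assms(1) by (auto simp: simple_graph_def doubleton_eq_iff)
      then show ?thesis
        using hom_mult[of f ?K ?I "A u" "A v"] iso AK by (simp add: iso_def)
    qed
    then have "edge_sums ?I E (f \<circ> A) = {f (A u \<otimes>\<^bsub>H\<^esub> A v) | u v. {u, v} \<in> E}"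
      unfolding edge_sums_def by (metis (no_types, opaque_lifting) comp_apply)
    then show ?thesis unfolding edge_sums_def by blast
  qed
  moreover have "finite (edge_sums H E A)"
  proof -
    have "u \<in> V \<and> v \<in> V" if "{u, v} \<in> E" for u v
      using that assms(1) by (auto simp: simple_graph_def doubleton_eq_iff)
    then have "edge_sums H E A \<subseteq> (\<lambda>(u, v). A u \<otimes>\<^bsub>H\<^esub> A v) ` (V \<times> V)"
      unfolding edge_sums_def by force
    then show ?thesis using fin by (meson finite_SigmaI finite_imageI finite_subset)
  qed
  ultimately have "sum_number_in ?I V E \<le> enat (card (edge_sums H E A))"
    using card_image_le[of "edge_sums H E A" f] order_trans enat_ord_simps(1) by metis
  then show ?thesis using cI unfolding sum_number_def by (intro INF_lower2[of ?I]) auto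
qed

lemma sum_number_le:
  fixes H :: "('h, 'm) monoid_scheme"
  assumes "simple_graph V E" "comm_group H"
  shows "sum_number V E \<le> sum_number_in H V E"
  unfolding sum_number_in_def using assms by (intro INF_greatest sum_number_le_card) auto

end

theory Submission
  imports Defs
begin

text \<open>
  Linear bound: if \<open>2 d t < n\<close>, the packing argument of Sauer and Spencer places the vertices
  bijectively on the integers modulo \<open>n\<close> so that \<open>t\<close> prescribed sums never occur on an edge.

  Power bound: following Alon and Capalbo's construction of universal graphs, cover the edges by
  \<open>d\<close> subgraphs such that every edge lies in two of them and every subgraph is path-like, in the
  sense that it can be arranged in layers of bounded size. For even \<open>d\<close> this is Petersen's 2-factor
  theorem. For odd \<open>d\<close> one removes a matching \<open>M\<close> whose uncovered vertices of degree \<open>d\<close> lie in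
  separate vertex sets with few outgoing edges (Gallai--Edmonds), splits the rest by Petersen's
  theorem, and covers \<open>M\<close> by splitting one of the 2-factors again after contracting \<open>M\<close>.
  In coordinate \<open>i < d\<close>, a vertex gets \<open>k\<close> random bits, and moving along the layers of the
  \<open>i\<close>-th subgraph refreshes them cyclically, one per step. Then every edge changes at most one bit
  in each of two coordinates, so the sums fill only a fraction of about \<open>(d k)\<^sup>2 / 4^k\<close> of the group,
  and labels that are far apart in the layerings are independent, so every label is taken by about
  \<open>n / 2^(d k)\<close> vertices if \<open>2^(d k)\<close> is about \<open>n / (ln n)\<^sup>2\<close>. A second, integer component separates
  the vertices with the same label.
\<close>

section \<open>Matchings in bipartite graphs\<close>

text \<open>The exponents come from the size of \<open>k\<close>. In the two coordinates where an
  edge is controlled, \<open>(k+1)^2\<close> difference patterns remain out of \<open>4^k\<close>.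
  Since \<open>4^k\<close> is about \<open>(n / (ln n)^2)^(2/d)\<close>, this yields
  \<open>n^(1 - 2/d)\<close> and \<open>(ln n)^(4/d)\<close>. The factor \<open>d^2 (ln n)^2\<close>
  pays for the pair of coordinates and the positions of the changed bits. Taking
  \<open>2^(d k)\<close> smaller than \<open>n\<close> by \<open>(ln n)^2\<close> pays for
  dependence: the vertices split into O(\<open>ln n\<close>) classes with independent labels, and
  each class adds O(\<open>ln n\<close>) to the largest fibre.

  The obstacle is odd \<open>d\<close>. Rounding up to \<open>d + 1\<close> before Petersen's
  theorem would give only the exponent \<open>1 - 2/(d+1)\<close>. A matching that meets all
  vertices of degree \<open>d\<close> would repair this, but need not exist. The vertices that have
  to be missed sit behind cuts of at most \<open>d - 2\<close> edges, and averaging over the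
  \<open>(d-1)/2\<close> factors finds one that crosses such a cut at most once. A missing edge
  behind the cut is put back into that factor. A component can meet only two such cuts, so the
  reinserted edges leave its layers bounded.\<close>

theorem hall_marriage:
  assumes "finite A" and "\<And>a. a \<in> A \<Longrightarrow> finite (N a)"
    and "\<And>B. B \<subseteq> A \<Longrightarrow> card B \<le> card (\<Union>(N ` B))"
  shows "\<exists>f. inj_on f A \<and> (\<forall>a\<in>A. f a \<in> N a)"
  using assms
proof (induction "card A" arbitrary: A N rule: less_induct)
  case less
  note fin = less.prems(1) and finN = less.prems(2) and hall = less.prems(3)
  show ?case
  proof (cases "A = {}")
    case True
    then show ?thesis by auto
  next
    case nonempty: False
    \<comment> \<open>Induction of Halmos and Vaughan. If a nonempty proper subset \<open>B\<close>
      is tight, \<open>B\<close> and its complement are matched separately, the latter avoiding all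
      neighbours of \<open>B\<close>. Otherwise every nonempty proper subset has a neighbour to
      spare, and any one pair can be fixed.\<close>
    show ?thesis
    proof (cases "\<exists>B. B \<subset> A \<and> B \<noteq> {} \<and> card B = card (\<Union>(N ` B))")
      case True
      then obtain B where B: "B \<subset> A" "B \<noteq> {}" "card B = card (\<Union>(N ` B))" by blast
      let ?Y = "\<Union>(N ` B)"
      have finB: "finite B" using B(1) fin by (meson finite_subset psubset_imp_subset)
      have "\<exists>f. inj_on f B \<and> (\<forall>a\<in>B. f a \<in> N a)"
        using B(1) fin finN finB by (intro less.hyps hall psubset_card_mono) auto
      then obtain f where f: "inj_on f B" "\<forall>a\<in>B. f a \<in> N a" by blast
      have "\<exists>g. inj_on g (A - B) \<and> (\<forall>a\<in>A - B. g a \<in> N a - ?Y)"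
      proof (rule less.hyps)
        show "card (A - B) < card A"
          using B fin by (intro psubset_card_mono) auto
        fix C assume C: "C \<subseteq> A - B"
        have finC: "finite C" using C fin by (auto intro: finite_subset)
        have "card C + card B = card (C \<union> B)"
          using C finC finB by (subst card_Un_disjoint) auto
        also have "\<dots> \<le> card (\<Union>(N ` (C \<union> B)))" using C B by (intro hall) auto
        also have "\<Union>(N ` (C \<union> B)) = \<Union>((\<lambda>a. N a - ?Y) ` C) \<union> ?Y" by auto
        also have "card \<dots> \<le> card (\<Union>((\<lambda>a. N a - ?Y) ` C)) + card ?Y" by (rule card_Un_le)
        finally show "card C \<le> card (\<Union>((\<lambda>a. N a - ?Y) ` C))" using B(3) by simp
      qed (use fin finN in auto)
      then obtain g where g: "inj_on g (A - B)" "\<forall>a\<in>A - B. g a \<in> N a - ?Y" by blast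
      have "f ` B \<subseteq> ?Y" using f(2) by auto
      moreover have "g ` (A - B) \<inter> ?Y = {}"
      proof -
        have "g a \<notin> ?Y" if "a \<in> A - B" for a using g(2)[THEN bspec, OF that] by simp
        then show ?thesis by auto
      qed
      ultimately have "f ` B \<inter> g ` (A - B) = {}" by (meson disjoint_iff subsetD)
      moreover have "B \<union> (A - B) = A" using B by blast
      ultimately have "inj_on (\<lambda>a. if a \<in> B then f a else g a) A"
        using inj_on_disjoint_Un[OF f(1) g(1)] by simp
      then show ?thesis using f(2) g(2) by (intro exI[of _ "\<lambda>a. if a \<in> B then f a else g a"]) auto
    next
      case False
      obtain a where a: "a \<in> A" using nonempty by blast
      have "card {a} \<le> card (\<Union>(N ` {a}))" using a by (intro hall) auto
      then obtain y where y: "y \<in> N a" by (cases "N a = {}") auto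
      have "\<exists>g. inj_on g (A - {a}) \<and> (\<forall>b\<in>A - {a}. g b \<in> N b - {y})"
      proof (rule less.hyps)
        show "card (A - {a}) < card A" using a fin by (intro psubset_card_mono) auto
        fix C assume C: "C \<subseteq> A - {a}"
        have eq: "\<Union>((\<lambda>b. N b - {y}) ` C) = \<Union>(N ` C) - {y}" by auto
        show "card C \<le> card (\<Union>((\<lambda>b. N b - {y}) ` C))"
        proof (cases "C = {}")
          case False
          moreover have "card C \<le> card (\<Union>(N ` C))" using C by (intro hall) auto
          moreover have "card C \<noteq> card (\<Union>(N ` C))"
            using \<open>\<not> (\<exists>B. B \<subset> A \<and> B \<noteq> {} \<and> card B = card (\<Union>(N ` B)))\<close> False C a by blast
          ultimately have "card C \<le> card (\<Union>(N ` C)) - 1" by linarith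
          also have "\<dots> \<le> card (\<Union>(N ` C) - {y})" by (simp add: card_Diff_singleton_if)
          finally show ?thesis unfolding eq .
        qed auto
      qed (use fin finN in auto)
      then obtain g where g: "inj_on g (A - {a})" "\<forall>b\<in>A - {a}. g b \<in> N b - {y}" by blast
      have "inj_on (g(a := y)) A" using g by (auto simp: inj_on_def split: if_splits)
      then show ?thesis using g(2) y by (intro exI[of _ "g(a := y)"]) auto
    qed
  qed
qed

text \<open>The fixed point makes \<open>X' = X - m2 ` (Y - m1 ` X')\<close>, as in the Schroeder--Bernstein theorem.\<close>

theorem mendelsohn_dulmage:
  assumes m1: "inj_on m1 X" "\<And>x. x \<in> X \<Longrightarrow> R x (m1 x)"
    and m2: "inj_on m2 Y" "\<And>y. y \<in> Y \<Longrightarrow> R (m2 y) y"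
  shows "\<exists>P. (\<forall>(x, y)\<in>P. R x y) \<and> inj_on fst P \<and> inj_on snd P \<and> X \<subseteq> fst ` P \<and> Y \<subseteq> snd ` P"
proof -
  define \<phi> where "\<phi> X' = X - m2 ` (Y - m1 ` X')" for X'
  have "mono \<phi>" unfolding mono_def \<phi>_def by blast
  then obtain X' where X': "X' = X - m2 ` (Y - m1 ` X')"
    using lfp_unfold[of \<phi>] unfolding \<phi>_def by blast
  define Y' where "Y' = Y - m1 ` X'"
  define P where "P = (\<lambda>x. (x, m1 x)) ` X' \<union> (\<lambda>y. (m2 y, y)) ` Y'"
  have X'': "X' = X - m2 ` Y'" using X' Y'_def by simp
  have sub: "X' \<subseteq> X" "Y' \<subseteq> Y" using X'' Y'_def by auto
  have "inj_on fst P" unfolding P_def inj_on_def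
    using X'' inj_on_subset[OF m2(1) sub(2)] by (auto dest: inj_onD)
  moreover have "inj_on snd P" unfolding P_def inj_on_def
    using Y'_def inj_on_subset[OF m1(1) sub(1)] by (auto dest: inj_onD)
  moreover have "\<forall>(x, y)\<in>P. R x y" using m1(2) m2(2) sub by (auto simp: P_def)
  moreover have "X \<subseteq> fst ` P"
  proof
    fix x assume "x \<in> X"
    then have "x \<in> X' \<or> x \<in> m2 ` Y'" using X'' by blast
    then show "x \<in> fst ` P" by (force simp: P_def image_Un image_image)
  qed
  moreover have "Y \<subseteq> snd ` P"
  proof
    fix y assume "y \<in> Y"
    then have "y \<in> Y' \<or> y \<in> m1 ` X'" using Y'_def by blast
    then show "y \<in> snd ` P" by (force simp: P_def image_Un image_image)
  qed
  ultimately show ?thesis by blast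
qed

text \<open>Hall's theorem from either side gives two matchings, and
  \<open>mendelsohn_dulmage\<close> merges them. Partners may lie outside \<open>X\<close> and
  \<open>Y\<close>, so these sets can be just the vertices that must be covered on each
  side.\<close>

lemma symmetric_hall:
  assumes finX: "finite X" and finY: "finite Y"
    and finRX: "\<And>x. x \<in> X \<Longrightarrow> finite {y. R x y}" and finRY: "\<And>y. y \<in> Y \<Longrightarrow> finite {x. R x y}"
    and X: "\<And>X'. X' \<subseteq> X \<Longrightarrow> card X' \<le> card {y. \<exists>x\<in>X'. R x y}"
    and Y: "\<And>Y'. Y' \<subseteq> Y \<Longrightarrow> card Y' \<le> card {x. \<exists>y\<in>Y'. R x y}"
  shows "\<exists>P. (\<forall>(x, y)\<in>P. R x y) \<and> inj_on fst P \<and> inj_on snd P \<and> X \<subseteq> fst ` P \<and> Y \<subseteq> snd ` P"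
proof -
  have "\<Union>((\<lambda>x. {y. R x y}) ` X') = {y. \<exists>x\<in>X'. R x y}" for X' by auto
  then have "\<exists>f. inj_on f X \<and> (\<forall>x\<in>X. f x \<in> {y. R x y})"
    using finX finRX X by (intro hall_marriage) auto
  moreover have "\<Union>((\<lambda>y. {x. R x y}) ` Y') = {x. \<exists>y\<in>Y'. R x y}" for Y' by auto
  then have "\<exists>f. inj_on f Y \<and> (\<forall>y\<in>Y. f y \<in> {x. R x y})"
    using finY finRY Y by (intro hall_marriage) auto
  ultimately obtain m1 m2 where "inj_on m1 X" "\<forall>x\<in>X. R x (m1 x)"
    "inj_on m2 Y" "\<forall>y\<in>Y. R (m2 y) y" by auto
  then show ?thesis by (intro mendelsohn_dulmage[of m1 X R m2 Y]) auto
qed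

section \<open>Edge colourings and 2-factors\<close>

lemma sum_card_fibres:
  assumes "finite F" "finite W"
  shows "(\<Sum>v\<in>W. card {e \<in> F. f e = v}) = card {e \<in> F. f e \<in> W}"
proof -
  have "{e \<in> F. f e \<in> W} = (\<Union>v\<in>W. {e \<in> F. f e = v})" by auto
  moreover have "card (\<Union>v\<in>W. {e \<in> F. f e = v}) = (\<Sum>v\<in>W. card {e \<in> F. f e = v})"
    using assms by (intro card_UN_disjoint) auto
  ultimately show ?thesis by simp
qed

lemma card_filter_eq_sum: "finite E \<Longrightarrow> card {e \<in> E. P e} = (\<Sum>e\<in>E. if P e then 1 else 0)"
  by (simp add: sum.If_cases Int_def)

lemma card_reorient:
  assumes "finite E" and "\<And>e. e \<in> E \<Longrightarrow> t e = a e \<and> h e = b e \<or> t e = b e \<and> h e = a e"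
  shows "card {e \<in> E. P e \<and> t e = v} + card {e \<in> E. P e \<and> h e = v} =
    card {e \<in> E. P e \<and> a e = v} + card {e \<in> E. P e \<and> b e = v}"
  unfolding card_filter_eq_sum[OF assms(1)] sum.distrib[symmetric]
proof (intro sum.cong refl)
  fix e assume "e \<in> E"
  from assms(2)[OF this]
  show "(if P e \<and> t e = v then 1 else 0) + (if P e \<and> h e = v then 1 else 0) =
    (if P e \<and> a e = v then 1 else 0) + (if P e \<and> b e = v then 1 else (0::nat))"
    by (elim disjE) simp_all
qed

text \<open>Every edge is matched to one of \<open>q\<close> slots at one of its ends, which becomes
  its tail, so outdegrees are at most \<open>q\<close>. The slots in \<open>Y\<close> must all be
  filled: they force outdegree at least \<open>dg v - q\<close>, hence indegree at most
  \<open>q\<close>. Both Hall conditions follow by counting edge ends, since all degrees are at most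
  \<open>2 * q\<close>. Abstract edges with end functions \<open>a\<close> and \<open>b\<close>
  allow parallel edges, which appear once a matching is contracted.\<close>

lemma balanced_orientation:
  fixes a b :: "'e \<Rightarrow> 'v"
  assumes finE: "finite E" and deg: "\<And>v. card {e \<in> E. a e = v} + card {e \<in> E. b e = v} \<le> 2 * q"
  shows "\<exists>t h. (\<forall>e\<in>E. t e = a e \<and> h e = b e \<or> t e = b e \<and> h e = a e) \<and>
    (\<forall>v. card {e \<in> E. t e = v} \<le> q) \<and> (\<forall>v. card {e \<in> E. h e = v} \<le> q)"
proof -
  define dg where "dg v = card {e \<in> E. a e = v} + card {e \<in> E. b e = v}" for v
  define V where "V = a ` E \<union> b ` E"
  define R where "R e = (\<lambda>(v, j). e \<in> E \<and> j < q \<and> (a e = v \<or> b e = v))" for e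
  define Y where "Y = Sigma V (\<lambda>v. {..<dg v - q})"
  have finV: "finite V" using finE by (simp add: V_def)
  have dg: "dg v \<le> 2 * q" for v using deg by (simp add: dg_def)
  have "\<exists>P. (\<forall>(e, s)\<in>P. R e s) \<and> inj_on fst P \<and> inj_on snd P \<and> E \<subseteq> fst ` P \<and> Y \<subseteq> snd ` P"
  proof (rule symmetric_hall)
    show "finite E" "finite Y" using finE finV by (auto simp: Y_def)
    show "finite {s. R e s}" if "e \<in> E" for e
      by (rule finite_subset[of _ "{a e, b e} \<times> {..<q}"]) (auto simp: R_def)
    show "finite {e. R e s}" if "s \<in> Y" for s
      using finE by (rule rev_finite_subset) (auto simp: R_def)
  next
    fix X' assume X': "X' \<subseteq> E"
    let ?W = "a ` X' \<union> b ` X'"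
    have fin: "finite X'" "finite ?W" using X' finE by (auto intro: finite_subset)
    have "{e \<in> X'. a e \<in> ?W} = X'" "{e \<in> X'. b e \<in> ?W} = X'" by auto
    then have "2 * card X' = (\<Sum>v\<in>?W. card {e \<in> X'. a e = v} + card {e \<in> X'. b e = v})"
      using fin by (simp add: sum.distrib sum_card_fibres)
    also have "\<dots> \<le> (\<Sum>v\<in>?W. 2 * q)"
    proof (rule sum_mono)
      fix v
      have "card {e \<in> X'. a e = v} + card {e \<in> X'. b e = v} \<le> dg v"
        unfolding dg_def using X' finE by (intro add_mono card_mono) auto
      then show "card {e \<in> X'. a e = v} + card {e \<in> X'. b e = v} \<le> 2 * q" using dg[of v] by simp
    qed
    also have "\<dots> = 2 * card (?W \<times> {..<q})" by (simp add: card_cartesian_product)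
    finally have "card X' \<le> card (?W \<times> {..<q})" by simp
    also have "?W \<times> {..<q} = {s. \<exists>e\<in>X'. R e s}" using X' by (auto simp: R_def)
    finally show "card X' \<le> card {s. \<exists>e\<in>X'. R e s}" .
  next
    fix Y' assume Y': "Y' \<subseteq> Y"
    let ?W = "fst ` Y'" and ?N = "{e \<in> E. a e \<in> fst ` Y' \<or> b e \<in> fst ` Y'}"
    have finW: "finite ?W" using Y' finV by (auto simp: Y_def intro!: finite_subset[OF _ finV])
    have "Y' \<subseteq> Sigma ?W (\<lambda>v. {..<dg v - q})" using Y' by (force simp: Y_def)
    then have "card Y' \<le> card (Sigma ?W (\<lambda>v. {..<dg v - q}))"
      using finW by (intro card_mono) auto
    also have "\<dots> = (\<Sum>v\<in>?W. dg v - q)" using finW by simp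
    finally have "2 * card Y' \<le> (\<Sum>v\<in>?W. 2 * (dg v - q))"
      unfolding sum_distrib_left[symmetric] by (rule mult_le_mono2)
    also have "\<dots> \<le> (\<Sum>v\<in>?W. dg v)"
    proof (rule sum_mono)
      fix v show "2 * (dg v - q) \<le> dg v" using dg[of v] by linarith
    qed
    also have "\<dots> = card {e \<in> E. a e \<in> ?W} + card {e \<in> E. b e \<in> ?W}"
      using finE finW by (simp add: dg_def sum.distrib sum_card_fibres)
    also have "\<dots> \<le> card ?N + card ?N" using finE by (intro add_mono card_mono) auto
    finally have "card Y' \<le> card ?N" by simp
    also have "?N = {e. \<exists>s\<in>Y'. R e s}"
    proof -
      have "j < q" if "(v, j) \<in> Y'" for v j using that Y' dg[of v] by (auto simp: Y_def)
      then show ?thesis by (force simp: R_def)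
    qed
    finally show "card Y' \<le> card {e. \<exists>s\<in>Y'. R e s}" .
  qed
  then obtain P where "\<forall>(e, s)\<in>P. R e s" and P': "inj_on fst P" "inj_on snd P"
    "E \<subseteq> fst ` P" "Y \<subseteq> snd ` P" by (elim exE conjE)
  then have "\<And>e s. (e, s) \<in> P \<Longrightarrow> R e s" by auto
  note P = this P'
  have "\<forall>e\<in>E. \<exists>s. (e, s) \<in> P" using P(4) by force
  then obtain s where s: "\<And>e. e \<in> E \<Longrightarrow> (e, s e) \<in> P" by metis
  have injs: "inj_on s E"
  proof (rule inj_onI)
    fix e e' assume "e \<in> E" "e' \<in> E" "s e = s e'"
    then show "e = e'" using inj_onD[OF P(3) _ s s, of e e'] by simp
  qed
  define t where "t e = fst (s e)" for e
  define h where "h e = (if t e = a e then b e else a e)" for e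
  have th: "t e = a e \<and> h e = b e \<or> t e = b e \<and> h e = a e" if "e \<in> E" for e
    using P(1)[OF s[OF that]] by (auto simp: R_def t_def h_def)
  have out_le: "card {e \<in> E. t e = v} \<le> q" for v
  proof -
    have "inj_on (snd \<circ> s) {e \<in> E. t e = v}"
      using injs by (auto simp: inj_on_def t_def prod_eq_iff)
    moreover have "(snd \<circ> s) ` {e \<in> E. t e = v} \<subseteq> {..<q}"
      using P(1)[OF s] by (auto simp: R_def t_def case_prod_beta)
    ultimately show ?thesis by (metis card_inj_on_le card_lessThan finite_lessThan)
  qed
  have total: "card {e \<in> E. t e = v} + card {e \<in> E. h e = v} = dg v" for v
    unfolding dg_def using card_reorient[OF finE th, where P = "\<lambda>_. True"] by simp
  have out_ge: "dg v - q \<le> card {e \<in> E. t e = v}" for v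
  proof (cases "v \<in> V")
    case True
    have "{v} \<times> {..<dg v - q} \<subseteq> s ` {e \<in> E. t e = v}"
    proof
      fix y assume y: "y \<in> {v} \<times> {..<dg v - q}"
      then have "y \<in> snd ` P" using P(5) True by (auto simp: Y_def)
      then obtain e where e: "(e, y) \<in> P" by auto
      then have eE: "e \<in> E" using P(1)[OF e] by (auto simp: R_def split: prod.splits)
      then have "s e = y" using inj_onD[OF P(2) _ s[OF eE] e] by simp
      then show "y \<in> s ` {e \<in> E. t e = v}" using eE y by (auto simp: t_def)
    qed
    then have "card ({v} \<times> {..<dg v - q}) \<le> card {e \<in> E. t e = v}"
      using finE by (intro surj_card_le) auto
    then show ?thesis by (simp add: card_cartesian_product)
  next
    case False
    then have "{e \<in> E. a e = v} = {}" "{e \<in> E. b e = v} = {}" by (auto simp: V_def)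
    then have "dg v = 0" unfolding dg_def by (simp only: card.empty)
    then show ?thesis by simp
  qed
  have "card {e \<in> E. h e = v} \<le> q" for v
    using dg[of v] total[of v] out_ge[of v] by linarith
  then show ?thesis using th out_le by blast
qed

lemma card_fibre_SucD: "card {e \<in> E. f e = x} = Suc q \<Longrightarrow> x \<in> f ` E"
  by (cases "{e \<in> E. f e = x} = {}") auto

text \<open>Double counting: \<open>Suc q\<close> edges leave each vertex of \<open>X'\<close>, and
  each neighbour receives at most \<open>Suc q\<close> of them.\<close>

lemma card_le_card_neighbours:
  assumes finE: "finite E" and X': "finite X'" "\<And>x. x \<in> X' \<Longrightarrow> card {e \<in> E. f e = x} = Suc q"
    and dg: "\<And>y. card {e \<in> E. g e = y} \<le> Suc q"
  shows "card X' \<le> card {y. \<exists>x\<in>X'. \<exists>e\<in>E. f e = x \<and> g e = y}"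
proof -
  let ?N = "{y. \<exists>x\<in>X'. \<exists>e\<in>E. f e = x \<and> g e = y}"
  have finN: "finite ?N" using finE by (rule finite_subset[rotated, OF finite_imageI[of E g]]) auto
  have "Suc q * card X' = (\<Sum>x\<in>X'. card {e \<in> E. f e = x})" using X' by simp
  also have "\<dots> = card {e \<in> E. f e \<in> X'}" using finE X' by (simp only: sum_card_fibres)
  also have "\<dots> \<le> card {e \<in> E. g e \<in> ?N}" using finE by (intro card_mono) auto
  also have "\<dots> = (\<Sum>y\<in>?N. card {e \<in> E. g e = y})" using finE finN by (simp only: sum_card_fibres)
  also have "\<dots> \<le> (\<Sum>y\<in>?N. Suc q)" using dg by (intro sum_mono) auto
  also have "\<dots> = Suc q * card ?N" by (simp only: sum_constant of_nat_id mult.commute)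
  finally show ?thesis by (simp only: Suc_mult_le_cancel1)
qed

lemma card_fibre_Diff_le:
  assumes "finite E" "M \<subseteq> E" "card {e \<in> E. f e = x} \<le> Suc q"
    and "card {e \<in> E. f e = x} = Suc q \<Longrightarrow> \<exists>e\<in>M. f e = x"
  shows "card {e \<in> E - M. f e = x} \<le> q"
proof (cases "card {e \<in> E. f e = x} = Suc q")
  case True
  then obtain e where "e \<in> M" "f e = x" using assms by blast
  then have "card {e \<in> E - M. f e = x} < card {e \<in> E. f e = x}"
    using assms by (intro psubset_card_mono) auto
  then show ?thesis using True by simp
next
  case False
  have "card {e \<in> E - M. f e = x} \<le> card {e \<in> E. f e = x}"
    using assms by (intro card_mono) auto
  then show ?thesis using False assms(3) by simp
qed

lemma inj_on_new_colour:
  assumes "inj_on f M" "inj_on (\<lambda>e. (f e, col e)) (E - M)" "\<forall>e\<in>E - M. col e < (q::nat)"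
  shows "inj_on (\<lambda>e. (f e, if e \<in> M then q else col e)) E"
proof (rule inj_onI)
  fix e e' assume e: "e \<in> E" "e' \<in> E"
    "(f e, if e \<in> M then q else col e) = (f e', if e' \<in> M then q else col e')"
  then have "e \<in> M \<longleftrightarrow> e' \<in> M" using assms(3) by (force split: if_splits)
  then show "e = e'" using e assms(1,2) by (auto simp: inj_on_def split: if_splits)
qed

text \<open>Koenig's induction on the degree: by \<open>symmetric_hall\<close> some matching meets
  all vertices of degree \<open>Suc q\<close> on both sides. It takes the new colour
  \<open>q\<close>, and the remaining edges have degree at most \<open>q\<close>.\<close>

theorem bipartite_edge_colouring:
  assumes "finite E" and "\<And>x. card {e \<in> E. t e = x} \<le> q" and "\<And>y. card {e \<in> E. h e = y} \<le> q"
  shows "\<exists>col. (\<forall>e\<in>E. col e < q) \<and> inj_on (\<lambda>e. (t e, col e)) E \<and> inj_on (\<lambda>e. (h e, col e)) E"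
  using assms
proof (induction q arbitrary: E)
  case 0
  have "e \<notin> E" for e
    using 0(2)[of "t e"] \<open>finite E\<close> by auto
  then have "E = {}" by blast
  then show ?case by auto
next
  case (Suc q)
  note finE = Suc.prems(1) and dt = Suc.prems(2) and dh = Suc.prems(3)
  define X where "X = {x. card {e \<in> E. t e = x} = Suc q}"
  define Y where "Y = {y. card {e \<in> E. h e = y} = Suc q}"
  define R where "R x y \<longleftrightarrow> (\<exists>e\<in>E. t e = x \<and> h e = y)" for x y
  have X: "X \<subseteq> t ` E" and Y: "Y \<subseteq> h ` E"
    unfolding X_def Y_def by (auto dest: card_fibre_SucD)
  have finX: "finite X" "finite Y" using X Y finE by (auto intro: finite_subset)
  have "\<exists>P. (\<forall>(x, y)\<in>P. R x y) \<and> inj_on fst P \<and> inj_on snd P \<and> X \<subseteq> fst ` P \<and> Y \<subseteq> snd ` P"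
  proof (rule symmetric_hall)
    show "finite {y. R x y}" for x
      using finE by (rule finite_subset[rotated, OF finite_imageI[of E h]]) (auto simp: R_def)
    show "finite {x. R x y}" for y
      using finE by (rule finite_subset[rotated, OF finite_imageI[of E t]]) (auto simp: R_def)
    show "card X' \<le> card {y. \<exists>x\<in>X'. R x y}" if X': "X' \<subseteq> X" for X'
      unfolding R_def using X' dh
      by (intro card_le_card_neighbours finE finite_subset[OF X' finX(1)]) (auto simp: X_def)
    show "card Y' \<le> card {x. \<exists>y\<in>Y'. R x y}" if Y': "Y' \<subseteq> Y" for Y'
    proof -
      have "{x. \<exists>y\<in>Y'. R x y} = {x. \<exists>y\<in>Y'. \<exists>e\<in>E. h e = y \<and> t e = x}"
        unfolding R_def by blast
      moreover have "finite Y'" using Y' finX(2) by (rule finite_subset)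
      moreover have "card {e \<in> E. h e = y} = Suc q" if "y \<in> Y'" for y
        using that Y' by (auto simp: Y_def)
      ultimately show ?thesis
        using card_le_card_neighbours[OF finE, of Y' h q t] dt by simp
    qed
    show "finite X" "finite Y" by fact+
  qed
  then obtain P where P: "\<forall>(x, y)\<in>P. R x y" "inj_on fst P" "inj_on snd P"
    "X \<subseteq> fst ` P" "Y \<subseteq> snd ` P" by (elim exE conjE)
  have "\<forall>p\<in>P. \<exists>e\<in>E. t e = fst p \<and> h e = snd p" using P(1) by (auto simp: R_def case_prod_beta)
  then obtain c where c: "\<And>p. p \<in> P \<Longrightarrow> c p \<in> E \<and> t (c p) = fst p \<and> h (c p) = snd p" by metis
  define M where "M = c ` P"
  have ME: "M \<subseteq> E" using c by (auto simp: M_def)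
  have Mt: "\<exists>e\<in>M. t e = x" if x: "card {e \<in> E. t e = x} = Suc q" for x
  proof -
    obtain p where "p \<in> P" "x = fst p" using P(4) x by (auto simp: X_def)
    then show ?thesis using c[of p] by (auto simp: M_def)
  qed
  have Mh: "\<exists>e\<in>M. h e = y" if y: "card {e \<in> E. h e = y} = Suc q" for y
  proof -
    obtain p where "p \<in> P" "y = snd p" using P(5) y by (auto simp: Y_def)
    then show ?thesis using c[of p] by (auto simp: M_def)
  qed
  obtain col where col: "\<forall>e\<in>E - M. col e < q"
    "inj_on (\<lambda>e. (t e, col e)) (E - M)" "inj_on (\<lambda>e. (h e, col e)) (E - M)"
    using Suc.IH[of "E - M", OF finite_Diff[OF finE] card_fibre_Diff_le[OF finE ME dt Mt]
      card_fibre_Diff_le[OF finE ME dh Mh]] by blast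
  have injM: "inj_on t M" "inj_on h M"
    using c P(2,3) by (auto simp: M_def inj_on_def)
  have "\<forall>e\<in>E. (if e \<in> M then q else col e) < Suc q" using col(1) by (auto simp: less_Suc_eq)
  then show ?case
    using inj_on_new_colour[OF injM(1) col(2,1)] inj_on_new_colour[OF injM(2) col(3,1)]
    by (intro exI[of _ "\<lambda>e. if e \<in> M then q else col e"] conjI)
qed

text \<open>After a balanced orientation, tails and heads form the two sides of a bipartite
  multigraph of degree at most \<open>q\<close>. Each of its \<open>q\<close> colours has at most
  one edge leaving and one edge entering a vertex.\<close>

theorem petersen_two_factors:
  fixes a b :: "'e \<Rightarrow> 'v"
  assumes finE: "finite E" and deg: "\<And>v. card {e \<in> E. a e = v} + card {e \<in> E. b e = v} \<le> 2 * q"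
  shows "\<exists>col. (\<forall>e\<in>E. col e < q) \<and>
    (\<forall>i v. card {e \<in> E. col e = i \<and> a e = v} + card {e \<in> E. col e = i \<and> b e = v} \<le> 2)"
proof -
  obtain t h where th: "\<And>e. e \<in> E \<Longrightarrow> t e = a e \<and> h e = b e \<or> t e = b e \<and> h e = a e"
    and q: "\<And>v. card {e \<in> E. t e = v} \<le> q" "\<And>v. card {e \<in> E. h e = v} \<le> q"
    using balanced_orientation[of E a b q, OF finE deg] by blast
  obtain col where col: "\<forall>e\<in>E. col e < q" "inj_on (\<lambda>e. (t e, col e)) E" "inj_on (\<lambda>e. (h e, col e)) E"
    using bipartite_edge_colouring[of E t q h, OF finE q] by blast
  have "card {e \<in> E. col e = i \<and> a e = v} + card {e \<in> E. col e = i \<and> b e = v} \<le> 2" for i v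
  proof -
    have "card {e \<in> E. col e = i \<and> f e = v} \<le> 1" if "inj_on (\<lambda>e. (f e, col e)) E" for f :: "'e \<Rightarrow> 'v"
      using that finE by (subst card_le_Suc0_iff_eq[unfolded One_nat_def[symmetric]]) (auto simp: inj_on_def)
    then have "card {e \<in> E. col e = i \<and> t e = v} + card {e \<in> E. col e = i \<and> h e = v} \<le> 2"
      using col(2,3) by (metis (no_types, lifting) add_mono one_add_one)
    moreover have "card {e \<in> E. col e = i \<and> t e = v} + card {e \<in> E. col e = i \<and> h e = v} =
        card {e \<in> E. col e = i \<and> a e = v} + card {e \<in> E. col e = i \<and> b e = v}"
      by (rule card_reorient[OF finE th])
    ultimately show ?thesis by simp
  qed
  then show ?thesis using col(1) by blast
qed

section \<open>Tutte's theorem and barriers\<close>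

text \<open>The members \<open>K\<close> play the role of the odd components of \<open>W - T\<close>, but they need not be
  connected; they only have to be unions of components. This makes the leftover set
  \<open>W - T - \<Union>\<O>\<close> a possible member as well, and no notion of connectivity is needed.\<close>

definition odd_family :: "'a set set \<Rightarrow> 'a set \<Rightarrow> 'a set \<Rightarrow> 'a set set \<Rightarrow> bool" where
  "odd_family E W T \<O> \<longleftrightarrow> T \<subseteq> W \<and> pairwise disjnt \<O> \<and>
    (\<forall>K\<in>\<O>. K \<subseteq> W - T \<and> odd (card K) \<and> (\<forall>u\<in>K. \<forall>v\<in>W - T - K. {u, v} \<notin> E))"

definition tutte_condition :: "'a set set \<Rightarrow> 'a set \<Rightarrow> bool" where
  "tutte_condition E W \<longleftrightarrow> (\<forall>T \<O>. odd_family E W T \<O> \<longrightarrow> card \<O> \<le> card T)"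

definition perfect_matching :: "'a set set \<Rightarrow> 'a set \<Rightarrow> 'a set set \<Rightarrow> bool" where
  "perfect_matching E W M \<longleftrightarrow> M \<subseteq> E \<and> pairwise disjnt M \<and> \<Union>M = W"

lemma odd_family_finite:
  assumes "odd_family E W T \<O>" "finite W"
  shows "finite \<O>" "finite T" "\<And>K. K \<in> \<O> \<Longrightarrow> finite K"
proof -
  have "\<O> \<subseteq> Pow W" using assms by (auto simp: odd_family_def)
  then show "finite \<O>" "\<And>K. K \<in> \<O> \<Longrightarrow> finite K"
    using assms(2) by (auto intro: finite_subset)
  show "finite T" using assms by (auto simp: odd_family_def intro: finite_subset)
qed

lemma even_sum_odd_iff: "finite A \<Longrightarrow> (\<And>a. a \<in> A \<Longrightarrow> odd (f a)) \<Longrightarrow> even (sum f A) \<longleftrightarrow> even (card A)"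
  for f :: "'a \<Rightarrow> nat"
  by (induction A rule: finite_induct) auto

lemma odd_card_leftover_iff:
  assumes "odd_family E W T \<O>" "finite W"
  shows "odd (card (W - T - \<Union>\<O>)) \<longleftrightarrow> odd (card W + card T + card \<O>)"
proof -
  note fin = odd_family_finite[OF assms]
  have sub: "T \<subseteq> W" "\<Union>\<O> \<subseteq> W - T" using assms(1) by (auto simp: odd_family_def)
  have "card (W - T - \<Union>\<O>) + card (\<Union>\<O>) = card (W - T)"
    using sub assms(2) by (metis card_Diff_subset card_mono finite_Diff finite_subset le_add_diff_inverse2)
  moreover have "card (W - T) + card T = card W"
    using sub(1) assms(2) by (metis card_Diff_subset card_mono finite_subset le_add_diff_inverse2)
  moreover have "card (\<Union>\<O>) = sum card \<O>"
    using assms(1) fin(3) by (intro card_Union_disjoint) (auto simp: odd_family_def)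
  ultimately have eq: "card W + card T + card \<O> = card (W - T - \<Union>\<O>) + (sum card \<O> + card \<O>) + 2 * card T"
    by linarith
  have "even (sum card \<O>) \<longleftrightarrow> even (card \<O>)"
    using assms(1) fin(1) by (intro even_sum_odd_iff) (auto simp: odd_family_def)
  then show ?thesis unfolding eq by simp
qed

lemma odd_family_leftover:
  assumes "odd_family E W T \<O>"
  shows "\<And>u v. u \<in> W - T - \<Union>\<O> \<Longrightarrow> v \<in> \<Union>\<O> \<Longrightarrow> {u, v} \<notin> E"
    and "odd (card (W - T - \<Union>\<O>)) \<Longrightarrow> odd_family E W T (insert (W - T - \<Union>\<O>) \<O>)"
proof -
  show closed: "{u, v} \<notin> E" if uv: "u \<in> W - T - \<Union>\<O>" "v \<in> \<Union>\<O>" for u v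
  proof -
    obtain K where K: "K \<in> \<O>" "v \<in> K" using uv by blast
    then have "{v, u} \<notin> E" using assms uv K unfolding odd_family_def by blast
    then show ?thesis by (simp add: insert_commute)
  qed
  assume odd: "odd (card (W - T - \<Union>\<O>))"
  show "odd_family E W T (insert (W - T - \<Union>\<O>) \<O>)"
    unfolding odd_family_def
  proof (intro conjI ballI)
    show "T \<subseteq> W" using assms by (simp add: odd_family_def)
    show "pairwise disjnt (insert (W - T - \<Union>\<O>) \<O>)"
      using assms by (auto simp: odd_family_def pairwise_insert disjnt_def)
    fix K assume "K \<in> insert (W - T - \<Union>\<O>) \<O>"
    then consider "K = W - T - \<Union>\<O>" | "K \<in> \<O>" by blast
    then have "K \<subseteq> W - T \<and> odd (card K) \<and> (\<forall>u\<in>K. \<forall>v\<in>W - T - K. {u, v} \<notin> E)"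
    proof cases
      case 1
      then show ?thesis using odd closed by blast
    next
      case 2
      then show ?thesis using assms by (simp add: odd_family_def)
    qed
    then show "K \<subseteq> W - T" "odd (card K)"
      "\<And>u v. u \<in> K \<Longrightarrow> v \<in> W - T - K \<Longrightarrow> {u, v} \<notin> E" by blast+
  qed
qed

lemma leftover_notin:
  assumes "odd (card (W - T - \<Union>\<O>))"
  shows "W - T - \<Union>\<O> \<notin> \<O>"
proof
  assume "W - T - \<Union>\<O> \<in> \<O>"
  then have "W - T - \<Union>\<O> = {}" by blast
  then show False using assms by (metis card.empty even_zero)
qed

text \<open>Edges leaving \<open>K\<close> end in \<open>T\<close>, so members of a family inside
  \<open>K - {x}\<close> stay closed in the whole graph once \<open>x\<close> and \<open>S\<close>
  join the barrier. Replacing \<open>K\<close> changes the deficiency by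
  \<open>card \<O>' - card S - 2\<close> when the families are disjoint. A violation of Tutte's
  condition by two therefore gives a larger barrier of no smaller deficiency.\<close>

lemma odd_family_refine:
  assumes fam: "odd_family E W T \<O>" and K: "K \<in> \<O>" "x \<in> K"
    and sub: "odd_family E (K - {x}) S \<O>'"
  shows "odd_family E W (insert x (T \<union> S)) (\<O> - {K} \<union> \<O>')"
  unfolding odd_family_def
proof (intro conjI ballI)
  have KW: "K \<subseteq> W - T" using fam K by (auto simp: odd_family_def)
  have SK: "S \<subseteq> K - {x}" using sub by (simp add: odd_family_def)
  show "insert x (T \<union> S) \<subseteq> W" using KW SK K fam unfolding odd_family_def by blast
  have subK: "L \<subseteq> K - {x} - S" if "L \<in> \<O>'" for L using that sub by (simp add: odd_family_def)
  have disjK: "L \<inter> K = {}" if "L \<in> \<O> - {K}" for L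
    using that K fam by (auto simp: odd_family_def pairwise_def disjnt_def)
  show "pairwise disjnt (\<O> - {K} \<union> \<O>')"
    unfolding pairwise_def
  proof (intro ballI impI)
    fix A B assume AB: "A \<in> \<O> - {K} \<union> \<O>'" "B \<in> \<O> - {K} \<union> \<O>'" "A \<noteq> B"
    have "disjnt A B" if "A \<in> \<O> - {K}" "B \<in> \<O> - {K}"
      using that AB(3) fam by (simp add: odd_family_def pairwise_def)
    moreover have "disjnt A B" if "A \<in> \<O>'" "B \<in> \<O>'"
      using that AB(3) sub by (simp add: odd_family_def pairwise_def)
    ultimately show "disjnt A B" using AB subK disjK by (fastforce simp: disjnt_def)
  qed
  fix L assume "L \<in> \<O> - {K} \<union> \<O>'"
  then consider "L \<in> \<O> - {K}" | "L \<in> \<O>'" by blast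
  then have "L \<subseteq> W - insert x (T \<union> S) \<and> odd (card L) \<and>
    (\<forall>u\<in>L. \<forall>v\<in>W - insert x (T \<union> S) - L. {u, v} \<notin> E)"
  proof cases
    case 1
    then have "L \<subseteq> W - T \<and> odd (card L) \<and> (\<forall>u\<in>L. \<forall>v\<in>W - T - L. {u, v} \<notin> E)"
      using fam unfolding odd_family_def by blast
    then show ?thesis using disjK[OF 1] SK K by blast
  next
    case 2
    have "{u, v} \<notin> E" if "u \<in> L" "v \<in> W - insert x (T \<union> S) - L" for u v
    proof (cases "v \<in> K")
      case True
      then show ?thesis using that 2 sub by (simp add: odd_family_def)
    next
      case False
      have "u \<in> K" using that subK[OF 2] by blast
      then show ?thesis using False that fam K by (simp add: odd_family_def)
    qed
    moreover have "odd (card L)" using 2 sub by (simp add: odd_family_def)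
    ultimately show ?thesis using subK[OF 2] KW K by blast
  qed
  then show "L \<subseteq> W - insert x (T \<union> S)" "odd (card L)"
    "\<And>u v. u \<in> L \<Longrightarrow> v \<in> W - insert x (T \<union> S) - L \<Longrightarrow> {u, v} \<notin> E" by blast+
qed

text \<open>The barrier has maximum deficiency and, among these, maximum size (West's proof of the
  Gallai--Edmonds theorem).\<close>

lemma gallai_edmonds_barrier:
  assumes finW: "finite W"
  obtains T \<O> where "odd_family E W T \<O>" "\<Union>\<O> = W - T"
    "\<And>K x. K \<in> \<O> \<Longrightarrow> x \<in> K \<Longrightarrow> tutte_condition E (K - {x})"
    "\<And>T'. T' \<subseteq> T \<Longrightarrow> card T' \<le> card {K \<in> \<O>. \<exists>t\<in>T'. \<exists>y\<in>K. {t, y} \<in> E}"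
proof -
  define S where "S = {(T, \<O>). odd_family E W T \<O>}"
  \<comment> \<open>Lexicographic order in one number: deficiency first, shifted by
    \<open>card W\<close> to stay natural, then the size of the barrier, which is below the weight
    \<open>card W + 1\<close>.\<close>
  define \<mu> where "\<mu> = (\<lambda>(T, \<O> :: 'a set set). (card \<O> + (card W - card T)) * (card W + 1) + card (T :: 'a set))"
  have "S \<subseteq> Pow W \<times> Pow (Pow W)" by (auto simp: S_def odd_family_def)
  then have finS: "finite S" using finW by (meson finite_Pow_iff finite_SigmaI finite_subset)
  have "({}, {}) \<in> S" by (simp add: S_def odd_family_def)
  then have "S \<noteq> {}" by blast
  obtain p where p: "p \<in> S" "\<mu> p = Max (\<mu> ` S)" using obtains_MAX[OF finS \<open>S \<noteq> {}\<close>] by metis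
  obtain T \<O> where TO: "p = (T, \<O>)" by (cases p)
  have fam: "odd_family E W T \<O>" using p TO by (simp add: S_def)
  note fin = odd_family_finite[OF fam finW]
  have max: "card \<O>' + card T \<le> card \<O> + card T' \<and>
      (card \<O> + card T' \<le> card \<O>' + card T \<longrightarrow> card T' \<le> card T)"
    if "odd_family E W T' \<O>'" for T' \<O>'
  proof -
    have "\<mu> (T', \<O>') \<le> \<mu> p" using p finS that by (auto simp: S_def)
    then have le: "(card \<O>' + (card W - card T')) * (card W + 1) + card T' \<le>
        (card \<O> + (card W - card T)) * (card W + 1) + card T" by (simp add: TO \<mu>_def)
    have T: "card T \<le> card W" "card T' \<le> card W"
      using that fam finW by (auto simp: odd_family_def intro: card_mono)
    have "card \<O>' + (card W - card T') \<le> card \<O> + (card W - card T)"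
    proof (rule ccontr)
      assume "\<not> ?thesis"
      then have "Suc (card \<O> + (card W - card T)) \<le> card \<O>' + (card W - card T')" by simp
      then have "Suc (card \<O> + (card W - card T)) * (card W + 1) \<le>
        (card \<O>' + (card W - card T')) * (card W + 1)" by (rule mult_le_mono1)
      then show False using le T by simp
    qed
    moreover have "card T' \<le> card T" if "card \<O>' + (card W - card T') = card \<O> + (card W - card T)"
      using le that by simp
    ultimately show ?thesis using T by linarith
  qed
  let ?R = "W - T - \<Union>\<O>"
  have evenR: "even (card ?R)"
  proof (rule ccontr)
    assume odd: "\<not> ?thesis"
    have "card (insert ?R \<O>) = Suc (card \<O>)" using leftover_notin[OF odd] fin(1) by simp
    then show False using max[OF odd_family_leftover(2)[OF fam odd]] by simp
  qed
  \<comment> \<open>The leftover is even by now. Moving one of its vertices into the barrier makes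
    the rest an odd member: the deficiency is unchanged, but the barrier is larger.\<close>
  have R: "?R = {}"
  proof (rule ccontr)
    assume "?R \<noteq> {}"
    then obtain x where x: "x \<in> ?R" by blast
    have finR: "finite ?R" using finW by simp
    have odd: "odd (card (?R - {x}))"
    proof -
      have "card ?R = Suc (card (?R - {x}))" using x finR by (rule card.remove[symmetric, THEN sym, rotated])
      then show ?thesis using evenR by simp
    qed
    have "odd_family E W (insert x T) \<O>"
      using fam x unfolding odd_family_def by blast
    moreover have eq: "W - insert x T - \<Union>\<O> = ?R - {x}" by blast
    ultimately have "odd_family E W (insert x T) (insert (?R - {x}) \<O>)"
      using odd odd_family_leftover(2)[of E W "insert x T" \<O>] by simp
    moreover have "?R - {x} \<notin> \<O>" using leftover_notin[of W "insert x T" \<O>] odd unfolding eq by simp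
    moreover have "x \<notin> T" using x by simp
    ultimately show False using max[of "insert x T" "insert (?R - {x}) \<O>"] fin by simp
  qed
  have tutte: "tutte_condition E (K - {x})" if K: "K \<in> \<O>" "x \<in> K" for K x
  proof (rule ccontr)
    assume "\<not> ?thesis"
    then obtain S \<O>' where fam': "odd_family E (K - {x}) S \<O>'" and gt: "card S < card \<O>'"
      by (auto simp: tutte_condition_def not_le)
    have finK: "finite (K - {x})" using fin(3)[OF K(1)] by simp
    note fin' = odd_family_finite[OF fam' finK]
    have evenK: "even (card (K - {x}))"
      using K fam fin(3)[OF K(1)] by (auto simp: odd_family_def)
    \<comment> \<open>Since \<open>K - {x}\<close> is even, an excess of exactly one leaves an odd
      leftover, which can be added as another member. So the excess can be taken to be at least
      two.\<close>
    have "\<exists>\<O>''. odd_family E (K - {x}) S \<O>'' \<and> card S + 2 \<le> card \<O>''"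
    proof (cases "card \<O>' = Suc (card S)")
      case True
      then have odd: "odd (card (K - {x} - S - \<Union>\<O>'))"
        using odd_card_leftover_iff[OF fam' finK] evenK by simp
      show ?thesis
        using odd_family_leftover(2)[OF fam' odd] leftover_notin[OF odd] fin'(1) True
        by (intro exI[of _ "insert (K - {x} - S - \<Union>\<O>') \<O>'"]) simp
    next
      case False
      then show ?thesis using fam' gt by (intro exI[of _ \<O>']) simp
    qed
    then obtain \<O>'' where fam'': "odd_family E (K - {x}) S \<O>''" and ge: "card S + 2 \<le> card \<O>''" by blast
    have sub: "S \<subseteq> K - {x}" using fam'' by (simp add: odd_family_def)
    have KT: "K \<inter> T = {}" using K fam by (auto simp: odd_family_def)
    have "(\<O> - {K}) \<inter> \<O>'' = {}"
    proof (rule ccontr)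
      assume "\<not> ?thesis"
      then obtain L where L: "L \<in> \<O> - {K}" "L \<in> \<O>''" by blast
      then have "L \<inter> K = {}" using K fam by (auto simp: odd_family_def pairwise_def disjnt_def)
      moreover have "L \<subseteq> K" "odd (card L)" using L fam'' by (auto simp: odd_family_def)
      ultimately have "L = {}" by blast
      then show False using \<open>odd (card L)\<close> by simp
    qed
    then have "card (\<O> - {K} \<union> \<O>'') = card (\<O> - {K}) + card \<O>''"
      using fin(1) odd_family_finite(1)[OF fam'' finK] by (intro card_Un_disjoint) auto
    moreover have "card \<O> = Suc (card (\<O> - {K}))" using fin(1) K(1) by (rule card.remove)
    moreover have "card (insert x (T \<union> S)) = Suc (card T + card S)"
    proof -
      have "card (T \<union> S) = card T + card S"
        using fin(2) fin'(2) sub KT by (intro card_Un_disjoint) auto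
      moreover have "x \<notin> T \<union> S" using K KT sub by blast
      ultimately show ?thesis using fin(2) fin'(2) by simp
    qed
    ultimately show False using max[OF odd_family_refine[OF fam K fam'']] ge by linarith
  qed
  \<comment> \<open>If \<open>T'\<close> is dropped from the barrier, the members not adjacent to
    \<open>T'\<close> survive. As the deficiency is maximal, at least \<open>card T'\<close> members
    must be lost.\<close>
  have hall: "card T' \<le> card {K \<in> \<O>. \<exists>t\<in>T'. \<exists>y\<in>K. {t, y} \<in> E}" if T': "T' \<subseteq> T" for T'
  proof -
    let ?N = "{K \<in> \<O>. \<exists>t\<in>T'. \<exists>y\<in>K. {t, y} \<in> E}"
    have "odd_family E W (T - T') (\<O> - ?N)"
      unfolding odd_family_def
    proof (intro conjI ballI)
      show "T - T' \<subseteq> W" using fam by (auto simp: odd_family_def)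
      show "pairwise disjnt (\<O> - ?N)"
        using fam unfolding odd_family_def by (meson Diff_subset pairwise_subset)
      fix K assume K: "K \<in> \<O> - ?N"
      then have *: "K \<subseteq> W - T \<and> odd (card K) \<and> (\<forall>u\<in>K. \<forall>v\<in>W - T - K. {u, v} \<notin> E)"
        using fam unfolding odd_family_def by blast
      then show "K \<subseteq> W - (T - T')" "odd (card K)" by blast+
      fix u v assume uv: "u \<in> K" "v \<in> W - (T - T') - K"
      show "{u, v} \<notin> E"
      proof (cases "v \<in> T'")
        case True
        then have "{v, u} \<notin> E" using K uv by blast
        then show ?thesis by (simp add: insert_commute)
      next
        case False
        then show ?thesis using * uv by blast
      qed
    qed
    from max[OF this] have "card (\<O> - ?N) + card T \<le> card \<O> + card (T - T')" by blast
    moreover have "card (\<O> - ?N) = card \<O> - card ?N" using fin(1) by (intro card_Diff_subset) auto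
    moreover have "card ?N \<le> card \<O>" using fin(1) by (intro card_mono) auto
    moreover have "card (T - T') = card T - card T'"
      using T' fin(2) by (meson card_Diff_subset finite_subset)
    moreover have "card T' \<le> card T" using T' fin(2) by (intro card_mono)
    ultimately show ?thesis by linarith
  qed
  have "\<Union>\<O> = W - T" using R fam by (auto simp: odd_family_def)
  then show ?thesis using that fam tutte hall by blast
qed

text \<open>Each member can be matched internally after deleting any one vertex. For a member
  matched by \<open>P\<close> the deleted vertex is the end of an edge to the barrier; for any other
  member \<open>K\<close> it is \<open>x K\<close>. Only edges from \<open>P\<close> cross between
  the barrier and members, so no chosen edge crosses the boundary of an unmatched member.\<close>

lemma matching_of_barrier:
  assumes disj: "pairwise disjnt \<O>" and TO: "T \<inter> \<Union>\<O> = {}"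
    and P: "P \<subseteq> T \<times> \<O>" "inj_on fst P" "inj_on snd P"
    and adj: "\<And>t K. (t, K) \<in> P \<Longrightarrow> \<exists>y\<in>K. {t, y} \<in> E"
    and perf: "\<And>K z. K \<in> \<O> \<Longrightarrow> z \<in> K \<Longrightarrow> \<exists>N. perfect_matching E (K - {z}) N"
    and x: "\<And>K. K \<in> \<O> \<Longrightarrow> x K \<in> K"
  obtains M where "M \<subseteq> E" "pairwise disjnt M"
    "\<Union>M = fst ` P \<union> \<Union>(\<O> \<inter> snd ` P) \<union> (\<Union>K\<in>\<O> - snd ` P. K - {x K})"
    "\<And>K m. K \<in> \<O> - snd ` P \<Longrightarrow> m \<in> M \<Longrightarrow> m \<inter> K = {} \<or> m \<subseteq> K"
proof -
  have "\<forall>p\<in>P. \<exists>y\<in>snd p. {fst p, y} \<in> E" using adj by auto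
  then obtain y0 where y0: "\<And>p. p \<in> P \<Longrightarrow> y0 p \<in> snd p \<and> {fst p, y0 p} \<in> E" by metis
  \<comment> \<open>\<open>y K\<close> is the vertex of \<open>K\<close> left out of its internal
    matching: the end of the \<open>P\<close>-edge into \<open>K\<close> if there is one, and
    \<open>x K\<close> otherwise.\<close>
  define y where "y K = (if K \<in> snd ` P then y0 (inv_into P snd K) else x K)" for K
  have y_snd: "y (snd p) = y0 p" if "p \<in> P" for p
    using that P(3) by (simp add: y_def)
  have yK: "y K \<in> K" if "K \<in> \<O>" for K
  proof (cases "K \<in> snd ` P")
    case True
    then show ?thesis using y_snd y0 by auto
  next
    case False
    then show ?thesis using x[OF that] by (simp add: y_def)
  qed
  have "\<forall>K\<in>\<O>. \<exists>N. perfect_matching E (K - {y K}) N" using perf yK by blast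
  then obtain N where N: "\<And>K. K \<in> \<O> \<Longrightarrow> perfect_matching E (K - {y K}) (N K)" by metis
  define M1 where "M1 = (\<Union>K\<in>\<O>. N K)"
  define M2 where "M2 = (\<lambda>p. {fst p, y0 p}) ` P"
  have NK: "\<And>K m. K \<in> \<O> \<Longrightarrow> m \<in> N K \<Longrightarrow> m \<subseteq> K - {y K}"
    using N unfolding perfect_matching_def by blast
  have same: "K = K'" if "K \<in> \<O>" "K' \<in> \<O>" "z \<in> K" "z \<in> K'" for K K' z
    using that disj unfolding pairwise_def disjnt_def by blast
  have PO: "fst p \<in> T" "snd p \<in> \<O>" if "p \<in> P" for p using that P(1) by auto
  have y0_T: "y0 p \<notin> T" if "p \<in> P" for p using TO PO(2)[OF that] y0[OF that] by blast
  have disj1: "m \<inter> m' = {}" if "m \<in> M1" "m' \<in> M1" "m \<noteq> m'" for m m'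
  proof -
    obtain K K' where K: "K \<in> \<O>" "m \<in> N K" "K' \<in> \<O>" "m' \<in> N K'"
      using \<open>m \<in> M1\<close> \<open>m' \<in> M1\<close> by (auto simp: M1_def)
    show ?thesis
    proof (cases "K = K'")
      case True
      then show ?thesis using N[OF K(1)] K \<open>m \<noteq> m'\<close>
        unfolding perfect_matching_def pairwise_def disjnt_def by blast
    next
      case False
      then show ?thesis using same[OF K(1,3)] NK[OF K(1,2)] NK[OF K(3,4)] by blast
    qed
  qed
  have disj2: "m \<inter> m' = {}" if "m \<in> M2" "m' \<in> M2" "m \<noteq> m'" for m m'
  proof -
    obtain p p' where p: "p \<in> P" "m = {fst p, y0 p}" "p' \<in> P" "m' = {fst p', y0 p'}"
      using \<open>m \<in> M2\<close> \<open>m' \<in> M2\<close> by (auto simp: M2_def)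
    then have "p \<noteq> p'" using \<open>m \<noteq> m'\<close> by blast
    then have "fst p \<noteq> fst p'" "snd p \<noteq> snd p'" using P(2,3) p by (auto dest: inj_onD)
    moreover have "y0 p \<noteq> y0 p'"
      using same[OF PO(2)[OF p(1)] PO(2)[OF p(3)]] y0[OF p(1)] y0[OF p(3)] \<open>snd p \<noteq> snd p'\<close> by metis
    moreover have "fst p \<noteq> y0 p'" "fst p' \<noteq> y0 p"
      using y0_T[OF p(1)] y0_T[OF p(3)] PO(1)[OF p(1)] PO(1)[OF p(3)] by metis+
    ultimately show ?thesis using p by auto
  qed
  have disj12: "m \<inter> m' = {}" if "m \<in> M1" "m' \<in> M2" for m m'
  proof -
    obtain K where K: "K \<in> \<O>" "m \<in> N K" using \<open>m \<in> M1\<close> by (auto simp: M1_def)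
    obtain p where p: "p \<in> P" "m' = {fst p, y0 p}" using \<open>m' \<in> M2\<close> by (auto simp: M2_def)
    have "fst p \<notin> m" using TO PO(1)[OF p(1)] NK[OF K] K(1) by blast
    moreover have "y0 p \<notin> m"
    proof
      assume "y0 p \<in> m"
      then have "K = snd p" using same[OF K(1) PO(2)[OF p(1)], of "y0 p"] NK[OF K] y0[OF p(1)] by auto
      then show False using \<open>y0 p \<in> m\<close> NK[OF K] y_snd[OF p(1)] by auto
    qed
    ultimately show ?thesis using p by simp
  qed
  show ?thesis
  proof
    show "M1 \<union> M2 \<subseteq> E" using N y0 by (auto simp: M1_def M2_def perfect_matching_def)
    show "pairwise disjnt (M1 \<union> M2)"
      unfolding pairwise_def disjnt_def using disj1 disj2 disj12 by blast
    have U1: "\<Union>M1 = (\<Union>K\<in>\<O>. K - {y K})"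
    proof -
      have "\<Union>M1 = (\<Union>K\<in>\<O>. \<Union>(N K))" by (auto simp: M1_def)
      then show ?thesis using N by (simp add: perfect_matching_def)
    qed
    have U2: "\<Union>M2 = fst ` P \<union> y0 ` P" by (auto simp: M2_def)
    have U3: "y0 ` P = y ` (\<O> \<inter> snd ` P)"
    proof -
      have "y0 ` P = (\<lambda>p. y (snd p)) ` P" using y_snd by simp
      also have "\<dots> = y ` snd ` P" by (simp add: image_image)
      also have "snd ` P = \<O> \<inter> snd ` P" using PO(2) by auto
      finally show ?thesis .
    qed
    have "(\<Union>K\<in>\<O>. K - {y K}) \<union> y ` (\<O> \<inter> snd ` P) =
        \<Union>(\<O> \<inter> snd ` P) \<union> (\<Union>K\<in>\<O> - snd ` P. K - {y K})"
    proof (intro equalityI subsetI)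
      fix z assume "z \<in> \<Union>(\<O> \<inter> snd ` P) \<union> (\<Union>K\<in>\<O> - snd ` P. K - {y K})"
      then show "z \<in> (\<Union>K\<in>\<O>. K - {y K}) \<union> y ` (\<O> \<inter> snd ` P)" by blast
    next
      fix z assume "z \<in> (\<Union>K\<in>\<O>. K - {y K}) \<union> y ` (\<O> \<inter> snd ` P)"
      then show "z \<in> \<Union>(\<O> \<inter> snd ` P) \<union> (\<Union>K\<in>\<O> - snd ` P. K - {y K})"
        using yK by blast
    qed
    moreover have "(\<Union>K\<in>\<O> - snd ` P. K - {y K}) = (\<Union>K\<in>\<O> - snd ` P. K - {x K})"
      by (intro SUP_cong) (auto simp: y_def)
    ultimately show "\<Union>(M1 \<union> M2) =
        fst ` P \<union> \<Union>(\<O> \<inter> snd ` P) \<union> (\<Union>K\<in>\<O> - snd ` P. K - {x K})"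
      unfolding Union_Un_distrib U1 U2 U3 by (simp only: Un_ac)
    fix K m assume Km: "K \<in> \<O> - snd ` P" "m \<in> M1 \<union> M2"
    show "m \<inter> K = {} \<or> m \<subseteq> K"
    proof (cases "m \<in> M1")
      case True
      then obtain K' where "K' \<in> \<O>" "m \<in> N K'" by (auto simp: M1_def)
      then have "K' \<in> \<O>" "m \<subseteq> K'" using NK by blast+
      then show ?thesis using same[of K K'] Km by blast
    next
      case False
      then obtain p where p: "p \<in> P" "m = {fst p, y0 p}" using Km by (auto simp: M2_def)
      then have "fst p \<notin> K" using TO PO Km by blast
      moreover have "y0 p \<notin> K" using same[of K "snd p"] Km p y0[OF p(1)] PO[OF p(1)] by force
      ultimately show ?thesis using p by simp
    qed
  qed
qed

text \<open>Under the condition the barrier has at least as many vertices as members, so the Hall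
  matching of the barrier into the members is onto. Each member minus one vertex is matched by
  induction. Combined with \<open>gallai_edmonds_barrier\<close>, the theorem shows that members are
  factor-critical.\<close>

theorem tutte:
  assumes "finite W" "tutte_condition E W"
  shows "\<exists>M. perfect_matching E W M"
  using assms
proof (induction "card W" arbitrary: W rule: less_induct)
  case less
  note finW = less.prems(1)
  obtain T \<O> where fam: "odd_family E W T \<O>" and U: "\<Union>\<O> = W - T"
    and sub: "\<And>K x. K \<in> \<O> \<Longrightarrow> x \<in> K \<Longrightarrow> tutte_condition E (K - {x})"
    and hall: "\<And>T'. T' \<subseteq> T \<Longrightarrow> card T' \<le> card {K \<in> \<O>. \<exists>t\<in>T'. \<exists>y\<in>K. {t, y} \<in> E}"
    by (rule gallai_edmonds_barrier[OF finW, of E]) blast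
  note fin = odd_family_finite[OF fam finW]
  have UN: "(\<Union>t\<in>T'. {K \<in> \<O>. \<exists>y\<in>K. {t, y} \<in> E}) = {K \<in> \<O>. \<exists>t\<in>T'. \<exists>y\<in>K. {t, y} \<in> E}" for T'
    by blast
  have "\<exists>f. inj_on f T \<and> (\<forall>t\<in>T. f t \<in> {K \<in> \<O>. \<exists>y\<in>K. {t, y} \<in> E})"
    using fin hall by (intro hall_marriage) (auto simp: UN)
  then obtain f where f: "inj_on f T"
    and fN: "\<forall>t\<in>T. f t \<in> {K \<in> \<O>. \<exists>y\<in>K. {t, y} \<in> E}" by (elim exE conjE)
  have f2: "f t \<in> \<O>" "\<exists>y\<in>f t. {t, y} \<in> E" if "t \<in> T" for t
    using bspec[OF fN that] by simp_all
  have "card \<O> \<le> card T" using less.prems(2) fam by (simp add: tutte_condition_def)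
  also have "\<dots> = card (f ` T)" using f by (simp add: card_image)
  finally have fT: "f ` T = \<O>" using fin(1) f2(1) by (intro card_seteq) auto
  define P where "P = (\<lambda>t. (t, f t)) ` T"
  have P: "P \<subseteq> T \<times> \<O>" "inj_on fst P" "inj_on snd P" "fst ` P = T" "snd ` P = \<O>"
    using f f2 fT by (auto simp: P_def inj_on_def image_image)
  have perf: "\<exists>N. perfect_matching E (K - {z}) N" if "K \<in> \<O>" "z \<in> K" for K z
  proof (rule less.hyps)
    have "K \<subseteq> W" using fam that by (auto simp: odd_family_def)
    then show "card (K - {z}) < card W" using that finW by (intro psubset_card_mono) auto
    show "finite (K - {z})" using fin(3) that by simp
    show "tutte_condition E (K - {z})" using sub that by blast
  qed
  have ne: "(SOME z. z \<in> K) \<in> K" if "K \<in> \<O>" for K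
  proof -
    have "odd (card K)" using fam that by (simp add: odd_family_def)
    then have "K \<noteq> {}" by (metis card.empty even_zero)
    then show ?thesis by (simp add: some_in_eq)
  qed
  have adjP: "\<exists>y\<in>K. {t, y} \<in> E" if "(t, K) \<in> P" for t K using that f2 by (auto simp: P_def)
  have dis: "pairwise disjnt \<O>" "T \<inter> \<Union>\<O> = {}" using fam U by (auto simp: odd_family_def)
  obtain M where M: "M \<subseteq> E" "pairwise disjnt M"
    "\<Union>M = fst ` P \<union> \<Union>(\<O> \<inter> snd ` P) \<union> (\<Union>K\<in>\<O> - snd ` P. K - {SOME z. z \<in> K})"
    by (rule matching_of_barrier[OF dis P(1-3) adjP perf ne])
  have "\<Union>M = W" using M(3) P(4,5) U fam by (auto simp: odd_family_def)
  then show ?case using M by (auto simp: perfect_matching_def)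
qed

section \<open>Matchings that miss vertices of maximum degree only behind small cuts\<close>

definition boundary :: "'a set set \<Rightarrow> 'a set \<Rightarrow> 'a set set" where
  "boundary E K = {e \<in> E. e \<inter> K \<noteq> {} \<and> \<not> e \<subseteq> K}"

lemma simple_graph_edgeE:
  assumes "simple_graph V E" "e \<in> E"
  obtains u v where "e = {u, v}" "u \<in> V" "v \<in> V" "u \<noteq> v"
  using assms by (auto simp: simple_graph_def)

lemma simple_graph_finite:
  assumes "simple_graph V E"
  shows "finite V" "finite E"
proof -
  show "finite V" using assms by (simp add: simple_graph_def)
  moreover have "E \<subseteq> Pow V" using assms by (auto simp: simple_graph_def)
  ultimately show "finite E" by (meson finite_Pow_iff finite_subset)
qed

lemma degree_sum:
  assumes "simple_graph V E" "K \<subseteq> V"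
  shows "(\<Sum>v\<in>K. vertex_degree E v) = 2 * card {e \<in> E. e \<subseteq> K} + card (boundary E K)"
proof -
  note fin = simple_graph_finite[OF assms(1)]
  have finK: "finite K" using assms(2) fin(1) by (rule finite_subset)
  have "(\<Sum>v\<in>K. vertex_degree E v) = (\<Sum>v\<in>K. \<Sum>e\<in>E. if v \<in> e then 1 else 0)"
    by (simp add: vertex_degree_def card_filter_eq_sum[OF fin(2)])
  also have "\<dots> = (\<Sum>e\<in>E. \<Sum>v\<in>K. if v \<in> e then 1 else 0)" by (rule sum.swap)
  also have "\<dots> = (\<Sum>e\<in>E. card {v \<in> K. v \<in> e})" by (simp add: card_filter_eq_sum[OF finK])
  also have "\<dots> = (\<Sum>e\<in>E. 2 * (if e \<subseteq> K then 1 else 0) + (if e \<inter> K \<noteq> {} \<and> \<not> e \<subseteq> K then 1 else 0))"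
  proof (intro sum.cong refl)
    fix e assume "e \<in> E"
    with assms(1) obtain u v where e: "e = {u, v}" "u \<noteq> v" by (rule simple_graph_edgeE)
    have "{w \<in> K. w \<in> e} = e \<inter> K" by blast
    then show "card {w \<in> K. w \<in> e} =
        2 * (if e \<subseteq> K then 1 else 0) + (if e \<inter> K \<noteq> {} \<and> \<not> e \<subseteq> K then 1 else 0)"
      using e by (cases "u \<in> K"; cases "v \<in> K") (auto simp: Int_insert_left)
  qed
  also have "\<dots> = 2 * card {e \<in> E. e \<subseteq> K} + card (boundary E K)"
    unfolding sum.distrib sum_distrib_left[symmetric] boundary_def card_filter_eq_sum[OF fin(2)] ..
  finally show ?thesis .
qed

text \<open>The barrier can be matched into the members, and the members in \<open>Big\<close> can
  be matched into the barrier, because each has at least \<open>d\<close> edges to it and a barrier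
  vertex takes at most \<open>d\<close>. One matching \<open>P\<close> does both. Members missed by
  it can either omit a vertex of degree below \<open>d\<close>, or they have fewer than
  \<open>d\<close> boundary edges and form \<open>\<K>\<close>.\<close>

lemma matching_with_small_cuts:
  assumes G: "simple_graph V E" and deg: "\<And>v. v \<in> V \<Longrightarrow> vertex_degree E v \<le> d" and "odd d"
  obtains M \<K> x where "M \<subseteq> E" "pairwise disjnt M" "pairwise disjnt \<K>"
    "\<And>K. K \<in> \<K> \<Longrightarrow> K \<subseteq> V \<and> x K \<in> K \<and> vertex_degree E (x K) = d \<and> card (boundary E K) + 2 \<le> d"
    "\<And>K m. K \<in> \<K> \<Longrightarrow> m \<in> M \<Longrightarrow> m \<inter> K = {} \<or> m \<subseteq> K"
    "\<And>v. v \<in> V \<Longrightarrow> vertex_degree E v = d \<Longrightarrow> v \<in> \<Union>M \<or> v \<in> x ` \<K>"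
proof -
  note fin = simple_graph_finite[OF G]
  obtain T \<O> where fam: "odd_family E V T \<O>" and U: "\<Union>\<O> = V - T"
    and sub: "\<And>K x. K \<in> \<O> \<Longrightarrow> x \<in> K \<Longrightarrow> tutte_condition E (K - {x})"
    and hall: "\<And>T'. T' \<subseteq> T \<Longrightarrow> card T' \<le> card {K \<in> \<O>. \<exists>t\<in>T'. \<exists>y\<in>K. {t, y} \<in> E}"
    by (rule gallai_edmonds_barrier[OF fin(1), of E]) blast
  note finO = odd_family_finite[OF fam fin(1)]
  have disj: "pairwise disjnt \<O>" and TO: "T \<inter> \<Union>\<O> = {}" and TV: "T \<subseteq> V"
    using fam U by (auto simp: odd_family_def)
  have KV: "K \<subseteq> V" and oddK: "odd (card K)" and neK: "K \<noteq> {}" if "K \<in> \<O>" for K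
  proof -
    show "K \<subseteq> V" "odd (card K)" using fam that by (auto simp: odd_family_def)
    then show "K \<noteq> {}" by (metis card.empty even_zero)
  qed
  define R where "R t K \<longleftrightarrow> t \<in> T \<and> K \<in> \<O> \<and> (\<exists>y\<in>K. {t, y} \<in> E)" for t K
  define Big where "Big = {K \<in> \<O>. (\<forall>v\<in>K. vertex_degree E v = d) \<and> d \<le> card (boundary E K)}"
  have bd: "\<exists>t y. e = {t, y} \<and> y \<in> K \<and> R t K" if K: "K \<in> \<O>" and e: "e \<in> boundary E K" for e K
  proof -
    have eE: "e \<in> E" using e by (simp add: boundary_def)
    with G obtain u v where uv: "e = {u, v}" "u \<in> V" "v \<in> V" by (rule simple_graph_edgeE)
    then obtain t y where ty: "e = {t, y}" "y \<in> K" "t \<notin> K" "t \<in> V"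
      using e by (cases "u \<in> K") (auto simp: boundary_def insert_commute)
    have "t \<in> T"
    proof (rule ccontr)
      assume "t \<notin> T"
      then have "{y, t} \<notin> E" using fam K ty unfolding odd_family_def by blast
      then show False using eE ty by (simp add: insert_commute)
    qed
    then show ?thesis using ty eE K unfolding R_def by blast
  qed
  have "\<exists>P. (\<forall>(x, y)\<in>P. R x y) \<and> inj_on fst P \<and> inj_on snd P \<and> T \<subseteq> fst ` P \<and> Big \<subseteq> snd ` P"
  proof (rule symmetric_hall)
    show "finite T" "finite Big" using finO by (auto simp: Big_def)
    show "finite {K. R t K}" for t using finO(1) by (rule rev_finite_subset) (auto simp: R_def)
    show fR: "finite {t. R t K}" for K using finO(2) by (rule rev_finite_subset) (auto simp: R_def)
    show "card T' \<le> card {K. \<exists>t\<in>T'. R t K}" if T': "T' \<subseteq> T" for T'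
    proof -
      have "{K \<in> \<O>. \<exists>t\<in>T'. \<exists>y\<in>K. {t, y} \<in> E} = {K. \<exists>t\<in>T'. R t K}"
        using T' unfolding R_def by blast
      then show ?thesis using hall[OF T'] by simp
    qed
    show "card \<Y> \<le> card {t. \<exists>K\<in>\<Y>. R t K}" if Y: "\<Y> \<subseteq> Big" for \<Y>
    proof -
      let ?N = "{t. \<exists>K\<in>\<Y>. R t K}"
      have YO: "\<Y> \<subseteq> \<O>" using Y by (auto simp: Big_def)
      have finY: "finite \<Y>" using YO finO(1) by (rule finite_subset)
      have finN: "finite ?N" using finO(2) by (rule rev_finite_subset) (auto simp: R_def)
      have "d * card \<Y> = (\<Sum>K\<in>\<Y>. d)" by simp
      also have "\<dots> \<le> (\<Sum>K\<in>\<Y>. card (boundary E K))"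
        using Y by (intro sum_mono) (auto simp: Big_def)
      also have "\<dots> = card (\<Union>K\<in>\<Y>. boundary E K)"
      proof (rule card_UN_disjoint[symmetric])
        show "\<forall>K\<in>\<Y>. finite (boundary E K)" using fin by (simp add: boundary_def)
        show "\<forall>K\<in>\<Y>. \<forall>K'\<in>\<Y>. K \<noteq> K' \<longrightarrow> boundary E K \<inter> boundary E K' = {}"
        proof (intro ballI impI)
          fix K K' assume KK: "K \<in> \<Y>" "K' \<in> \<Y>" "K \<noteq> K'"
          then have KO: "K \<in> \<O>" "K' \<in> \<O>" using YO by auto
          then have "K \<inter> K' = {}" using disj KK by (simp add: pairwise_def disjnt_def)
          moreover have "K \<inter> T = {}" "K' \<inter> T = {}" using TO KO by auto
          ultimately show "boundary E K \<inter> boundary E K' = {}"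
            using bd[OF KO(1)] bd[OF KO(2)] unfolding R_def by (fastforce simp: doubleton_eq_iff)
        qed
      qed (rule finY)
      also have "\<dots> \<le> card (\<Union>t\<in>?N. {e \<in> E. t \<in> e})"
      proof (rule card_mono)
        show "finite (\<Union>t\<in>?N. {e \<in> E. t \<in> e})" using fin(2) finN by simp
        show "(\<Union>K\<in>\<Y>. boundary E K) \<subseteq> (\<Union>t\<in>?N. {e \<in> E. t \<in> e})"
        proof
          fix e assume "e \<in> (\<Union>K\<in>\<Y>. boundary E K)"
          then obtain K where K: "K \<in> \<Y>" "e \<in> boundary E K" by blast
          then obtain t y where "e = {t, y}" "R t K" using bd YO by blast
          then show "e \<in> (\<Union>t\<in>?N. {e \<in> E. t \<in> e})" using K by (auto simp: boundary_def)
        qed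
      qed
      also have "\<dots> \<le> (\<Sum>t\<in>?N. card {e \<in> E. t \<in> e})" using finN by (rule card_UN_le)
      also have "\<dots> \<le> (\<Sum>t\<in>?N. d)"
        using deg TV by (intro sum_mono) (auto simp: R_def vertex_degree_def)
      finally have "d * card \<Y> \<le> d * card ?N" by simp
      then show ?thesis using \<open>odd d\<close> by (auto elim: oddE)
    qed
  qed
  then obtain P where PR: "\<forall>(x, y)\<in>P. R x y" and inj: "inj_on fst P" "inj_on snd P"
    and cov: "T \<subseteq> fst ` P" "Big \<subseteq> snd ` P" by (elim exE conjE)
  have adjP: "\<exists>y\<in>K. {t, y} \<in> E" if "(t, K) \<in> P" for t K
    using PR that by (auto simp: R_def)
  have PTO: "P \<subseteq> T \<times> \<O>" using PR by (auto simp: R_def)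
  \<comment> \<open>A vertex of degree below \<open>d\<close> is omitted whenever the member has
    one. So a vertex of degree \<open>d\<close> is lost only in a member whose degrees all equal
    \<open>d\<close>.\<close>
  define x where "x K = (if \<exists>v\<in>K. vertex_degree E v \<noteq> d then SOME v. v \<in> K \<and> vertex_degree E v \<noteq> d
    else SOME v. v \<in> K)" for K
  have xK: "x K \<in> K" if "K \<noteq> {}" for K
    using that someI_ex[of "\<lambda>v. v \<in> K \<and> vertex_degree E v \<noteq> d"] some_in_eq[of K]
    unfolding x_def by (auto split: if_splits)
  have xdeg: "vertex_degree E (x K) \<noteq> d" if "\<exists>v\<in>K. vertex_degree E v \<noteq> d" for K
    using that someI_ex[of "\<lambda>v. v \<in> K \<and> vertex_degree E v \<noteq> d"] unfolding x_def by auto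
  have perf: "\<exists>N. perfect_matching E (K - {z}) N" if "K \<in> \<O>" "z \<in> K" for K z
    using tutte[OF _ sub[OF that]] finO(3)[OF that(1)] by simp
  have xO: "x K \<in> K" if "K \<in> \<O>" for K using xK neK[OF that] .
  obtain M where M: "M \<subseteq> E" "pairwise disjnt M"
    "\<Union>M = fst ` P \<union> \<Union>(\<O> \<inter> snd ` P) \<union> (\<Union>K\<in>\<O> - snd ` P. K - {x K})"
    "\<And>K m. K \<in> \<O> - snd ` P \<Longrightarrow> m \<in> M \<Longrightarrow> m \<inter> K = {} \<or> m \<subseteq> K"
    by (rule matching_of_barrier[OF disj TO PTO inj adjP perf xO]) blast+
  define \<K> where "\<K> = {K \<in> \<O> - snd ` P. \<forall>v\<in>K. vertex_degree E v = d}"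
  show ?thesis
  proof
    show "M \<subseteq> E" "pairwise disjnt M" by fact+
    show "pairwise disjnt \<K>" using disj by (rule pairwise_subset) (auto simp: \<K>_def)
    show "m \<inter> K = {} \<or> m \<subseteq> K" if "K \<in> \<K>" "m \<in> M" for K m
      using M(4) that by (simp add: \<K>_def)
    show "K \<subseteq> V \<and> x K \<in> K \<and> vertex_degree E (x K) = d \<and> card (boundary E K) + 2 \<le> d"
      if "K \<in> \<K>" for K
    proof (intro conjI)
      have K: "K \<in> \<O>" "K \<notin> snd ` P" "\<And>v. v \<in> K \<Longrightarrow> vertex_degree E v = d"
        using that by (auto simp: \<K>_def)
      show "K \<subseteq> V" "x K \<in> K" "vertex_degree E (x K) = d"
        using KV[OF K(1)] xO[OF K(1)] K(3) by auto
      have "card (boundary E K) < d" using K cov(2) by (auto simp: Big_def not_le[symmetric])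
      \<comment> \<open>Parity: \<open>card K\<close> and \<open>d\<close> are odd, hence so is the
        number of boundary edges. Being less than \<open>d\<close>, it is at most
        \<open>d - 2\<close>.\<close>
      moreover have "card K * d = 2 * card {e \<in> E. e \<subseteq> K} + card (boundary E K)"
        using degree_sum[OF G KV[OF K(1)]] K(3) by simp
      then have "odd (card (boundary E K))" using \<open>odd d\<close> oddK[OF K(1)]
        by (metis dvd_triv_left even_add even_mult_iff)
      ultimately show "card (boundary E K) + 2 \<le> d" using \<open>odd d\<close>
        by (auto elim!: oddE)
    qed
    show "v \<in> \<Union>M \<or> v \<in> x ` \<K>" if v: "v \<in> V" "vertex_degree E v = d" for v
    proof (cases "v \<in> \<Union>M")
      case False
      then have "v \<notin> T" using cov(1) M(3) by blast
      then obtain K where K: "K \<in> \<O>" "v \<in> K" using U v(1) by blast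
      then have KP: "K \<notin> snd ` P" using False M(3) by blast
      then have vx: "v = x K" using False M(3) K by blast
      then have "K \<in> \<K>" using K KP v(2) xdeg[of K] by (auto simp: \<K>_def)
      then show ?thesis using vx by blast
    qed simp
  qed
qed

section \<open>Layerings of sparse multigraphs\<close>

lemma rtrancl_leaves:
  assumes "(u, v) \<in> r\<^sup>*" "u \<in> A" "v \<notin> A"
  shows "\<exists>(x, y)\<in>r. x \<in> A \<and> y \<notin> A"
  using assms by (induction rule: rtrancl_induct) blast+

text \<open>A set of nodes grown along leaving edges gains at least one new inner edge that is not a
  loop with every node. This is the spanning tree bound for connected multigraphs.\<close>

lemma card_le_card_edges:
  fixes a b :: "'e \<Rightarrow> 'n"
  assumes finB: "finite B" and finS: "finite S" and S: "S \<noteq> {}"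
    and conn: "\<And>A. A \<subset> S \<Longrightarrow> A \<noteq> {} \<Longrightarrow>
      \<exists>e\<in>B. a e \<in> A \<and> b e \<in> S - A \<or> b e \<in> A \<and> a e \<in> S - A"
  shows "card S \<le> card {e \<in> B. a e \<in> S \<and> b e \<in> S \<and> a e \<noteq> b e} + 1"
proof -
  define N where "N A = {e \<in> B. a e \<in> A \<and> b e \<in> A \<and> a e \<noteq> b e}" for A
  have "\<exists>A\<subseteq>S. card A = n \<and> n \<le> card (N A) + 1" if "1 \<le> n" "n \<le> card S" for n
    using that
  proof (induction n rule: nat_induct_at_least)
    case base
    obtain s where "s \<in> S" using S by blast
    then show ?case by (intro exI[of _ "{s}"]) simp
  next
    case (Suc n)
    then obtain A where A: "A \<subseteq> S" "card A = n" "n \<le> card (N A) + 1" by auto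
    have "A \<subset> S" "A \<noteq> {}" using A Suc by auto
    from conn[OF this] obtain e where e: "e \<in> B"
      "a e \<in> A \<and> b e \<in> S - A \<or> b e \<in> A \<and> a e \<in> S - A" by blast
    define s where "s = (if a e \<in> A then b e else a e)"
    have s: "s \<in> S - A" using e by (auto simp: s_def)
    have finA: "finite A" using A(1) finS by (rule finite_subset)
    have "e \<in> N (insert s A)" "e \<notin> N A" using e by (auto simp: N_def s_def)
    moreover have "N A \<subseteq> N (insert s A)" by (auto simp: N_def)
    moreover have "finite (N (insert s A))" using finB by (simp add: N_def)
    ultimately have "card (N A) < card (N (insert s A))" by (intro psubset_card_mono) auto
    then show ?case using A s finA by (intro exI[of _ "insert s A"]) auto
  qed
  from this[of "card S"] obtain A where "A \<subseteq> S" "card A = card S" "card S \<le> card (N A) + 1"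
    using S finS by (auto simp: Suc_le_eq card_gt_0_iff)
  moreover from this have "A = S" using card_subset_eq finS by blast
  ultimately show ?thesis by (simp add: N_def)
qed

text \<open>After contracting every \<open>K \<in> \<K>\<close> to a node of degree at most 1, the connected graph on \<open>X\<close> has
  too few edges if it contains three such nodes.\<close>

lemma few_small_cuts_in_component:
  fixes a b :: "'e \<Rightarrow> 'n"
  assumes finB: "finite B" and finX: "finite X" and X: "X \<noteq> {}"
    and deg: "\<And>v. card {e \<in> B. a e = v} + card {e \<in> B. b e = v} \<le> 2"
    and disj: "pairwise disjnt \<K>"
    and cut: "\<And>K. K \<in> \<K> \<Longrightarrow> card {e \<in> B. (a e \<in> K) \<noteq> (b e \<in> K)} \<le> 1"
    and \<Gamma>: "\<And>g. g \<in> \<Gamma> \<Longrightarrow> \<exists>K\<in>\<K>. a g \<in> K \<and> b g \<in> K"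
    and conn: "\<And>A. A \<subset> X \<Longrightarrow> A \<noteq> {} \<Longrightarrow>
      \<exists>e\<in>B \<union> \<Gamma>. a e \<in> A \<and> b e \<in> X - A \<or> b e \<in> A \<and> a e \<in> X - A"
  shows "card {K \<in> \<K>. K \<inter> X \<noteq> {}} \<le> 2"
proof -
  have same: "K = K'" if "K \<in> \<K>" "K' \<in> \<K>" "z \<in> K" "z \<in> K'" for K K' z
    using that disj unfolding pairwise_def disjnt_def by blast
  define \<kappa> where "\<kappa> v = (if v \<in> \<Union>\<K> then THE K. K \<in> \<K> \<and> v \<in> K else {v})" for v
  have \<kappa>K: "\<kappa> v = K" if "K \<in> \<K>" "v \<in> K" for v K
    using that same unfolding \<kappa>_def by (auto intro!: the_equality)
  have in_\<kappa>: "v \<in> \<kappa> v" for v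
  proof (cases "v \<in> \<Union>\<K>")
    case True
    then show ?thesis using \<kappa>K by auto
  qed (simp add: \<kappa>_def)
  define S where "S = \<kappa> ` X"
  define N where "N = {e \<in> B. \<kappa> (a e) \<in> S \<and> \<kappa> (b e) \<in> S \<and> \<kappa> (a e) \<noteq> \<kappa> (b e)}"
  have finS: "finite S" and finN: "finite N" using finX finB by (auto simp: S_def N_def)
  have "card S \<le> card {e \<in> B. \<kappa> (a e) \<in> S \<and> \<kappa> (b e) \<in> S \<and> \<kappa> (a e) \<noteq> \<kappa> (b e)} + 1"
  proof (rule card_le_card_edges[OF finB finS])
    show "S \<noteq> {}" using X by (simp add: S_def)
    fix A assume A: "A \<subset> S" "A \<noteq> {}"
    let ?A = "{v \<in> X. \<kappa> v \<in> A}"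
    have "?A \<subset> X" "?A \<noteq> {}" using A by (auto simp: S_def)
    from conn[OF this] obtain e where e: "e \<in> B \<union> \<Gamma>"
      "a e \<in> ?A \<and> b e \<in> X - ?A \<or> b e \<in> ?A \<and> a e \<in> X - ?A" by blast
    then have ne: "\<kappa> (a e) \<noteq> \<kappa> (b e)" by auto
    \<comment> \<open>Edges of \<open>\<Gamma>\<close> lie inside members of \<open>\<K>\<close>, so
      they become loops under \<open>\<kappa>\<close> and connectivity comes from \<open>B\<close>
      alone.\<close>
    have "e \<notin> \<Gamma>"
    proof
      assume "e \<in> \<Gamma>"
      then obtain K where "K \<in> \<K>" "a e \<in> K" "b e \<in> K" using \<Gamma> by blast
      then show False using ne \<kappa>K by simp
    qed
    then show "\<exists>e\<in>B. \<kappa> (a e) \<in> A \<and> \<kappa> (b e) \<in> S - A \<or> \<kappa> (b e) \<in> A \<and> \<kappa> (a e) \<in> S - A"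
      using e by (intro bexI[of _ e]) (auto simp: S_def)
  qed
  then have card: "card S \<le> card N + 1" by (simp add: N_def)
  have N2: "card {e \<in> N. \<kappa> (a e) = s} + card {e \<in> N. \<kappa> (b e) = s} \<le> (if s \<in> \<K> then 1 else 2)"
    if "s \<in> S" for s
  proof (cases "s \<in> \<K>")
    case True
    have mem: "\<kappa> v = s \<longleftrightarrow> v \<in> s" for v using in_\<kappa>[of v] \<kappa>K[OF True, of v] by blast
    have "card {e \<in> N. \<kappa> (a e) = s} + card {e \<in> N. \<kappa> (b e) = s} =
        card ({e \<in> N. \<kappa> (a e) = s} \<union> {e \<in> N. \<kappa> (b e) = s})"
    proof (rule card_Un_disjoint[symmetric])
      show "finite {e \<in> N. \<kappa> (a e) = s}" "finite {e \<in> N. \<kappa> (b e) = s}" using finN by simp_all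
    qed (auto simp: N_def)
    also have "\<dots> \<le> card {e \<in> B. (a e \<in> s) \<noteq> (b e \<in> s)}"
      using finB by (intro card_mono) (auto simp: N_def mem[symmetric])
    also have "\<dots> \<le> 1" by (rule cut[OF True])
    finally show ?thesis using True by simp
  next
    case False
    obtain v where v: "s = \<kappa> v" using \<open>s \<in> S\<close> by (auto simp: S_def)
    then have "v \<notin> \<Union>\<K>" using False \<kappa>K by auto
    then have sv: "s = {v}" using v by (simp add: \<kappa>_def)
    have "card {e \<in> N. \<kappa> (f e) = s} \<le> card {e \<in> B. f e = v}" for f :: "'e \<Rightarrow> 'n"
      using finB in_\<kappa> sv by (intro card_mono) (auto simp: N_def)
    from add_mono[OF this[of a] this[of b]] show ?thesis using False deg[of v] by simp
  qed
  \<comment> \<open>Handshake count in the contracted graph: \<open>2 (card S - 1) \<le> 2 card N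
    \<le> 2 card S - card (S \<inter> \<K>)\<close>, so at most two nodes come from
    \<open>\<K>\<close>.\<close>
  have "2 * card N = card {e \<in> N. \<kappa> (a e) \<in> S} + card {e \<in> N. \<kappa> (b e) \<in> S}"
  proof -
    have "{e \<in> N. \<kappa> (a e) \<in> S} = N" "{e \<in> N. \<kappa> (b e) \<in> S} = N" by (auto simp: N_def)
    then show ?thesis by simp
  qed
  also have "\<dots> = (\<Sum>s\<in>S. card {e \<in> N. \<kappa> (a e) = s} + card {e \<in> N. \<kappa> (b e) = s})"
    using finN finS by (simp only: sum.distrib sum_card_fibres)
  also have "\<dots> \<le> (\<Sum>s\<in>S. if s \<in> \<K> then 1 else 2)" by (intro sum_mono N2)
  also have "\<dots> = card (S \<inter> \<K>) + 2 * card (S - \<K>)" using finS by (simp add: sum.If_cases Diff_eq)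
  finally have "2 * card N \<le> card (S \<inter> \<K>) + 2 * card (S - \<K>)" .
  moreover have "card S = card (S \<inter> \<K>) + card (S - \<K>)"
  proof -
    have "S = (S \<inter> \<K>) \<union> (S - \<K>)" by blast
    then show ?thesis using finS by (metis Diff_disjoint Int_Diff_disjoint card_Un_disjoint finite_Diff finite_Int)
  qed
  ultimately have "card (S \<inter> \<K>) \<le> 2" using card by linarith
  moreover have "{K \<in> \<K>. K \<inter> X \<noteq> {}} \<subseteq> S \<inter> \<K>" using \<kappa>K by (force simp: S_def)
  then have "card {K \<in> \<K>. K \<inter> X \<noteq> {}} \<le> card (S \<inter> \<K>)" using finS by (intro card_mono) auto
  ultimately show ?thesis by simp
qed

text \<open>The layers are distances from the roots \<open>R\<close>. Edges between roots stay in
  layer 0, and all others follow \<open>nb\<close>. A vertex has at most two neighbours there, and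
  beyond the roots one of them is its predecessor. So the layer size can double only from layer 0 to
  layer 1.\<close>

lemma bfs_layers:
  assumes finV: "finite V" and rV: "r \<subseteq> V \<times> V" and symr: "sym r" and RV: "R \<subseteq> V"
    and reach: "\<And>v. v \<in> V \<Longrightarrow> \<exists>w\<in>R. (w, v) \<in> r\<^sup>*"
    and Rk: "\<And>v. v \<in> V \<Longrightarrow> card {w \<in> R. (v, w) \<in> r\<^sup>*} \<le> k"
    and nb: "\<And>u v. (u, v) \<in> r \<Longrightarrow> v \<in> nb u \<or> u \<in> R \<and> v \<in> R"
    and nb2: "\<And>u. finite (nb u)" "\<And>u. card (nb u) \<le> 2"
  obtains l :: "'n \<Rightarrow> nat" where "\<And>u v. (u, v) \<in> r \<Longrightarrow> l v \<le> l u + 1"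
    "\<And>v n. v \<in> V \<Longrightarrow> card {w \<in> V. (v, w) \<in> r\<^sup>* \<and> l w = n} \<le> 2 * k"
proof -
  define l where "l v = (LEAST n. \<exists>w\<in>R. (w, v) \<in> r ^^ n)" for v
  have ex: "\<exists>n. \<exists>w\<in>R. (w, v) \<in> r ^^ n" if v: "v \<in> V" for v
    using reach[OF v] by (auto simp: rtrancl_power)
  have lI: "\<exists>w\<in>R. (w, v) \<in> r ^^ l v" if "v \<in> V" for v
    unfolding l_def using ex[OF that] by (rule LeastI_ex)
  have l_le: "l v \<le> n" if "w \<in> R" "(w, v) \<in> r ^^ n" for v w n
    unfolding l_def using that by (intro Least_le) blast
  have step: "l v \<le> l u + 1" if uv: "(u, v) \<in> r" for u v
  proof -
    have "u \<in> V" using uv rV by blast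
    then obtain w where "w \<in> R" "(w, u) \<in> r ^^ l u" using lI by blast
    then have "(w, v) \<in> r ^^ Suc (l u)" using uv by auto
    then show ?thesis using l_le[OF \<open>w \<in> R\<close>] by simp
  qed
  have l0: "l v = 0 \<longleftrightarrow> v \<in> R" if v: "v \<in> V" for v
  proof
    assume "l v = 0"
    then show "v \<in> R" using lI[OF v] by auto
  next
    assume "v \<in> R"
    then show "l v = 0" using l_le[of v v 0] by simp
  qed
  have pred: "\<exists>p\<in>V. (p, v) \<in> r \<and> l p = n" if v: "v \<in> V" "l v = Suc n" for v n
  proof -
    obtain w where w: "w \<in> R" "(w, v) \<in> r ^^ Suc n" using lI[OF v(1)] v(2) by metis
    then obtain p where p: "(w, p) \<in> r ^^ n" "(p, v) \<in> r" by auto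
    then have "l p \<le> n" using l_le w(1) by blast
    moreover have "l v \<le> l p + 1" using step p(2) by blast
    ultimately show ?thesis using p(2) v rV by (intro bexI[of _ p]) auto
  qed
  have layer: "card {w \<in> V. (v, w) \<in> r\<^sup>* \<and> l w = n} \<le> (if n = 0 then k else 2 * k)"
    if v: "v \<in> V" for v n
  proof (induction n)
    case 0
    have "{w \<in> V. (v, w) \<in> r\<^sup>* \<and> l w = 0} = {w \<in> R. (v, w) \<in> r\<^sup>*}" using l0 RV by blast
    then show ?case using Rk[OF v] by simp
  next
    case (Suc n)
    let ?L = "\<lambda>n. {w \<in> V. (v, w) \<in> r\<^sup>* \<and> l w = n}"
    have finL: "finite (?L m)" for m using finV by simp
    have succ: "\<exists>p\<in>?L n. w \<in> nb p \<and> (p, w) \<in> r" if w: "w \<in> ?L (Suc n)" for w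
    proof -
      obtain p where p: "p \<in> V" "(p, w) \<in> r" "l p = n" using pred w by blast
      have "(w, p) \<in> r" using p(2) symr by (blast dest: symD)
      then have "(v, p) \<in> r\<^sup>*" using w by auto
      moreover have "w \<notin> R" using l0[of w] w by auto
      ultimately show ?thesis using nb[OF p(2)] p by blast
    qed
    show ?case
    proof (cases n)
      case 0
      have "?L (Suc n) \<subseteq> (\<Union>p\<in>?L n. nb p)" using succ by blast
      then have "card (?L (Suc n)) \<le> card (\<Union>p\<in>?L n. nb p)" using finL nb2 by (intro card_mono) auto
      also have "\<dots> \<le> (\<Sum>p\<in>?L n. card (nb p))" using finL by (rule card_UN_le)
      also have "\<dots> \<le> (\<Sum>p\<in>?L n. 2)" by (intro sum_mono nb2)
      also have "\<dots> \<le> 2 * k" using Suc 0 by simp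
      finally show ?thesis by simp
    next
      case (Suc m)
      define q where "q p = (SOME q. (q, p) \<in> r \<and> l q = m)" for p
      have q: "(q p, p) \<in> r \<and> l (q p) = m" if "p \<in> ?L n" for p
        unfolding q_def using pred[of p m] that Suc by (intro someI_ex[of "\<lambda>q. (q, p) \<in> r \<and> l q = m"]) auto
      have "?L (Suc n) \<subseteq> (\<Union>p\<in>?L n. nb p - {q p})" using succ q Suc by fastforce
      then have "card (?L (Suc n)) \<le> card (\<Union>p\<in>?L n. nb p - {q p})"
        using finL nb2 by (intro card_mono) auto
      also have "\<dots> \<le> (\<Sum>p\<in>?L n. card (nb p - {q p}))" using finL by (rule card_UN_le)
      also have "\<dots> \<le> (\<Sum>p\<in>?L n. 1)"
      proof (rule sum_mono)
        fix p assume p: "p \<in> ?L n"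
        have "(p, q p) \<in> r" using q[OF p] symr by (blast dest: symD)
        moreover have "p \<notin> R" using p l0[of p] Suc by auto
        ultimately have "q p \<in> nb p" using nb by blast
        then show "card (nb p - {q p}) \<le> 1" using nb2[of p] by (simp add: card_Diff_singleton)
      qed
      also have "\<dots> \<le> 2 * k" using Suc.IH Suc by simp
      finally show ?thesis by simp
    qed
  qed
  show ?thesis
  proof
    show "l v \<le> l u + 1" if "(u, v) \<in> r" for u v using step that .
    show "card {w \<in> V. (v, w) \<in> r\<^sup>* \<and> l w = n} \<le> 2 * k" if "v \<in> V" for v n
      using layer[OF that, of n] by (auto split: if_splits)
  qed
qed

text \<open>Each component meets at most two members of \<open>\<K>\<close>, by
  \<open>few_small_cuts_in_component\<close>, and each member carries at most one edge of
  \<open>\<Gamma>\<close>. So a component contains at most four ends of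
  \<open>\<Gamma>\<close>-edges. With these as roots of a breadth-first search, at most eight
  vertices share a layer.\<close>

lemma layering_of_sparse_multigraph:
  fixes a b :: "'e \<Rightarrow> 'n"
  assumes finV: "finite V" and finB: "finite B" and fin\<Gamma>: "finite \<Gamma>"
    and ends: "\<And>e. e \<in> B \<union> \<Gamma> \<Longrightarrow> a e \<in> V \<and> b e \<in> V"
    and deg: "\<And>v. card {e \<in> B. a e = v} + card {e \<in> B. b e = v} \<le> 2"
    and disj: "pairwise disjnt \<K>"
    and cut: "\<And>K. K \<in> \<K> \<Longrightarrow> card {e \<in> B. (a e \<in> K) \<noteq> (b e \<in> K)} \<le> 1"
    and \<Gamma>: "\<And>g. g \<in> \<Gamma> \<Longrightarrow> \<exists>K\<in>\<K>. a g \<in> K \<and> b g \<in> K"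
    and \<Gamma>1: "\<And>g g' K. g \<in> \<Gamma> \<Longrightarrow> g' \<in> \<Gamma> \<Longrightarrow> K \<in> \<K> \<Longrightarrow> a g \<in> K \<Longrightarrow> a g' \<in> K \<Longrightarrow> g = g'"
  obtains \<rho> :: "'n \<Rightarrow> 'n set" and l :: "'n \<Rightarrow> nat"
  where "\<And>e. e \<in> B \<union> \<Gamma> \<Longrightarrow> \<rho> (a e) = \<rho> (b e) \<and> l (a e) \<le> l (b e) + 1 \<and> l (b e) \<le> l (a e) + 1"
    "\<And>v n. v \<in> V \<Longrightarrow> card {w \<in> V. \<rho> w = \<rho> v \<and> l w = n} \<le> 8"
proof -
  define r where "r = (\<lambda>e. (a e, b e)) ` (B \<union> \<Gamma>) \<union> (\<lambda>e. (b e, a e)) ` (B \<union> \<Gamma>)"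
  have rV: "r \<subseteq> V \<times> V" using ends by (auto simp: r_def)
  have symr: "sym r" by (auto simp: r_def sym_def)
  have symr': "sym (r\<^sup>*)" using symr by (rule sym_rtrancl)
  define \<rho> where "\<rho> v = r\<^sup>* `` {v}" for v
  have \<rho>_eq: "\<rho> u = \<rho> v \<longleftrightarrow> (u, v) \<in> r\<^sup>*" for u v
  proof
    assume "\<rho> u = \<rho> v"
    then show "(u, v) \<in> r\<^sup>*" by (auto simp: \<rho>_def)
  next
    assume uv: "(u, v) \<in> r\<^sup>*"
    then have "(v, u) \<in> r\<^sup>*" using symr' by (blast dest: symD)
    with uv show "\<rho> u = \<rho> v" unfolding \<rho>_def by (auto intro: rtrancl_trans)
  qed
  have \<rho>_mem: "\<rho> w = \<rho> v" if "w \<in> \<rho> v" for v w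
    using that \<rho>_eq[of v w] by (simp add: \<rho>_def)
  have \<rho>V: "\<rho> v \<subseteq> V" if "v \<in> V" for v
  proof
    fix w assume "w \<in> \<rho> v"
    then have "(v, w) \<in> r\<^sup>*" by (simp add: \<rho>_def)
    then show "w \<in> V" using that rV by (induction rule: rtrancl_induct) auto
  qed
  define Ends where "Ends = a ` \<Gamma> \<union> b ` \<Gamma>"
  have Ends4: "card (Ends \<inter> \<rho> v) \<le> 4" if v: "v \<in> V" for v
  proof -
    have fin\<rho>: "finite (\<rho> v)" using \<rho>V[OF v] finV by (rule finite_subset)
    have conn: "\<exists>e\<in>B \<union> \<Gamma>. a e \<in> A \<and> b e \<in> \<rho> v - A \<or> b e \<in> A \<and> a e \<in> \<rho> v - A"
      if A: "A \<subset> \<rho> v" "A \<noteq> {}" for A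
    proof -
      obtain x y where xy: "x \<in> A" "y \<in> \<rho> v" "y \<notin> A" using A by blast
      have "\<rho> x = \<rho> v" "\<rho> y = \<rho> v" 
        using xy(2) by (simp_all add: \<rho>_mem subsetD[OF psubset_imp_subset[OF A(1)] xy(1)])
      then have "(x, y) \<in> r\<^sup>*" using \<rho>_eq by metis
      from rtrancl_leaves[OF this xy(1,3)] obtain p q where pq: "(p, q) \<in> r" "p \<in> A" "q \<notin> A" by blast
      have "q \<in> \<rho> v" using pq A by (auto simp: \<rho>_def intro: rtrancl_into_rtrancl)
      then show ?thesis using pq by (auto simp: r_def)
    qed
    have "v \<in> \<rho> v" by (simp add: \<rho>_def)
    then have K2: "card {K \<in> \<K>. K \<inter> \<rho> v \<noteq> {}} \<le> 2"
      by (intro few_small_cuts_in_component[OF finB fin\<rho> _ deg disj cut \<Gamma> conn]) auto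
    let ?G = "{g \<in> \<Gamma>. a g \<in> \<rho> v}"
    have "\<forall>g\<in>\<Gamma>. \<exists>K. K \<in> \<K> \<and> a g \<in> K" using \<Gamma> by blast
    then obtain k where k: "\<And>g. g \<in> \<Gamma> \<Longrightarrow> k g \<in> \<K> \<and> a g \<in> k g" by metis
    have finK: "finite {K \<in> \<K>. K \<inter> \<rho> v \<noteq> {}}"
    proof -
      have "{K \<in> \<K>. K \<inter> \<rho> v \<noteq> {}} \<subseteq> (\<lambda>z. THE K. K \<in> \<K> \<and> z \<in> K) ` \<rho> v"
      proof
        fix K assume "K \<in> {K \<in> \<K>. K \<inter> \<rho> v \<noteq> {}}"
        then obtain z where z: "K \<in> \<K>" "z \<in> K" "z \<in> \<rho> v" by blast
        then have "(THE K. K \<in> \<K> \<and> z \<in> K) = K"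
          using disj by (intro the_equality) (auto simp: pairwise_def disjnt_def)
        then show "K \<in> (\<lambda>z. THE K. K \<in> \<K> \<and> z \<in> K) ` \<rho> v" using z by force
      qed
      then show ?thesis using fin\<rho> by (meson finite_imageI finite_subset)
    qed
    have "inj_on k ?G"
    proof (rule inj_onI)
      fix g g' assume "g \<in> ?G" "g' \<in> ?G" "k g = k g'"
      then show "g = g'" using \<Gamma>1[of g g' "k g"] k[of g] k[of g'] by simp
    qed
    moreover have "k ` ?G \<subseteq> {K \<in> \<K>. K \<inter> \<rho> v \<noteq> {}}" using k by blast
    ultimately have "card ?G \<le> card {K \<in> \<K>. K \<inter> \<rho> v \<noteq> {}}" using finK by (rule card_inj_on_le)
    then have G2: "card ?G \<le> 2" using K2 by simp
    have finG: "finite ?G" using fin\<Gamma> by simp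
    have "Ends \<inter> \<rho> v \<subseteq> a ` ?G \<union> b ` ?G"
    proof
      fix z assume z: "z \<in> Ends \<inter> \<rho> v"
      then obtain g where g: "g \<in> \<Gamma>" "z = a g \<or> z = b g" by (auto simp: Ends_def)
      have "(b g, a g) \<in> r" using g by (auto simp: r_def)
      then have "a g \<in> \<rho> v" using z g by (auto simp: \<rho>_def intro: rtrancl_into_rtrancl)
      then show "z \<in> a ` ?G \<union> b ` ?G" using g by blast
    qed
    then have "card (Ends \<inter> \<rho> v) \<le> card (a ` ?G \<union> b ` ?G)" using finG by (intro card_mono) auto
    also have "\<dots> \<le> card (a ` ?G) + card (b ` ?G)" by (rule card_Un_le)
    also have "\<dots> \<le> card ?G + card ?G" using finG by (intro add_mono card_image_le)
    finally show ?thesis using G2 by simp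
  qed
  \<comment> \<open>All ends of \<open>\<Gamma>\<close>-edges are roots, so these edges stay in
    layer 0 and only \<open>B\<close>, of degree at most two, determines the further layers. A
    component without such ends gets one arbitrary root.\<close>
  define R where "R = {v \<in> V. v \<in> Ends \<or> Ends \<inter> \<rho> v = {} \<and> v = (SOME w. w \<in> \<rho> v)}"
  define nb where "nb v = b ` {e \<in> B. a e = v} \<union> a ` {e \<in> B. b e = v}" for v
  obtain l :: "'n \<Rightarrow> nat" where l: "\<And>u v. (u, v) \<in> r \<Longrightarrow> l v \<le> l u + 1"
    "\<And>v n. v \<in> V \<Longrightarrow> card {w \<in> V. (v, w) \<in> r\<^sup>* \<and> l w = n} \<le> 2 * 4"
  proof (rule bfs_layers[OF finV rV symr])
    show "R \<subseteq> V" by (auto simp: R_def)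
    show "\<exists>w\<in>R. (w, v) \<in> r\<^sup>*" if v: "v \<in> V" for v
    proof (cases "Ends \<inter> \<rho> v = {}")
      case True
      have "v \<in> \<rho> v" by (simp add: \<rho>_def)
      then have w: "(SOME w. w \<in> \<rho> v) \<in> \<rho> v" by (rule someI)
      then have eq: "\<rho> (SOME w. w \<in> \<rho> v) = \<rho> v" by (rule \<rho>_mem)
      then have "(SOME w. w \<in> \<rho> v) \<in> R" using w \<rho>V[OF v] True by (auto simp only: R_def mem_Collect_eq)
      then show ?thesis using eq \<rho>_eq by blast
    next
      case False
      then obtain w where w: "w \<in> Ends" "w \<in> \<rho> v" by blast
      then have "(w, v) \<in> r\<^sup>*" using symr' by (auto simp: \<rho>_def dest: symD)
      then show ?thesis using w \<rho>V[OF v] by (auto simp: R_def)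
    qed
    show "card {w \<in> R. (v, w) \<in> r\<^sup>*} \<le> 4" if v: "v \<in> V" for v
    proof (cases "Ends \<inter> \<rho> v = {}")
      case True
      have "{w \<in> R. (v, w) \<in> r\<^sup>*} \<subseteq> {SOME w. w \<in> \<rho> v}"
      proof
        fix w assume w: "w \<in> {w \<in> R. (v, w) \<in> r\<^sup>*}"
        then have "\<rho> v = \<rho> w" by (simp add: \<rho>_eq)
        moreover have "w \<in> \<rho> v" using w by (simp add: \<rho>_def)
        ultimately show "w \<in> {SOME w. w \<in> \<rho> v}" using w True by (auto simp: R_def)
      qed
      then have "card {w \<in> R. (v, w) \<in> r\<^sup>*} \<le> card {SOME w. w \<in> \<rho> v}" by (intro card_mono) auto
      then show ?thesis by simp
    next
      case False
      have "{w \<in> R. (v, w) \<in> r\<^sup>*} \<subseteq> Ends \<inter> \<rho> v"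
      proof
        fix w assume w: "w \<in> {w \<in> R. (v, w) \<in> r\<^sup>*}"
        then have "\<rho> v = \<rho> w" by (simp add: \<rho>_eq)
        moreover have "w \<in> \<rho> v" using w by (simp add: \<rho>_def)
        ultimately show "w \<in> Ends \<inter> \<rho> v" using w False by (auto simp: R_def)
      qed
      then have "card {w \<in> R. (v, w) \<in> r\<^sup>*} \<le> card (Ends \<inter> \<rho> v)"
        using fin\<Gamma> by (intro card_mono) (auto simp: Ends_def)
      then show ?thesis using Ends4[OF v] by simp
    qed
    show "v \<in> nb u \<or> u \<in> R \<and> v \<in> R" if uv: "(u, v) \<in> r" for u v
    proof -
      obtain e where e: "e \<in> B \<union> \<Gamma>" "u = a e \<and> v = b e \<or> u = b e \<and> v = a e"
        using uv by (auto simp: r_def)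
      show ?thesis
      proof (cases "e \<in> B")
        case True
        then show ?thesis using e by (auto simp: nb_def)
      next
        case False
        then have "u \<in> Ends" "v \<in> Ends" using e by (auto simp: Ends_def)
        then show ?thesis using uv rV by (auto simp: R_def)
      qed
    qed
    show "finite (nb u)" for u using finB by (simp add: nb_def)
    show "card (nb u) \<le> 2" for u
    proof -
      have "card (nb u) \<le> card (b ` {e \<in> B. a e = u}) + card (a ` {e \<in> B. b e = u})"
        unfolding nb_def by (rule card_Un_le)
      also have "\<dots> \<le> card {e \<in> B. a e = u} + card {e \<in> B. b e = u}"
        using finB by (intro add_mono card_image_le) auto
      finally show ?thesis using deg[of u] by simp
    qed
  qed blast
  show ?thesis
  proof
    show "\<rho> (a e) = \<rho> (b e) \<and> l (a e) \<le> l (b e) + 1 \<and> l (b e) \<le> l (a e) + 1" if "e \<in> B \<union> \<Gamma>" for e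
    proof -
      have e: "(a e, b e) \<in> r" "(b e, a e) \<in> r" using that by (auto simp: r_def)
      then show ?thesis using l(1)[OF e(1)] l(1)[OF e(2)] by (auto simp: \<rho>_eq)
    qed
    show "card {w \<in> V. \<rho> w = \<rho> v \<and> l w = n} \<le> 8" if v: "v \<in> V" for v n
    proof -
      have "\<rho> w = \<rho> v \<longleftrightarrow> (v, w) \<in> r\<^sup>*" for w using \<rho>_eq[of v w] by auto
      then show ?thesis using l(2)[OF v, of n] by simp
    qed
  qed
qed

section \<open>Covering every edge by two thin subgraphs\<close>

text \<open>\<open>\<rho>\<close> names the component of a vertex and \<open>l\<close> its layer. The values of \<open>\<rho>\<close> are sets of contracted
  vertices, which are themselves sets of vertices.\<close>

definition thin :: "'a set \<Rightarrow> 'a set set \<Rightarrow> bool" where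
  "thin V F \<longleftrightarrow> (\<exists>(\<rho> :: 'a \<Rightarrow> 'a set set) (l :: 'a \<Rightarrow> nat).
    (\<forall>u v. {u, v} \<in> F \<longrightarrow> \<rho> u = \<rho> v \<and> l u \<le> l v + 1) \<and>
    (\<forall>v\<in>V. \<forall>n. card {w \<in> V. \<rho> w = \<rho> v \<and> l w = n} \<le> 16))"

lemma card_le_fibres:
  assumes "finite Z" "\<And>w. w \<in> W \<Longrightarrow> f w \<in> Z" "\<And>z. z \<in> Z \<Longrightarrow> card {w \<in> W. f w = z} \<le> c" "finite W"
  shows "card W \<le> c * card Z"
proof -
  have "card W = card {w \<in> W. f w \<in> Z}" using assms(2) by (intro arg_cong[of _ _ card]) auto
  also have "\<dots> = (\<Sum>z\<in>Z. card {w \<in> W. f w = z})" using assms by (simp only: sum_card_fibres)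
  also have "\<dots> \<le> (\<Sum>z\<in>Z. c)" by (intro sum_mono assms)
  finally show ?thesis by (simp add: mult.commute)
qed

text \<open>\<open>\<pi>\<close> contracts the edges of \<open>M\<close>, which then cost nothing in
  a layering. The contracted multigraph is layered and the layering is pulled back; a class has at
  most two vertices, so the bound 8 becomes 16. \<open>sat\<close> makes each member of
  \<open>\<K>\<close> a union of classes, so that cuts survive the contraction.\<close>

lemma thinI:
  fixes \<pi> :: "'a \<Rightarrow> 'a set"
  assumes G: "simple_graph V E" and ab: "\<And>e. e \<in> E \<Longrightarrow> e = {a e, b e}"
    and sub: "B \<subseteq> E" "\<Gamma> \<subseteq> E" "M \<subseteq> E"
    and \<pi>2: "\<And>z. card {v \<in> V. \<pi> v = z} \<le> 2"
    and \<pi>M: "\<And>u v. {u, v} \<in> M \<Longrightarrow> \<pi> u = \<pi> v"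
    and deg: "\<And>z. card {e \<in> B. \<pi> (a e) = z} + card {e \<in> B. \<pi> (b e) = z} \<le> 2"
    and disj: "pairwise disjnt \<K>" and KV: "\<And>K. K \<in> \<K> \<Longrightarrow> K \<subseteq> V"
    and sat: "\<And>K u v. K \<in> \<K> \<Longrightarrow> u \<in> K \<Longrightarrow> v \<in> V \<Longrightarrow> \<pi> u = \<pi> v \<Longrightarrow> v \<in> K"
    and cut: "\<And>K. K \<in> \<K> \<Longrightarrow> card (boundary B K) \<le> 1"
    and \<Gamma>: "\<And>g. g \<in> \<Gamma> \<Longrightarrow> \<exists>K\<in>\<K>. g \<subseteq> K"
    and \<Gamma>1: "\<And>g g' K. g \<in> \<Gamma> \<Longrightarrow> g' \<in> \<Gamma> \<Longrightarrow> K \<in> \<K> \<Longrightarrow> g \<inter> K \<noteq> {} \<Longrightarrow> g' \<inter> K \<noteq> {} \<Longrightarrow> g = g'"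
  shows "thin V (B \<union> \<Gamma> \<union> M)"
proof -
  note fin = simple_graph_finite[OF G]
  have inV: "a e \<in> V" "b e \<in> V" if "e \<in> E" for e
  proof -
    from G that obtain u v where "e = {u, v}" "u \<in> V" "v \<in> V" by (rule simple_graph_edgeE)
    then have "e \<subseteq> V" by simp
    then show "a e \<in> V" "b e \<in> V" using ab[OF that] by auto
  qed
  have mem: "\<pi> v \<in> \<pi> ` K \<longleftrightarrow> v \<in> K" if "K \<in> \<K>" "v \<in> V" for K v
  proof
    assume "\<pi> v \<in> \<pi> ` K"
    then obtain u where "u \<in> K" "\<pi> u = \<pi> v" by force
    then show "v \<in> K" using sat that by blast
  qed simp
  obtain \<rho> :: "'a set \<Rightarrow> 'a set set" and l :: "'a set \<Rightarrow> nat" where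
    \<rho>l: "\<And>e. e \<in> B \<union> \<Gamma> \<Longrightarrow> \<rho> (\<pi> (a e)) = \<rho> (\<pi> (b e)) \<and>
      l (\<pi> (a e)) \<le> l (\<pi> (b e)) + 1 \<and> l (\<pi> (b e)) \<le> l (\<pi> (a e)) + 1"
    and fib: "\<And>v n. v \<in> \<pi> ` V \<Longrightarrow> card {w \<in> \<pi> ` V. \<rho> w = \<rho> v \<and> l w = n} \<le> 8"
  proof (rule layering_of_sparse_multigraph[of "\<pi> ` V" B \<Gamma> "\<lambda>e. \<pi> (a e)" "\<lambda>e. \<pi> (b e)" "(`) \<pi> ` \<K>"])
    show "finite (\<pi> ` V)" "finite B" "finite \<Gamma>" using fin sub by (auto intro: finite_subset)
    show "\<pi> (a e) \<in> \<pi> ` V \<and> \<pi> (b e) \<in> \<pi> ` V" if "e \<in> B \<union> \<Gamma>" for e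
      using that sub inV by blast
    show "card {e \<in> B. \<pi> (a e) = v} + card {e \<in> B. \<pi> (b e) = v} \<le> 2" for v by (rule deg)
    show "pairwise disjnt ((`) \<pi> ` \<K>)"
      unfolding pairwise_def disjnt_def
    proof (intro ballI impI)
      fix X Y assume "X \<in> (`) \<pi> ` \<K>" "Y \<in> (`) \<pi> ` \<K>" "X \<noteq> Y"
      then obtain K L where KL: "K \<in> \<K>" "L \<in> \<K>" "X = \<pi> ` K" "Y = \<pi> ` L" "K \<noteq> L" by auto
      then have "K \<inter> L = {}" using disj by (simp add: pairwise_def disjnt_def)
      then show "X \<inter> Y = {}" using KL mem[OF KL(2)] KV[OF KL(1)] by blast
    qed
    show "card {e \<in> B. (\<pi> (a e) \<in> K) \<noteq> (\<pi> (b e) \<in> K)} \<le> 1" if K: "K \<in> (`) \<pi> ` \<K>" for K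
    proof -
      obtain L where L: "L \<in> \<K>" "K = \<pi> ` L" using K by blast
      have "{e \<in> B. (\<pi> (a e) \<in> K) \<noteq> (\<pi> (b e) \<in> K)} \<subseteq> boundary B L"
      proof
        fix e assume e: "e \<in> {e \<in> B. (\<pi> (a e) \<in> K) \<noteq> (\<pi> (b e) \<in> K)}"
        then have eE: "e \<in> E" using sub by auto
        then have "(a e \<in> L) \<noteq> (b e \<in> L)" using e L mem inV by auto
        then show "e \<in> boundary B L" using e ab[OF eE] unfolding boundary_def by auto
      qed
      moreover have "finite (boundary B L)" using fin(2) sub by (auto simp: boundary_def intro: finite_subset)
      ultimately show ?thesis using cut[OF L(1)] card_mono order_trans by blast
    qed
    show "\<exists>K\<in>(`) \<pi> ` \<K>. \<pi> (a g) \<in> K \<and> \<pi> (b g) \<in> K" if g: "g \<in> \<Gamma>" for g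
    proof -
      obtain K where K: "K \<in> \<K>" "g \<subseteq> K" using \<Gamma>[OF g] by blast
      have "g = {a g, b g}" using g sub ab by blast
      then have "a g \<in> K" "b g \<in> K" using K by auto
      then show ?thesis using K by blast
    qed
    show "g = g'" if g: "g \<in> \<Gamma>" "g' \<in> \<Gamma>" and K: "K \<in> (`) \<pi> ` \<K>" "\<pi> (a g) \<in> K" "\<pi> (a g') \<in> K"
      for g g' K
    proof -
      obtain L where L: "L \<in> \<K>" "K = \<pi> ` L" using K by blast
      have gE: "g \<in> E" "g' \<in> E" using g sub by auto
      then have "a g \<in> L" "a g' \<in> L" using K L mem inV by auto
      then have "g \<inter> L \<noteq> {}" "g' \<inter> L \<noteq> {}" using ab[OF gE(1)] ab[OF gE(2)] by blast+
      then show ?thesis using \<Gamma>1[OF g L(1)] by blast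
    qed
  qed blast
  show ?thesis unfolding thin_def
  proof (intro exI conjI allI impI ballI)
    show "\<rho> (\<pi> u) = \<rho> (\<pi> v)" "l (\<pi> u) \<le> l (\<pi> v) + 1" if uv: "{u, v} \<in> B \<union> \<Gamma> \<union> M" for u v
    proof -
      have "\<rho> (\<pi> u) = \<rho> (\<pi> v) \<and> l (\<pi> u) \<le> l (\<pi> v) + 1"
      proof (cases "{u, v} \<in> M")
        case True
        then show ?thesis using \<pi>M by simp
      next
        case False
        then have e: "{u, v} \<in> B \<union> \<Gamma>" using uv by blast
        then have "{u, v} \<in> E" using sub by blast
        from ab[OF this] have "u = a {u, v} \<and> v = b {u, v} \<or> u = b {u, v} \<and> v = a {u, v}"
          by (simp add: doubleton_eq_iff)
        then show ?thesis using \<rho>l[OF e] by metis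
      qed
      then show "\<rho> (\<pi> u) = \<rho> (\<pi> v)" "l (\<pi> u) \<le> l (\<pi> v) + 1" by simp_all
    qed
    show "card {w \<in> V. \<rho> (\<pi> w) = \<rho> (\<pi> v) \<and> l (\<pi> w) = n} \<le> 16" if v: "v \<in> V" for v n
    proof -
      let ?Z = "{z \<in> \<pi> ` V. \<rho> z = \<rho> (\<pi> v) \<and> l z = n}"
      have "card {w \<in> V. \<rho> (\<pi> w) = \<rho> (\<pi> v) \<and> l (\<pi> w) = n} \<le> 2 * card ?Z"
      proof (rule card_le_fibres)
        show "card {w \<in> {w \<in> V. \<rho> (\<pi> w) = \<rho> (\<pi> v) \<and> l (\<pi> w) = n}. \<pi> w = z} \<le> 2" for z
        proof -
          have "card {w \<in> {w \<in> V. \<rho> (\<pi> w) = \<rho> (\<pi> v) \<and> l (\<pi> w) = n}. \<pi> w = z} \<le> card {w \<in> V. \<pi> w = z}"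
            using fin(1) by (intro card_mono) auto
          then show ?thesis using \<pi>2[of z] by simp
        qed
      qed (use fin(1) in auto)
      then show ?thesis using fib[of "\<pi> v" n] v by simp
    qed
  qed
qed

lemma thinI_no_contraction:
  assumes G: "simple_graph V E" and ab: "\<And>e. e \<in> E \<Longrightarrow> e = {a e, b e}"
    and sub: "B \<subseteq> E" "\<Gamma> \<subseteq> E"
    and deg: "\<And>v. card {e \<in> B. a e = v} + card {e \<in> B. b e = v} \<le> 2"
    and disj: "pairwise disjnt \<K>" and KV: "\<And>K. K \<in> \<K> \<Longrightarrow> K \<subseteq> V"
    and cut: "\<And>K. K \<in> \<K> \<Longrightarrow> card (boundary B K) \<le> 1"
    and \<Gamma>: "\<And>g. g \<in> \<Gamma> \<Longrightarrow> \<exists>K\<in>\<K>. g \<subseteq> K"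
    and \<Gamma>1: "\<And>g g' K. g \<in> \<Gamma> \<Longrightarrow> g' \<in> \<Gamma> \<Longrightarrow> K \<in> \<K> \<Longrightarrow> g \<inter> K \<noteq> {} \<Longrightarrow> g' \<inter> K \<noteq> {} \<Longrightarrow> g = g'"
  shows "thin V (B \<union> \<Gamma>)"
proof -
  have "card {e \<in> B. {a e} = z} + card {e \<in> B. {b e} = z} \<le> 2" for z
  proof (cases "\<exists>v. z = {v}")
    case True
    then show ?thesis using deg by auto
  next
    case False
    then have "{e \<in> B. {a e} = z} = {}" "{e \<in> B. {b e} = z} = {}" by auto
    then show ?thesis by (simp only: card.empty)
  qed
  moreover have "card {v \<in> V. {v} = z} \<le> 2" for z
  proof -
    have "card {v \<in> V. {v} = z} \<le> card {the_elem z}" by (intro card_mono) auto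
    then show ?thesis by simp
  qed
  ultimately have "thin V (B \<union> \<Gamma> \<union> {})"
    using disj KV cut \<Gamma> \<Gamma>1
    by (intro thinI[OF G ab sub, where \<pi> = "\<lambda>v. {v}" and \<K> = \<K>]) auto
  then show ?thesis by simp
qed

lemma simple_graph_ends:
  assumes "simple_graph V E"
  obtains a b where "\<forall>e\<in>E. e = {a e, b e}" "\<forall>e\<in>E. a e \<noteq> b e"
proof -
  have "\<forall>e\<in>E. \<exists>p. e = {fst p, snd p} \<and> fst p \<noteq> snd p" using assms by (force simp: simple_graph_def)
  then obtain p where "\<forall>e\<in>E. e = {fst (p e), snd (p e)} \<and> fst (p e) \<noteq> snd (p e)" by metis
  then show ?thesis using that[of "\<lambda>e. fst (p e)" "\<lambda>e. snd (p e)"] by blast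
qed

lemma card_ends:
  assumes "finite F" "\<And>e. e \<in> F \<Longrightarrow> e = {a e, b e}" "\<And>e. e \<in> F \<Longrightarrow> a e \<noteq> b e"
  shows "card {e \<in> F. a e = v} + card {e \<in> F. b e = v} = card {e \<in> F. v \<in> e}"
proof -
  have "card {e \<in> F. a e = v} + card {e \<in> F. b e = v} = card ({e \<in> F. a e = v} \<union> {e \<in> F. b e = v})"
    using assms(1,3) by (intro card_Un_disjoint[symmetric]) fastforce+
  also have "{e \<in> F. a e = v} \<union> {e \<in> F. b e = v} = {e \<in> F. v \<in> e}"
  proof -
    have "v \<in> e \<longleftrightarrow> a e = v \<or> b e = v" if "e \<in> F" for e
      using arg_cong[OF assms(2)[OF that], of "\<lambda>s. v \<in> s"] by auto
    then show ?thesis by blast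
  qed
  finally show ?thesis .
qed

definition thin_cover :: "'a set \<Rightarrow> 'a set set \<Rightarrow> nat \<Rightarrow> (nat \<Rightarrow> 'a set set) \<Rightarrow> bool" where
  "thin_cover V E d F \<longleftrightarrow> (\<forall>i<d. thin V (F i)) \<and>
    (\<forall>e\<in>E. \<exists>i<d. \<exists>j<d. i < j \<and> e \<in> F i \<and> e \<in> F j)"

lemma card_incident_le:
  assumes "simple_graph V E" "\<And>v. v \<in> V \<Longrightarrow> card {e \<in> F. v \<in> e} \<le> k" "F \<subseteq> E"
  shows "card {e \<in> F. v \<in> e} \<le> k"
proof (cases "v \<in> V")
  case False
  then have "{e \<in> F. v \<in> e} = {}" using assms by (auto simp: simple_graph_def)
  then show ?thesis by (simp only: card.empty)
qed (use assms in simp)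

lemma thin_cover_even:
  assumes G: "simple_graph V E" and deg: "\<And>v. v \<in> V \<Longrightarrow> vertex_degree E v \<le> 2 * q"
  shows "\<exists>F. thin_cover V E (2 * q) F"
proof -
  note fin = simple_graph_finite[OF G]
  obtain a b where "\<forall>e\<in>E. e = {a e, b e}" "\<forall>e\<in>E. a e \<noteq> b e"
    by (rule simple_graph_ends[OF G])
  note ab = this[rule_format]
  have deg': "card {e \<in> E. v \<in> e} \<le> 2 * q" for v
    by (rule card_incident_le[OF G _ order_refl]) (use deg in \<open>simp add: vertex_degree_def\<close>)
  have "card {e \<in> E. a e = v} + card {e \<in> E. b e = v} \<le> 2 * q" for v
    using card_ends[OF fin(2) ab] deg' by simp
  from petersen_two_factors[OF fin(2) this] obtain col where col: "\<forall>e\<in>E. col e < q"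
    "\<And>i v. card {e \<in> E. col e = i \<and> a e = v} + card {e \<in> E. col e = i \<and> b e = v} \<le> 2" by blast
  \<comment> \<open>Each of the \<open>q\<close> Petersen factors is listed twice, at the indices
    \<open>2 j\<close> and \<open>2 j + 1\<close>.\<close>
  define F where "F i = {e \<in> E. col e = i div 2}" for i :: nat
  have "thin V (F i)" for i
  proof -
    have "thin V (F i \<union> {})"
      by (rule thinI_no_contraction[OF G ab(1), where \<K> = "{}"])
        (use col(2)[of "i div 2"] in \<open>auto simp: F_def conj_ac\<close>)
    then show ?thesis by simp
  qed
  moreover have "\<exists>i<2*q. \<exists>j<2*q. i < j \<and> e \<in> F i \<and> e \<in> F j" if "e \<in> E" for e
    using that col(1) by (intro exI[of _ "2 * col e"] conjI exI[of _ "2 * col e + 1"]) (auto simp: F_def)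
  ultimately show ?thesis unfolding thin_cover_def by blast
qed

lemma finite_boundary [simp]: "finite E \<Longrightarrow> finite (boundary E K)"
  by (simp add: boundary_def)

text \<open>Removing \<open>M\<close>, and one edge \<open>g K\<close> at each uncovered vertex
  \<open>x K\<close>, lowers all degrees to at most \<open>2 * q\<close>, so Petersen's theorem
  yields \<open>B 0\<close>, ..., \<open>B (q - 1)\<close>. Each \<open>g K\<close> returns as a
  \<open>\<Gamma>\<close>-edge to a factor that crosses the boundary of \<open>K\<close> at most
  once. \<open>M\<close> is covered by the two halves \<open>D 0\<close> and \<open>D 1\<close> into
  which the last factor is split after contracting \<open>M\<close>.\<close>

lemma thin_cover_odd:
  assumes G: "simple_graph V E" and q: "q \<ge> 1"
    and deg: "\<And>v. v \<in> V \<Longrightarrow> vertex_degree E v \<le> 2 * q + 1"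
  shows "\<exists>F. thin_cover V E (2 * q + 1) F"
proof -
  note fin = simple_graph_finite[OF G]
  obtain a b where "\<forall>e\<in>E. e = {a e, b e}" "\<forall>e\<in>E. a e \<noteq> b e"
    by (rule simple_graph_ends[OF G])
  note ab = this[rule_format]
  have odd: "odd (2 * q + 1)" by simp
  obtain M \<K> x where M: "M \<subseteq> E" "pairwise disjnt M" and disj: "pairwise disjnt \<K>"
    and K: "\<And>K. K \<in> \<K> \<Longrightarrow> K \<subseteq> V \<and> x K \<in> K \<and> vertex_degree E (x K) = 2 * q + 1 \<and>
      card (boundary E K) + 2 \<le> 2 * q + 1"
    and MK: "\<And>K m. K \<in> \<K> \<Longrightarrow> m \<in> M \<Longrightarrow> m \<inter> K = {} \<or> m \<subseteq> K"
    and cov: "\<And>v. v \<in> V \<Longrightarrow> vertex_degree E v = 2 * q + 1 \<Longrightarrow> v \<in> \<Union>M \<or> v \<in> x ` \<K>"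
    by (rule matching_with_small_cuts[OF G deg odd]) blast+
  \<comment> \<open>\<open>x K\<close> has degree \<open>2 * q + 1\<close>, but only
    \<open>2 * q - 1\<close> edges leave \<open>K\<close>.\<close>
  have "\<exists>g\<in>E. x K \<in> g \<and> g \<subseteq> K" if KK: "K \<in> \<K>" for K
  proof (rule ccontr)
    assume "\<not> ?thesis"
    then have "{e \<in> E. x K \<in> e} \<subseteq> boundary E K" using K[OF KK] by (auto simp: boundary_def)
    then have "vertex_degree E (x K) \<le> card (boundary E K)"
      unfolding vertex_degree_def using fin(2) by (intro card_mono) (auto simp: boundary_def)
    then show False using K[OF KK] by simp
  qed
  then have "\<forall>K\<in>\<K>. \<exists>g. g \<in> E \<and> x K \<in> g \<and> g \<subseteq> K" by blast
  then obtain g where g: "\<And>K. K \<in> \<K> \<Longrightarrow> g K \<in> E \<and> x K \<in> g K \<and> g K \<subseteq> K" by metis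
  define E1 where "E1 = E - M - g ` \<K>"
  have E1: "E1 \<subseteq> E" "finite E1" using fin by (auto simp: E1_def)
  have deg1: "card {e \<in> E1. v \<in> e} \<le> 2 * q" for v
  proof (rule card_incident_le[OF G _ E1(1)])
    fix v assume v: "v \<in> V"
    show "card {e \<in> E1. v \<in> e} \<le> 2 * q"
    proof (cases "vertex_degree E v = 2 * q + 1")
      case True
      then obtain e where "e \<in> M \<union> g ` \<K>" "v \<in> e" using cov[OF v] g by blast
      then have "e \<in> E" "e \<notin> E1" "v \<in> e" using M g by (auto simp: E1_def)
      then have "{e \<in> E1. v \<in> e} \<subset> {e \<in> E. v \<in> e}" using E1 by blast
      then have "card {e \<in> E1. v \<in> e} < card {e \<in> E. v \<in> e}" using fin(2) by (intro psubset_card_mono) auto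
      then show ?thesis using True by (simp add: vertex_degree_def)
    next
      case False
      have "card {e \<in> E1. v \<in> e} \<le> card {e \<in> E. v \<in> e}"
        using E1 fin(2) by (intro card_mono) auto
      then show ?thesis using False deg[OF v] by (simp add: vertex_degree_def)
    qed
  qed
  have "card {e \<in> E1. a e = v} + card {e \<in> E1. b e = v} \<le> 2 * q" for v
    using card_ends[OF E1(2) ab(1)[OF subsetD[OF E1(1)]] ab(2)[OF subsetD[OF E1(1)]], of v] deg1[of v] by simp
  from petersen_two_factors[OF E1(2) this] obtain col where col: "\<forall>e\<in>E1. col e < q"
    "\<And>i v. card {e \<in> E1. col e = i \<and> a e = v} + card {e \<in> E1. col e = i \<and> b e = v} \<le> 2" by blast
  define B where "B i = {e \<in> E1. col e = i}" for i :: nat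
  have BE: "B i \<subseteq> E" "finite (B i)" for i using E1 by (auto simp: B_def)
  have degB: "card {e \<in> B i. a e = v} + card {e \<in> B i. b e = v} \<le> 2" for i v
    using col(2)[of i v] by (simp add: B_def conj_ac)
  \<comment> \<open>Averaging: if all \<open>q\<close> factors crossed the cut twice, it would have
    \<open>2 * q\<close> edges, one more than allowed.\<close>
  have "\<exists>j<q. card (boundary (B j) K) \<le> 1" if KK: "K \<in> \<K>" for K
  proof (rule ccontr)
    assume neg: "\<not> ?thesis"
    have "2 * q = (\<Sum>j<q. 2)" by simp
    also have "\<dots> \<le> (\<Sum>j<q. card (boundary (B j) K))"
      using neg by (intro sum_mono) (auto simp: not_le Suc_le_eq)
    also have "\<dots> = card (\<Union>j<q. boundary (B j) K)"
    proof (rule card_UN_disjoint[symmetric])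
      show "\<forall>j\<in>{..<q}. finite (boundary (B j) K)" using BE(2) by simp
    qed (auto simp: boundary_def B_def)
    also have "\<dots> \<le> card (boundary E K)"
    proof (rule card_mono)
      show "finite (boundary E K)" using fin(2) by simp
    qed (use BE(1) in \<open>auto simp: boundary_def\<close>)
    finally show False using K[OF KK] by simp
  qed
  then have "\<forall>K\<in>\<K>. \<exists>j. j < q \<and> card (boundary (B j) K) \<le> 1" by blast
  then obtain j where j: "\<And>K. K \<in> \<K> \<Longrightarrow> j K < q \<and> card (boundary (B (j K)) K) \<le> 1" by metis
  define \<K>' where "\<K>' i = {K \<in> \<K>. j K = i}" for i
  define \<Gamma> where "\<Gamma> i = g ` \<K>' i" for i
  have \<Gamma>E: "\<Gamma> i \<subseteq> E" for i using g by (auto simp: \<Gamma>_def \<K>'_def)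
  have \<K>': "pairwise disjnt (\<K>' i)" "\<And>K. K \<in> \<K>' i \<Longrightarrow> K \<subseteq> V"
    "\<And>K. K \<in> \<K>' i \<Longrightarrow> card (boundary (B i) K) \<le> 1" for i
    using disj K j unfolding \<K>'_def by (auto intro: pairwise_subset)
  have \<Gamma>: "\<exists>K\<in>\<K>' i. h \<subseteq> K" if "h \<in> \<Gamma> i" for h i
    using that g by (auto simp: \<Gamma>_def \<K>'_def)
  have \<Gamma>1: "h = h'" if h: "h \<in> \<Gamma> i" "h' \<in> \<Gamma> i" "L \<in> \<K>' i" "h \<inter> L \<noteq> {}" "h' \<inter> L \<noteq> {}" for h h' L i
  proof -
    have "h = g L" if "h \<in> \<Gamma> i" "h \<inter> L \<noteq> {}" for h
    proof -
      obtain L' where L': "L' \<in> \<K>" "h = g L'" using \<open>h \<in> \<Gamma> i\<close> by (auto simp: \<Gamma>_def \<K>'_def)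
      then have "L' \<inter> L \<noteq> {}" using g \<open>h \<inter> L \<noteq> {}\<close> by blast
      then have "L' = L" using disj L'(1) h(3) by (auto simp: \<K>'_def pairwise_def disjnt_def)
      then show ?thesis using L' by simp
    qed
    then show ?thesis using h by blast
  qed
  define \<pi> where "\<pi> v = (if v \<in> \<Union>M then THE m. m \<in> M \<and> v \<in> m else {v})" for v
  have \<pi>m: "\<pi> v = m" if "m \<in> M" "v \<in> m" for v m
  proof -
    have "(THE m. m \<in> M \<and> v \<in> m) = m"
      using that M(2) by (intro the_equality) (auto simp: pairwise_def disjnt_def)
    then show ?thesis using that by (auto simp: \<pi>_def)
  qed
  have \<pi>: "v \<in> \<pi> v \<and> finite (\<pi> v) \<and> card (\<pi> v) \<le> 2" for v
  proof (cases "v \<in> \<Union>M")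
    case True
    then obtain m where m: "m \<in> M" "v \<in> m" by blast
    then have "m = {a m, b m}" using ab(1) M(1) by blast
    then have "finite m \<and> card m \<le> 2" by (metis card_2_iff card_1_singleton_iff finite.emptyI finite.insertI insert_absorb2 order_refl one_le_numeral is_singletonI is_singleton_altdef)
    then show ?thesis using \<pi>m[OF m] m by simp
  qed (simp add: \<pi>_def)
  define C where "C = B (q - 1)"
  \<comment> \<open>A contracted pair has degree at most 4 in the last factor, so Petersen's theorem
    splits it into two parts that have degree at most 2 even after contraction.\<close>
  have C4: "card {e \<in> C. \<pi> (a e) = z} + card {e \<in> C. \<pi> (b e) = z} \<le> 2 * 2" for z
  proof (cases "\<exists>v. \<pi> v = z")
    case True
    then have z: "finite z" "card z \<le> 2" using \<pi> by auto
    have le: "card {e \<in> C. \<pi> (f e) = z} \<le> (\<Sum>v\<in>z. card {e \<in> C. f e = v})" for f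
    proof -
      have "card {e \<in> C. \<pi> (f e) = z} \<le> card {e \<in> C. f e \<in> z}"
        using \<pi> BE by (intro card_mono) (auto simp: C_def)
      then show ?thesis using z BE by (simp add: sum_card_fibres C_def)
    qed
    have "card {e \<in> C. \<pi> (a e) = z} + card {e \<in> C. \<pi> (b e) = z} \<le>
        (\<Sum>v\<in>z. card {e \<in> C. a e = v} + card {e \<in> C. b e = v})"
      using le[of a] le[of b] by (simp add: sum.distrib)
    also have "\<dots> \<le> (\<Sum>v\<in>z. 2)" unfolding C_def by (intro sum_mono degB)
    finally show ?thesis using z by simp
  next
    case False
    then have "{e \<in> C. \<pi> (a e) = z} = {}" "{e \<in> C. \<pi> (b e) = z} = {}" by auto
    then show ?thesis by (simp only: card.empty)
  qed
  have CE: "C \<subseteq> E" "finite C" using BE by (auto simp: C_def)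
  from petersen_two_factors[OF CE(2) C4] obtain col' where col': "\<forall>e\<in>C. col' e < (2::nat)"
    "\<And>i z. card {e \<in> C. col' e = i \<and> \<pi> (a e) = z} + card {e \<in> C. col' e = i \<and> \<pi> (b e) = z} \<le> 2" by blast
  define D where "D k = {e \<in> C. col' e = k}" for k :: nat
  have DE: "D k \<subseteq> E" for k using CE by (auto simp: D_def)
  have degD: "card {e \<in> D k. \<pi> (a e) = z} + card {e \<in> D k. \<pi> (b e) = z} \<le> 2" for k z
    using col'(2)[of k z] by (simp add: D_def conj_ac)
  have \<pi>2: "card {v \<in> V. \<pi> v = z} \<le> 2" for z
  proof (cases "\<exists>v. \<pi> v = z")
    case True
    then have z: "finite z" "card z \<le> 2" using \<pi> by auto
    have "card {v \<in> V. \<pi> v = z} \<le> card z" using \<pi> z(1) by (intro card_mono) auto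
    then show ?thesis using z by simp
  next
    case False
    then have "{v \<in> V. \<pi> v = z} = {}" by auto
    then show ?thesis by (simp only: card.empty)
  qed
  have \<pi>M: "\<pi> u = \<pi> v" if "{u, v} \<in> M" for u v using \<pi>m[OF that] by simp
  have sat: "v \<in> L" if "L \<in> \<K>" "u \<in> L" "\<pi> u = \<pi> v" for L u v
  proof (cases "u \<in> \<Union>M")
    case True
    then obtain m where m: "m \<in> M" "u \<in> m" by blast
    then have "v \<in> m" using \<pi>m[OF m] that(3) \<pi>[of v] by simp
    moreover have "m \<subseteq> L" using MK[OF that(1) m(1)] m(2) that(2) by blast
    ultimately show ?thesis by blast
  next
    case False
    then have "v \<in> {u}" using that(3) \<pi>[of v] by (simp add: \<pi>_def)
    then show ?thesis using that(2) by simp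
  qed
  have thinB: "thin V (B i \<union> \<Gamma> i)" for i
    by (rule thinI_no_contraction[OF G ab(1) BE(1) \<Gamma>E degB \<K>' \<Gamma> \<Gamma>1])
  have thinD0: "thin V (D 0 \<union> \<Gamma> (q - 1) \<union> M)"
  proof (rule thinI[OF G ab(1) DE \<Gamma>E M(1) \<pi>2 \<pi>M degD \<K>'(1,2) _ _ \<Gamma> \<Gamma>1])
    show "v \<in> L" if "L \<in> \<K>' (q - 1)" "u \<in> L" "v \<in> V" "\<pi> u = \<pi> v" for L u v
      using sat[of L u v] that by (simp add: \<K>'_def)
    show "card (boundary (D 0) L) \<le> 1" if "L \<in> \<K>' (q - 1)" for L
    proof -
      have "card (boundary (D 0) L) \<le> card (boundary (B (q - 1)) L)"
      proof (rule card_mono)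
        show "finite (boundary (B (q - 1)) L)" using BE(2) by simp
      qed (auto simp: boundary_def D_def C_def)
      then show ?thesis using \<K>'(3)[OF that] by simp
    qed
  qed
  have "thin V (D 1 \<union> {} \<union> M)"
    by (rule thinI[OF G ab(1) DE _ M(1) \<pi>2 \<pi>M degD, where \<K> = "{}"]) auto
  then have thinD1: "thin V (D 1 \<union> M)" by simp
  \<comment> \<open>The list has \<open>2 (q - 1)\<close> entries from the first
    \<open>q - 1\<close> factors taken twice, one entry from the last factor, and two from its
    halves. An edge of the last factor occurs there and in one half, an edge of \<open>M\<close> in
    both halves, and an edge of \<open>\<Gamma> (q - 1)\<close> with the last factor and with
    \<open>D 0\<close>.\<close>
  define F where "F i = (if i < 2 * q - 1 then B (i div 2) \<union> \<Gamma> (i div 2)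
    else if i = 2 * q - 1 then D 0 \<union> \<Gamma> (q - 1) \<union> M else D 1 \<union> M)" for i
  have "thin V (F i)" for i unfolding F_def using thinB thinD0 thinD1 by simp
  moreover have "\<exists>i<2*q+1. \<exists>j<2*q+1. i < j \<and> e \<in> F i \<and> e \<in> F j" if e: "e \<in> E" for e
  proof -
    have low: ?thesis if "k < q - 1" "e \<in> B k \<union> \<Gamma> k" for k
      using that by (intro exI[of _ "2 * k"] conjI exI[of _ "2 * k + 1"]) (auto simp: F_def)
    have mid: "e \<in> F (2 * q - 2)" if "e \<in> B (q - 1) \<union> \<Gamma> (q - 1)"
    proof -
      have "(2 * q - 2) div 2 = q - 1" by presburger
      then show ?thesis using that q by (auto simp: F_def)
    qed
    have top: "D 0 \<union> \<Gamma> (q - 1) \<union> M = F (2 * q - 1)" "D 1 \<union> M = F (2 * q)" using q by (auto simp: F_def)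
    consider "e \<in> M" | k where "k < q - 1" "e \<in> B k \<union> \<Gamma> k" | "e \<in> \<Gamma> (q - 1)" | "e \<in> B (q - 1)"
    proof (cases "e \<in> M")
      case False
      have "\<exists>k<q. e \<in> B k \<union> \<Gamma> k"
      proof (cases "e \<in> E1")
        case True
        then show ?thesis using col(1) by (auto simp: B_def)
      next
        case nE1: False
        then obtain L where "L \<in> \<K>" "e = g L" using e False by (auto simp: E1_def)
        then show ?thesis using j by (auto simp: \<Gamma>_def \<K>'_def)
      qed
      then obtain k where "k < q" "e \<in> B k \<union> \<Gamma> k" by blast
      then have "k < q - 1 \<or> k = q - 1" by linarith
      then show ?thesis using that(2-4) \<open>e \<in> B k \<union> \<Gamma> k\<close> by auto
    qed (use that in blast)
    then show ?thesis
    proof cases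
      case 1
      then show ?thesis using top q by (intro exI[of _ "2 * q - 1"] conjI exI[of _ "2 * q"]) auto
    next
      case 2
      then show ?thesis using low by blast
    next
      case 3
      then show ?thesis using mid top q by (intro exI[of _ "2 * q - 2"] conjI exI[of _ "2 * q - 1"]) auto
    next
      case 4
      then have "e \<in> D 0 \<or> e \<in> D 1" using col'(1) by (auto simp: D_def C_def less_2_cases_iff)
      then show ?thesis
      proof
        assume "e \<in> D 0"
        then show ?thesis using 4 mid top q
          by (intro exI[of _ "2 * q - 2"] conjI exI[of _ "2 * q - 1"]) auto
      next
        assume "e \<in> D 1"
        then show ?thesis using 4 mid top q
          by (intro exI[of _ "2 * q - 2"] conjI exI[of _ "2 * q"]) auto
      qed
    qed
  qed
  ultimately show ?thesis unfolding thin_cover_def by blast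
qed

theorem thin_cover_exists:
  assumes "simple_graph V E" "\<And>v. v \<in> V \<Longrightarrow> vertex_degree E v \<le> d" "d \<ge> 2"
  shows "\<exists>F. thin_cover V E d F"
proof (cases "even d")
  case True
  then obtain q where "d = 2 * q" by blast
  then show ?thesis using thin_cover_even assms by blast
next
  case False
  then obtain q where "d = 2 * q + 1" by (rule oddE)
  then show ?thesis using thin_cover_odd[of V E q] assms by auto
qed

section \<open>Random labellings with small fibres\<close>

lemma greedy_colouring:
  assumes "finite V" and "\<And>v. v \<in> V \<Longrightarrow> card {w \<in> V. w \<noteq> v \<and> dep v w} \<le> D"
    and sym: "\<And>v w. dep v w \<Longrightarrow> dep w v"
  shows "\<exists>\<chi>. (\<forall>v\<in>V. \<chi> v \<le> D) \<and> (\<forall>v\<in>V. \<forall>w\<in>V. v \<noteq> w \<longrightarrow> dep v w \<longrightarrow> \<chi> v \<noteq> (\<chi> w :: nat))"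
  using assms(1,2)
proof (induction V rule: finite_induct)
  case empty
  show ?case by simp
next
  case (insert v V)
  have "card {w \<in> V. w \<noteq> u \<and> dep u w} \<le> D" if "u \<in> V" for u
  proof -
    have "card {w \<in> V. w \<noteq> u \<and> dep u w} \<le> card {w \<in> insert v V. w \<noteq> u \<and> dep u w}"
      using insert.hyps by (intro card_mono) auto
    then show ?thesis using insert.prems[of u] that by simp
  qed
  then obtain \<chi> where \<chi>: "\<forall>v\<in>V. \<chi> v \<le> D"
    "\<forall>v\<in>V. \<forall>w\<in>V. v \<noteq> w \<longrightarrow> dep v w \<longrightarrow> \<chi> v \<noteq> (\<chi> w :: nat)" using insert.IH by blast
  let ?N = "{w \<in> insert v V. w \<noteq> v \<and> dep v w}"
  have "card (\<chi> ` ?N) \<le> card ?N" using insert.hyps by (intro card_image_le) auto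
  also have "\<dots> \<le> D" using insert.prems by simp
  finally have "card (\<chi> ` ?N) < card {..D}" by simp
  moreover have "card {..D} \<le> card (\<chi> ` ?N)" if "{..D} \<subseteq> \<chi> ` ?N"
    using that insert.hyps by (intro card_mono) auto
  ultimately have "\<not> {..D} \<subseteq> \<chi> ` ?N" using not_le by blast
  then obtain c where c: "c \<le> D" "c \<notin> \<chi> ` ?N" by blast
  have ne: "\<chi> w \<noteq> c" if "w \<in> V" "dep v w" for w
  proof
    assume "\<chi> w = c"
    moreover have "w \<in> ?N" using that insert.hyps by auto
    ultimately show False using c(2) by blast
  qed
  show ?case
  proof (intro exI[of _ "\<chi>(v := c)"] conjI ballI impI)
    show "(\<chi>(v := c)) u \<le> D" if "u \<in> insert v V" for u using that \<chi>(1) c(1) by auto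
    show "(\<chi>(v := c)) u \<noteq> (\<chi>(v := c)) w"
      if uw: "u \<in> insert v V" "w \<in> insert v V" "u \<noteq> w" "dep u w" for u w
    proof -
      consider "u = v" "w \<in> V" | "w = v" "u \<in> V" | "u \<in> V" "w \<in> V" "u \<noteq> v" "w \<noteq> v"
        using uw by blast
      then show ?thesis
      proof cases
        case 1
        then show ?thesis using ne[of w] uw by auto
      next
        case 2
        then show ?thesis using ne[of u] uw sym by auto
      next
        case 3
        then show ?thesis using \<chi>(2) uw by auto
      qed
    qed
  qed
qed

lemma power_div_fact_le_exp:
  assumes "x \<ge> (0::real)"
  shows "x ^ n / fact n \<le> exp x"
proof -
  have s: "summable (\<lambda>n. x ^ n / fact n)" using summable_exp[of x] by (simp add: field_simps)
  have "sum (\<lambda>n. x ^ n / fact n) {n} \<le> (\<Sum>n. x ^ n / fact n)"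
    using assms by (intro sum_le_suminf s) auto
  then show ?thesis by (simp add: exp_def scaleR_conv_of_real field_simps)
qed

text \<open>\<open>n choose t\<close> is at most \<open>n^t / t!\<close>, and
  \<open>t^t / t!\<close> is at most \<open>e^t\<close>, hence at most \<open>3^t\<close>. One
  factor 3 of the 9 absorbs this, the other leaves \<open>(1/3)^t\<close>.\<close>

lemma binomial_div_power_le:
  assumes M: "M > (0::real)" and t: "9 * real n \<le> real t * M"
  shows "real (n choose t) / M ^ t \<le> (1 / 3) ^ t"
proof -
  have "real (n choose t) * fact t \<le> real n ^ t"
    using binomial_fact_pow[of n t] by (metis of_nat_fact of_nat_le_iff of_nat_mult of_nat_power)
  also have "\<dots> \<le> (real t * M / 9) ^ t" using t by (intro power_mono) auto
  also have "\<dots> = (real t ^ t / fact t) * (M / 9) ^ t * fact t" by (simp add: power_mult_distrib power_divide)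
  also have "\<dots> \<le> exp (real t) * (M / 9) ^ t * fact t"
    using M power_div_fact_le_exp[of "real t" t] by (intro mult_right_mono) auto
  also have "exp (real t) = exp 1 ^ t" by (simp add: exp_of_nat_mult[symmetric])
  also have "exp (1::real) ^ t \<le> 3 ^ t" using exp_le by (intro power_mono) auto
  finally have "real (n choose t) * fact t \<le> 3 ^ t * (M / 9) ^ t * fact t" using M by (simp add: mult_right_mono)
  then have "real (n choose t) \<le> 3 ^ t * (M / 9) ^ t" by simp
  also have "\<dots> = (1 / 3) ^ t * M ^ t"
  proof -
    have "3 ^ t * (M / 9) ^ t = (3 * (M / 9)) ^ t" by (rule power_mult_distrib[symmetric])
    also have "\<dots> = (1 / 3 * M) ^ t" by simp
    finally show ?thesis by (simp only: power_mult_distrib)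
  qed
  finally show ?thesis using M by (simp add: field_simps)
qed

text \<open>Independence in counting form: the keys of \<open>W\<close> are distinct, so prescribing
  all its labels fixes \<open>card W * card X\<close> membership bits of \<open>\<omega>\<close> and
  leaves the others free.\<close>

lemma card_prescribed_traces_le:
  assumes finX: "finite X" and finJ: "finite J" and finW: "finite W"
    and J: "\<And>v x. v \<in> W \<Longrightarrow> x \<in> X \<Longrightarrow> key v x \<in> J"
    and inj: "inj_on (\<lambda>(v, x). key v x) (W \<times> X)"
  shows "card {\<omega> \<in> Pow J. \<forall>v\<in>W. {x \<in> X. key v x \<in> \<omega>} = Z} * (2 ^ card X) ^ card W \<le> 2 ^ card J"
proof -
  let ?\<Omega> = "{\<omega> \<in> Pow J. \<forall>v\<in>W. {x \<in> X. key v x \<in> \<omega>} = Z}"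
  define J' where "J' = (\<lambda>(v, x). key v x) ` (W \<times> X)"
  have J': "J' \<subseteq> J" using J by (auto simp: J'_def)
  have cJ': "card J' = card W * card X" unfolding J'_def using inj by (simp add: card_image card_cartesian_product)
  have "inj_on (\<lambda>\<omega>. \<omega> - J') ?\<Omega>"
  proof (rule inj_onI)
    fix \<omega> \<omega>' assume w: "\<omega> \<in> ?\<Omega>" "\<omega>' \<in> ?\<Omega>" "\<omega> - J' = \<omega>' - J'"
    have "y \<in> \<omega> \<longleftrightarrow> y \<in> \<omega>'" if "y \<in> J'" for y
    proof -
      obtain v x where vx: "v \<in> W" "x \<in> X" "y = key v x" using \<open>y \<in> J'\<close> by (auto simp: J'_def)
      then have "{x \<in> X. key v x \<in> \<omega>} = {x \<in> X. key v x \<in> \<omega>'}" using w by auto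
      then show ?thesis using vx by blast
    qed
    then show "\<omega> = \<omega>'" using w(3) by blast
  qed
  moreover have "(\<lambda>\<omega>. \<omega> - J') ` ?\<Omega> \<subseteq> Pow (J - J')" by auto
  ultimately have "card ?\<Omega> \<le> card (Pow (J - J'))" using finJ by (intro card_inj_on_le) auto
  also have "\<dots> = 2 ^ (card J - card W * card X)"
    using finJ J' by (simp add: card_Pow card_Diff_subset finite_subset cJ')
  finally have "card ?\<Omega> * (2 ^ card X) ^ card W \<le> 2 ^ (card J - card W * card X) * 2 ^ (card W * card X)"
    by (simp add: power_mult[symmetric] mult.commute)
  also have "\<dots> = 2 ^ card J"
    using card_mono[OF finJ J'] cJ' by (simp add: power_add[symmetric])
  finally show ?thesis .
qed

text \<open>First moment method: \<open>\<omega>\<close> is a uniformly random set of keys. The colour classes of \<open>\<chi>\<close> consist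
  of vertices with independent labels.\<close>

lemma exists_spread_choice:
  fixes key :: "'v \<Rightarrow> 'x \<Rightarrow> 'y" and \<chi> :: "'v \<Rightarrow> nat"
  assumes finX: "finite X" and finV: "finite V"
    and inj: "\<And>W c. W \<subseteq> {v \<in> V. \<chi> v = c} \<Longrightarrow> inj_on (\<lambda>(v, x). key v x) (W \<times> X)"
    and t: "\<And>c. 9 * real (card {v \<in> V. \<chi> v = c}) \<le> real (t c) * 2 ^ card X"
    and ts: "\<And>c. s \<le> t c" and s: "2 ^ card X * (D + 1) < (3::nat) ^ s"
  shows "\<exists>\<omega>. \<forall>Z. \<forall>c\<le>D. card {v \<in> V. \<chi> v = c \<and> {x \<in> X. key v x \<in> \<omega>} = Z} < t c"
proof (rule ccontr)
  assume neg: "\<not> ?thesis"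
  define J where "J = (\<lambda>(v, x). key v x) ` (V \<times> X)"
  define M where "M = (2::real) ^ card X"
  have finJ: "finite J" using finX finV by (simp add: J_def)
  define Vc where "Vc c = {v \<in> V. \<chi> v = c}" for c
  have finVc: "finite (Vc c)" for c using finV by (simp add: Vc_def)
  define \<Omega> where "\<Omega> W Z = {\<omega> \<in> Pow J. \<forall>v\<in>W. {x \<in> X. key v x \<in> \<omega>} = Z}" for W Z
  define \<W> where "\<W> c = {W. W \<subseteq> Vc c \<and> card W = t c}" for c
  have finW: "finite (\<W> c)" for c using finVc by (simp add: \<W>_def)
  \<comment> \<open>Positivity makes the set \<open>W\<close> below nonempty. Its common label
    \<open>Z\<close> is then a subset of \<open>X\<close>, so the union bound runs over only
    \<open>2 ^ card X\<close> labels.\<close>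
  have t0: "t c > 0" for c
  proof -
    have "s > 0" using s by (cases s) auto
    then show ?thesis using ts[of c] by simp
  qed
  \<comment> \<open>Union bound: if every \<open>\<omega>\<close> fails, each one gives a common
    label \<open>Z\<close> to some \<open>t c\<close> vertices of one colour.\<close>
  have "Pow J \<subseteq> (\<Union>c\<in>{..D}. \<Union>Z\<in>Pow X. \<Union>W\<in>\<W> c. \<Omega> W Z)"
  proof
    fix \<omega> assume \<omega>: "\<omega> \<in> Pow J"
    have "\<not> (\<forall>Z. \<forall>c\<le>D. card {v \<in> V. \<chi> v = c \<and> {x \<in> X. key v x \<in> \<omega>} = Z} < t c)"
      using neg[unfolded not_ex] by (rule spec)
    then obtain Z c where c: "c \<le> D" "t c \<le> card {v \<in> V. \<chi> v = c \<and> {x \<in> X. key v x \<in> \<omega>} = Z}"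
      unfolding not_all not_imp not_less by (elim exE conjE)
    from c(2) obtain W where W: "W \<subseteq> {v \<in> V. \<chi> v = c \<and> {x \<in> X. key v x \<in> \<omega>} = Z}" "card W = t c"
      by (rule obtain_subset_with_card_n)
    then have "W \<noteq> {}" using t0[of c] by auto
    then have "Z \<in> Pow X" using W(1) by blast
    moreover have "W \<in> \<W> c" using W by (auto simp: \<W>_def Vc_def)
    moreover have "\<omega> \<in> \<Omega> W Z" using W \<omega> by (auto simp: \<Omega>_def)
    ultimately show "\<omega> \<in> (\<Union>c\<in>{..D}. \<Union>Z\<in>Pow X. \<Union>W\<in>\<W> c. \<Omega> W Z)" using c(1) by blast
  qed
  then have "card (Pow J) \<le> card (\<Union>c\<in>{..D}. \<Union>Z\<in>Pow X. \<Union>W\<in>\<W> c. \<Omega> W Z)"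
    using finJ finX finW by (intro card_mono) (auto simp: \<Omega>_def)
  also have "\<dots> \<le> (\<Sum>c\<in>{..D}. card (\<Union>Z\<in>Pow X. \<Union>W\<in>\<W> c. \<Omega> W Z))" by (rule card_UN_le) simp
  also have "\<dots> \<le> (\<Sum>c\<in>{..D}. \<Sum>Z\<in>Pow X. card (\<Union>W\<in>\<W> c. \<Omega> W Z))"
    using finX by (intro sum_mono card_UN_le) simp
  also have "\<dots> \<le> (\<Sum>c\<in>{..D}. \<Sum>Z\<in>Pow X. \<Sum>W\<in>\<W> c. card (\<Omega> W Z))"
    using finW by (intro sum_mono card_UN_le) simp
  finally have "real (2 ^ card J) \<le> real (\<Sum>c\<in>{..D}. \<Sum>Z\<in>Pow X. \<Sum>W\<in>\<W> c. card (\<Omega> W Z))"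
    using finJ by (simp only: card_Pow of_nat_le_iff)
  also have "\<dots> = (\<Sum>c\<in>{..D}. \<Sum>Z\<in>Pow X. \<Sum>W\<in>\<W> c. real (card (\<Omega> W Z)))" by simp
  also have "\<dots> \<le> (\<Sum>c\<in>{..D}. \<Sum>Z\<in>Pow X. \<Sum>W\<in>\<W> c. 2 ^ card J / M ^ t c)"
  proof (intro sum_mono)
    fix c Z W assume W: "W \<in> \<W> c"
    have "card (\<Omega> W Z) * (2 ^ card X) ^ card W \<le> 2 ^ card J"
      unfolding \<Omega>_def
    proof (rule card_prescribed_traces_le[OF finX finJ])
      show "finite W" using W finVc by (auto simp: \<W>_def intro: finite_subset)
      show "key v x \<in> J" if "v \<in> W" "x \<in> X" for v x
        using that W by (force simp: J_def \<W>_def Vc_def)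
      show "inj_on (\<lambda>(v, x). key v x) (W \<times> X)" using W by (intro inj[of _ c]) (auto simp: \<W>_def Vc_def)
    qed
    then have "real (card (\<Omega> W Z) * (2 ^ card X) ^ card W) \<le> real (2 ^ card J)" by (simp only: of_nat_le_iff)
    then have "real (card (\<Omega> W Z)) * M ^ t c \<le> 2 ^ card J" using W by (simp add: M_def \<W>_def)
    then show "real (card (\<Omega> W Z)) \<le> 2 ^ card J / M ^ t c" by (simp add: M_def pos_le_divide_eq)
  qed
  also have "\<dots> = (\<Sum>c\<in>{..D}. 2 ^ card J * M * (real (card (Vc c) choose t c) / M ^ t c))"
    using finX finVc by (simp add: card_Pow \<W>_def n_subsets M_def field_simps)
  also have "\<dots> \<le> (\<Sum>c\<in>{..D}. 2 ^ card J * M * (1 / 3) ^ s)"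
  proof (rule sum_mono)
    fix c
    have "real (card (Vc c) choose t c) / M ^ t c \<le> (1 / 3) ^ t c"
      using t[of c] by (intro binomial_div_power_le) (auto simp: M_def Vc_def)
    also have "\<dots> \<le> (1 / 3) ^ s" by (rule power_decreasing) (use ts in auto)
    finally show "2 ^ card J * M * (real (card (Vc c) choose t c) / M ^ t c) \<le> 2 ^ card J * M * (1 / 3) ^ s"
      by (intro mult_left_mono) (auto simp: M_def)
  qed
  also have "\<dots> = 2 ^ card J * (M * real (D + 1) / 3 ^ s)" by (simp add: field_simps power_divide)
  finally have "2 ^ card J * 1 \<le> 2 ^ card J * (M * real (D + 1) / 3 ^ s)"
    by (simp only: of_nat_power of_nat_numeral mult_1_right)
  then have "1 \<le> M * real (D + 1) / 3 ^ s" by (rule mult_left_le_imp_le) simp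
  moreover have "real (2 ^ card X * (D + 1)) < real (3 ^ s)" using s by (simp only: of_nat_less_iff)
  then have "M * real (D + 1) < 3 ^ s" by (simp only: M_def of_nat_mult of_nat_power of_nat_numeral)
  ultimately show False by (simp add: pos_le_divide_eq)
qed

text \<open>When \<open>p\<close> grows by one, the quotient changes only if \<open>k\<close>
  divides \<open>p + b + 1\<close>, which happens for at most one \<open>b < k\<close>. This is the
  cyclic refreshing: bit \<open>b\<close> in layer \<open>p\<close> is read from block
  \<open>(p + b) div k\<close>.\<close>

lemma card_div_change_le:
  fixes p q k :: nat
  assumes "p \<le> q + 1" "q \<le> p + 1"
  shows "card {b. b < k \<and> (p + b) div k \<noteq> (q + b) div k} \<le> 1"
proof -
  have *: "card {b. b < k \<and> (p + b) div k \<noteq> (Suc p + b) div k} \<le> 1" (is "card (?A p) \<le> 1") for p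
  proof -
    have dvd: "k dvd Suc (p + b)" if "(p + b) div k \<noteq> (Suc p + b) div k" for b
      using that div_Suc[of "p + b" k] by (auto split: if_splits)
    have le: "b' \<le> b" if "b' < k" "k dvd Suc (p + b)" "k dvd Suc (p + b')" for b b'
    proof (rule ccontr)
      assume "\<not> b' \<le> b"
      moreover have "k dvd Suc (p + b') - Suc (p + b)" using that(2,3) by (rule dvd_diff_nat[rotated])
      ultimately have "k dvd b' - b" "0 < b' - b" by auto
      then have "k \<le> b' - b" by (rule dvd_imp_le)
      then show False using that(1) by linarith
    qed
    have uniq: "b = b'" if "b < k" "b' < k" "k dvd Suc (p + b)" "k dvd Suc (p + b')" for b b'
      using le[of b' b] le[of b b'] that by simp
    have "b = b'" if "b \<in> {b. b < k \<and> (p + b) div k \<noteq> (Suc p + b) div k}"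
      "b' \<in> {b. b < k \<and> (p + b) div k \<noteq> (Suc p + b) div k}" for b b'
      using that unfolding mem_Collect_eq by (elim conjE) (rule uniq[OF _ _ dvd dvd])
    then have "\<forall>b\<in>?A p. \<forall>b'\<in>?A p. b = b'" by blast
    moreover have "finite (?A p)" by (rule finite_subset[of _ "{..<k}"]) blast+
    ultimately show ?thesis unfolding One_nat_def by (simp only: card_le_Suc0_iff_eq)
  qed
  consider "p = q" | "q = Suc p" | "p = Suc q" using assms by linarith
  then show ?thesis
  proof cases
    case 3
    have "{b. b < k \<and> (Suc q + b) div k \<noteq> (q + b) div k} = {b. b < k \<and> (q + b) div k \<noteq> (Suc q + b) div k}"
      by (rule Collect_cong) metis
    then show ?thesis using *[of q] 3 by simp
  qed (use * in auto)
qed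

text \<open>Bit \<open>(i, b)\<close> of a vertex is a random bit indexed by its component in the
  \<open>i\<close>-th layering and the block of its layer. Vertices can share an index only if they
  are close in some layering. This relation \<open>dep\<close> has degree at most
  \<open>32 * d * k\<close>, so \<open>32 * d * k + 1\<close> colours give classes with independent
  labels, and the fibre bound is the sum of the bounds for these classes.\<close>

lemma spread_labelling:
  assumes G: "simple_graph V E" and cover: "thin_cover V E d F"
    and s: "2 ^ (d * k) * (32 * d * k + 1) < (3::nat) ^ s"
  obtains f :: "'v \<Rightarrow> (nat \<times> nat) set" where "\<And>v. f v \<subseteq> {..<d} \<times> {..<k}"
    "\<And>u v. {u, v} \<in> E \<Longrightarrow> \<exists>i<d. \<exists>j<d. i < j \<and>
      card {b. (i, b) \<in> f u - f v \<union> (f v - f u)} \<le> 1 \<and> card {b. (j, b) \<in> f u - f v \<union> (f v - f u)} \<le> 1"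
    "\<And>Z. real (card {v \<in> V. f v = Z}) \<le>
      9 * real (card V) / 2 ^ (d * k) + real (32 * d * k + 1) * real (s + 1)"
proof -
  note finV = simple_graph_finite(1)[OF G]
  have thin: "thin V (F i)" if "i < d" for i using that cover by (simp add: thin_cover_def)
  define good where "good i \<rho> l \<longleftrightarrow> (\<forall>u v. {u, v} \<in> F i \<longrightarrow> \<rho> u = \<rho> v \<and> l u \<le> l v + 1) \<and>
    (\<forall>v\<in>V. \<forall>n. card {w \<in> V. \<rho> w = \<rho> v \<and> l w = n} \<le> 16)"
    for i and \<rho> :: "'v \<Rightarrow> 'v set set" and l :: "'v \<Rightarrow> nat"
  have "\<forall>i. \<exists>p. i < d \<longrightarrow> good i (fst p) (snd p)"
    using thin unfolding thin_def good_def[symmetric] by auto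
  then obtain p where p: "\<And>i. i < d \<Longrightarrow> good i (fst (p i)) (snd (p i))" by metis
  define \<rho> where "\<rho> i = fst (p i)" for i
  define l where "l i = snd (p i)" for i
  have step: "\<rho> i u = \<rho> i v \<and> l i u \<le> l i v + 1" if "i < d" "{u, v} \<in> F i" for i u v
    using p[OF that(1)] that(2) by (simp add: good_def \<rho>_def l_def)
  have fib: "card {w \<in> V. \<rho> i w = \<rho> i v \<and> l i w = n} \<le> 16" if "i < d" "v \<in> V" for i v n
    using p[OF that(1)] that(2) by (simp add: good_def \<rho>_def l_def)
  define X where "X = {..<d} \<times> {..<k}"
  have finX: "finite X" and cX: "card X = d * k" by (simp_all add: X_def)
  \<comment> \<open>Neighbours in \<open>F i\<close> agree on \<open>\<rho> i\<close>, so in row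
    \<open>i\<close> their keys differ only where the block changes. Vertices of one component in
    layers at distance \<open>k\<close> or more have no key of row \<open>i\<close> in
    common.\<close>
  define key where "key v = (\<lambda>(i, b). (i, b, \<rho> i v, (l i v + b) div k))" for v
  define dep where "dep v w \<longleftrightarrow> (\<exists>i<d. \<rho> i w = \<rho> i v \<and> l i v < l i w + k \<and> l i w < l i v + k)" for v w
  \<comment> \<open>At most 16 vertices in each of fewer than \<open>2 * k\<close> relevant layers,
    in each of \<open>d\<close> layerings.\<close>
  have dep_card: "card {w \<in> V. w \<noteq> v \<and> dep v w} \<le> 32 * d * k" if v: "v \<in> V" for v
  proof -
    let ?I = "\<lambda>i. {l i v + 1 - k..<l i v + k}"
    let ?S = "\<lambda>i n. {w \<in> V. \<rho> i w = \<rho> i v \<and> l i w = n}"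
    have "{w \<in> V. w \<noteq> v \<and> dep v w} \<subseteq> (\<Union>i\<in>{..<d}. \<Union>n\<in>?I i. ?S i n)"
      by (auto simp: dep_def)
    then have "card {w \<in> V. w \<noteq> v \<and> dep v w} \<le> card (\<Union>i\<in>{..<d}. \<Union>n\<in>?I i. ?S i n)"
      using finV by (intro card_mono) auto
    also have "\<dots> \<le> (\<Sum>i\<in>{..<d}. card (\<Union>n\<in>?I i. ?S i n))" by (rule card_UN_le) simp
    also have "\<dots> \<le> (\<Sum>i\<in>{..<d}. \<Sum>n\<in>?I i. card (?S i n))" by (intro sum_mono card_UN_le) simp
    also have "\<dots> \<le> (\<Sum>i\<in>{..<d}. \<Sum>n\<in>?I i. 16)" using v by (intro sum_mono fib) auto
    also have "\<dots> \<le> (\<Sum>i\<in>{..<d}. 32 * k)" by (intro sum_mono) simp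
    finally show ?thesis by (simp add: mult_ac)
  qed
  have dep_sym: "dep v w \<Longrightarrow> dep w v" for v w by (auto simp: dep_def)
  obtain \<chi> where \<chi>: "\<forall>v\<in>V. \<chi> v \<le> 32 * d * k"
    "\<forall>v\<in>V. \<forall>w\<in>V. v \<noteq> w \<longrightarrow> dep v w \<longrightarrow> \<chi> v \<noteq> (\<chi> w :: nat)"
    using greedy_colouring[OF finV dep_card dep_sym] by blast
  have key_dep: "x = x' \<and> dep v w" if "x \<in> X" "x' \<in> X" "key v x = key w x'" for v w x x'
  proof -
    obtain i b i' b' where x: "x = (i, b)" "x' = (i', b')" by (cases x, cases x')
    have eq: "i' = i" "b' = b" "\<rho> i w = \<rho> i v" "(l i v + b) div k = (l i w + b) div k"
      using that by (auto simp: x key_def)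
    have k: "k > 0" "i < d" using that(1) by (auto simp: x X_def)
    have "m < n + k" if "(m + b) div k = (n + b) div k" for m n
    proof -
      have "m + b < (m + b) div k * k + k"
        using k(1) by (metis div_mult_mod_eq add_less_cancel_left mod_less_divisor)
      also have "(m + b) div k * k \<le> n + b" unfolding that by (rule div_times_less_eq_dividend)
      finally show ?thesis by simp
    qed
    then have "dep v w" using eq k(2) unfolding dep_def by metis
    then show ?thesis using x eq by simp
  qed
  have inj: "inj_on (\<lambda>(v, x). key v x) (W \<times> X)" if W: "W \<subseteq> {v \<in> V. \<chi> v = c}" for W c
  proof (rule inj_onI)
    fix a a' assume a: "a \<in> W \<times> X" "a' \<in> W \<times> X"
      "(case a of (v, x) \<Rightarrow> key v x) = (case a' of (v, x) \<Rightarrow> key v x)"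
    then have *: "snd a = snd a' \<and> dep (fst a) (fst a')"
      using key_dep[of "snd a" "snd a'" "fst a" "fst a'"] by (auto simp: case_prod_beta)
    have "fst a = fst a'"
    proof (rule ccontr)
      assume "fst a \<noteq> fst a'"
      moreover have "fst a \<in> W" "fst a' \<in> W" using a(1,2) by auto
      then have "fst a \<in> V" "fst a' \<in> V" "\<chi> (fst a) = c" "\<chi> (fst a') = c" using W by blast+
      then have "fst a \<in> V" "fst a' \<in> V" "\<chi> (fst a) = \<chi> (fst a')" by simp_all
      ultimately show False using \<chi>(2) * by blast
    qed
    with * show "a = a'" by (simp add: prod_eq_iff)
  qed
  define nn where "nn c = card {v \<in> V. \<chi> v = c}" for c
  \<comment> \<open>Nine times the average fibre of the class, as
    \<open>binomial_div_power_le\<close> requires. The summand \<open>s\<close> makes the failure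
    probability small even for small classes.\<close>
  define t where "t c = nat \<lceil>9 * real (nn c) / 2 ^ (d * k)\<rceil> + s" for c
  have t9: "9 * real (card {v \<in> V. \<chi> v = c}) \<le> real (t c) * 2 ^ card X" for c
  proof -
    have "9 * real (nn c) / 2 ^ (d * k) \<le> real (t c)" unfolding t_def by linarith
    then show ?thesis by (simp add: nn_def cX divide_le_eq)
  qed
  have t_le: "real (t c) \<le> 9 * real (nn c) / 2 ^ (d * k) + real (s + 1)" for c
  proof -
    have "0 \<le> 9 * real (nn c) / 2 ^ (d * k)" by simp
    then have "real (nat \<lceil>9 * real (nn c) / 2 ^ (d * k)\<rceil>) \<le> 9 * real (nn c) / 2 ^ (d * k) + 1" by linarith
    then show ?thesis by (simp add: t_def)
  qed
  have "\<exists>\<omega>. \<forall>Z. \<forall>c\<le>32 * d * k. card {v \<in> V. \<chi> v = c \<and> {x \<in> X. key v x \<in> \<omega>} = Z} < t c"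
    by (rule exists_spread_choice[OF finX finV inj t9, where s = s]) (use s in \<open>auto simp: t_def cX\<close>)
  then obtain \<omega> where \<omega>: "\<And>Z c. c \<le> 32 * d * k \<Longrightarrow>
      card {v \<in> V. \<chi> v = c \<and> {x \<in> X. key v x \<in> \<omega>} = Z} < t c" by blast
  define f where "f v = {x \<in> X. key v x \<in> \<omega>}" for v
  show ?thesis
  proof
    show "f v \<subseteq> {..<d} \<times> {..<k}" for v by (auto simp: f_def X_def)
    show "\<exists>i<d. \<exists>j<d. i < j \<and> card {b. (i, b) \<in> f u - f v \<union> (f v - f u)} \<le> 1 \<and>
        card {b. (j, b) \<in> f u - f v \<union> (f v - f u)} \<le> 1" if uv: "{u, v} \<in> E" for u v
    proof -
      have row: "card {b. (i, b) \<in> f u - f v \<union> (f v - f u)} \<le> 1" if i: "i < d" "{u, v} \<in> F i" for i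
      proof -
        have i': "{v, u} \<in> F i" using i(2) by (simp add: insert_commute)
        have "{b. (i, b) \<in> f u - f v \<union> (f v - f u)} \<subseteq> {b. b < k \<and> (l i u + b) div k \<noteq> (l i v + b) div k}"
          using step[OF i] by (auto simp: f_def X_def key_def)
        then have "card {b. (i, b) \<in> f u - f v \<union> (f v - f u)} \<le>
            card {b. b < k \<and> (l i u + b) div k \<noteq> (l i v + b) div k}" by (intro card_mono) auto
        also have "\<dots> \<le> 1" using step[OF i] step[OF i(1) i'] by (intro card_div_change_le) auto
        finally show ?thesis .
      qed
      obtain i j where "i < d" "j < d" "i < j" "{u, v} \<in> F i" "{u, v} \<in> F j"
        using cover uv unfolding thin_cover_def by blast
      then show ?thesis using row by blast
    qed
    show "real (card {v \<in> V. f v = Z}) \<le>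
        9 * real (card V) / 2 ^ (d * k) + real (32 * d * k + 1) * real (s + 1)" for Z
    proof -
      let ?C = "{..32 * d * k}"
      have "{v \<in> {v \<in> V. f v = Z}. \<chi> v \<in> ?C} = {v \<in> V. f v = Z}" using \<chi>(1) by auto
      then have "card {v \<in> V. f v = Z} = (\<Sum>c\<in>?C. card {v \<in> {v \<in> V. f v = Z}. \<chi> v = c})"
        using finV sum_card_fibres[of "{v \<in> V. f v = Z}" ?C \<chi>] by simp
      also have "\<dots> \<le> (\<Sum>c\<in>?C. t c)"
      proof (rule sum_mono)
        fix c assume "c \<in> ?C"
        then have "card {v \<in> V. \<chi> v = c \<and> f v = Z} < t c" unfolding f_def by (intro \<omega>) simp
        moreover have "{v \<in> {v \<in> V. f v = Z}. \<chi> v = c} = {v \<in> V. \<chi> v = c \<and> f v = Z}" by blast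
        ultimately show "card {v \<in> {v \<in> V. f v = Z}. \<chi> v = c} \<le> t c" by simp
      qed
      finally have "real (card {v \<in> V. f v = Z}) \<le> (\<Sum>c\<in>?C. real (t c))"
        by (metis of_nat_le_iff of_nat_sum)
      also have "\<dots> \<le> (\<Sum>c\<in>?C. 9 * real (nn c) / 2 ^ (d * k) + real (s + 1))" by (intro sum_mono t_le)
      also have "\<dots> = 9 * real (\<Sum>c\<in>?C. nn c) / 2 ^ (d * k) + real (32 * d * k + 1) * real (s + 1)"
        by (simp add: sum.distrib sum_distrib_left sum_divide_distrib)
      also have "(\<Sum>c\<in>?C. nn c) = card V"
      proof -
        have "{v \<in> V. \<chi> v \<in> ?C} = V" using \<chi>(1) by auto
        then show ?thesis using finV sum_card_fibres[of V ?C \<chi>] by (simp add: nn_def)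
      qed
      finally show ?thesis .
    qed
  qed
qed

section \<open>From labels to sums\<close>

text \<open>The sets form an elementary abelian 2-group under symmetric difference, so the first
  component of a sum records exactly where two labels differ. The factor \<open>int\<close> keeps
  vertices with equal labels apart.\<close>

definition symdiff_int_group :: "('a set \<times> int) monoid" where
  "symdiff_int_group = \<lparr>carrier = UNIV,
    monoid.mult = (\<lambda>(A, x) (B, y). (A - B \<union> (B - A), x + y)), one = ({}, 0)\<rparr>"

lemma comm_group_symdiff_int_group: "comm_group symdiff_int_group"
proof (rule comm_groupI)
  fix p :: "'a set \<times> int"
  show "\<exists>q\<in>carrier symdiff_int_group. q \<otimes>\<^bsub>symdiff_int_group\<^esub> p = \<one>\<^bsub>symdiff_int_group\<^esub>"
    by (intro bexI[of _ "(fst p, - snd p)"]) (auto simp: symdiff_int_group_def case_prod_beta)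
qed (auto simp: symdiff_int_group_def)

text \<open>There are at most \<open>d^2\<close> choices of two rows and \<open>k + 1\<close>
  possibilities for a row with at most one element; the other \<open>d - 2\<close> rows are
  free.\<close>

lemma card_sparse_rows_le:
  "card {Z \<in> Pow ({..<d} \<times> {..<k}). \<exists>i<d. \<exists>j<d. i < j \<and> card {b. (i, b) \<in> Z} \<le> 1 \<and> card {b. (j, b) \<in> Z} \<le> 1}
    \<le> d\<^sup>2 * (k + 1)\<^sup>2 * 2 ^ ((d - 2) * k)"
proof -
  define S where "S i = insert {} ((\<lambda>b. {(i, b)}) ` {..<k})" for i :: nat
  define R where "R i j = Pow (({..<d} - {i, j}) \<times> {..<k})" for i j
  define Y where "Y = (\<lambda>(i, j). (\<lambda>(P, Q, T). P \<union> Q \<union> T) ` (S i \<times> S j \<times> R i j))"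
  define I where "I = {(i, j). i < d \<and> j < d \<and> i < j}"
  have I: "I \<subseteq> {..<d} \<times> {..<d}" by (auto simp: I_def)
  then have finI: "finite I" by (rule finite_subset) simp
  have cS: "card (S i) \<le> k + 1" for i
  proof -
    have "card (S i) \<le> Suc (card ((\<lambda>b. {(i, b)}) ` {..<k}))" unfolding S_def by (rule card_insert_le_m1[simplified]) simp_all
    also have "\<dots> \<le> Suc (card {..<k})" by (simp add: card_image_le del: card_lessThan)
    finally show ?thesis by simp
  qed
  have finSR: "finite (S i)" "finite (R i j)" for i j by (auto simp: S_def R_def)
  have row: "Z \<inter> {i} \<times> {..<k} \<in> S i" if Z: "Z \<subseteq> {..<d} \<times> {..<k}" and c: "card {b. (i, b) \<in> Z} \<le> 1" for Z i
  proof -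
    have "finite {b. (i, b) \<in> Z}" by (rule finite_subset[of _ "{..<k}"]) (use Z in auto)
    then have "{b. (i, b) \<in> Z} = {} \<or> (\<exists>b. {b. (i, b) \<in> Z} = {b})"
      using c by (metis card_0_eq card_1_singletonE le_Suc_eq le_zero_eq One_nat_def)
    then show ?thesis
    proof
      assume "{b. (i, b) \<in> Z} = {}"
      then have "Z \<inter> {i} \<times> {..<k} = {}" by auto
      then show ?thesis by (simp add: S_def)
    next
      assume "\<exists>b. {b. (i, b) \<in> Z} = {b}"
      then obtain b where b: "{b. (i, b) \<in> Z} = {b}" by blast
      then have "(i, b) \<in> Z" by blast
      then have "b < k" using Z by auto
      moreover have "Z \<inter> {i} \<times> {..<k} = {(i, b)}" using b \<open>b < k\<close> by auto
      ultimately show ?thesis by (simp add: S_def)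
    qed
  qed
  have "{Z \<in> Pow ({..<d} \<times> {..<k}). \<exists>i<d. \<exists>j<d. i < j \<and> card {b. (i, b) \<in> Z} \<le> 1 \<and> card {b. (j, b) \<in> Z} \<le> 1}
      \<subseteq> (\<Union>p\<in>I. Y p)"
  proof
    fix Z assume "Z \<in> {Z \<in> Pow ({..<d} \<times> {..<k}). \<exists>i<d. \<exists>j<d. i < j \<and> card {b. (i, b) \<in> Z} \<le> 1 \<and> card {b. (j, b) \<in> Z} \<le> 1}"
    then obtain i j where ij: "Z \<subseteq> {..<d} \<times> {..<k}" "i < d" "j < d" "i < j"
      "card {b. (i, b) \<in> Z} \<le> 1" "card {b. (j, b) \<in> Z} \<le> 1" by blast
    have "Z = Z \<inter> {i} \<times> {..<k} \<union> Z \<inter> {j} \<times> {..<k} \<union> Z \<inter> ({..<d} - {i, j}) \<times> {..<k}" using ij(1) by auto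
    moreover have "Z \<inter> ({..<d} - {i, j}) \<times> {..<k} \<in> R i j" by (auto simp: R_def)
    ultimately have "Z \<in> Y (i, j)"
      unfolding Y_def using row[OF ij(1,5)] row[OF ij(1,6)]
      by (auto intro!: image_eqI[of _ _ "(Z \<inter> {i} \<times> {..<k}, Z \<inter> {j} \<times> {..<k}, Z \<inter> ({..<d} - {i, j}) \<times> {..<k})"])
    moreover have "(i, j) \<in> I" using ij by (simp add: I_def)
    ultimately show "Z \<in> (\<Union>p\<in>I. Y p)" by blast
  qed
  then have "card {Z \<in> Pow ({..<d} \<times> {..<k}). \<exists>i<d. \<exists>j<d. i < j \<and> card {b. (i, b) \<in> Z} \<le> 1 \<and> card {b. (j, b) \<in> Z} \<le> 1}
      \<le> card (\<Union>p\<in>I. Y p)"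
    using finI finSR by (intro card_mono) (auto simp: Y_def)
  also have "\<dots> \<le> (\<Sum>p\<in>I. card (Y p))" using finI by (rule card_UN_le)
  also have "\<dots> \<le> (\<Sum>p\<in>I. (k + 1) * ((k + 1) * 2 ^ ((d - 2) * k)))"
  proof (rule sum_mono)
    fix p assume p: "p \<in> I"
    obtain i j where ij: "p = (i, j)" by (cases p)
    have "card ({..<d} - {i, j}) = d - 2"
      using p ij by (subst card_Diff_subset) (auto simp: I_def card_insert_if)
    then have cR: "card (R i j) = 2 ^ ((d - 2) * k)" by (simp add: R_def card_Pow card_cartesian_product)
    have "card (Y p) \<le> card (S i \<times> S j \<times> R i j)" unfolding Y_def ij prod.case by (rule card_image_le) (simp add: finSR)
    also have "\<dots> = card (S i) * (card (S j) * 2 ^ ((d - 2) * k))" by (simp add: card_cartesian_product cR)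
    also have "\<dots> \<le> (k + 1) * ((k + 1) * 2 ^ ((d - 2) * k))" by (intro mult_le_mono cS order_refl)
    finally show "card (Y p) \<le> (k + 1) * ((k + 1) * 2 ^ ((d - 2) * k))" .
  qed
  also have "\<dots> = card I * ((k + 1)\<^sup>2 * 2 ^ ((d - 2) * k))"
    by (simp only: sum_constant power2_eq_square mult.assoc of_nat_id)
  also have "\<dots> \<le> d\<^sup>2 * ((k + 1)\<^sup>2 * 2 ^ ((d - 2) * k))"
    using card_mono[OF _ I] by (intro mult_le_mono1) (simp add: card_cartesian_product power2_eq_square)
  finally show ?thesis by (simp add: mult.assoc)
qed

text \<open>The sums lie in the product of the sparse patterns \<open>Y\<close> with an interval of
  \<open>2 * K\<close> integers, where \<open>K\<close> bounds the fibres of the labelling. Writing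
  \<open>2 ^ ((d - 2) * k)\<close> as \<open>2 ^ (d * k) / 4 ^ k\<close> isolates the
  saving.\<close>

lemma sum_number_le_spread:
  assumes G: "simple_graph V E" and deg: "\<And>v. v \<in> V \<Longrightarrow> vertex_degree E v \<le> d" and d: "d \<ge> 2"
    and s: "2 ^ (d * k) * (32 * d * k + 1) < (3::nat) ^ s"
  obtains N where "sum_number V E \<le> enat N"
    "real N \<le> 2 * (real d)\<^sup>2 * (real (k + 1))\<^sup>2 / 4 ^ k *
      (9 * real (card V) + 2 ^ (d * k) * real (32 * d * k + 1) * real (s + 1))"
proof -
  note finV = simple_graph_finite(1)[OF G]
  obtain F where F: "thin_cover V E d F" using thin_cover_exists[OF G deg d] by blast
  obtain f :: "'a \<Rightarrow> (nat \<times> nat) set" where fX: "\<And>v. f v \<subseteq> {..<d} \<times> {..<k}"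
    and fE: "\<And>u v. {u, v} \<in> E \<Longrightarrow> \<exists>i<d. \<exists>j<d. i < j \<and>
      card {b. (i, b) \<in> f u - f v \<union> (f v - f u)} \<le> 1 \<and> card {b. (j, b) \<in> f u - f v \<union> (f v - f u)} \<le> 1"
    and fib: "\<And>Z. real (card {v \<in> V. f v = Z}) \<le>
      9 * real (card V) / 2 ^ (d * k) + real (32 * d * k + 1) * real (s + 1)"
    by (rule spread_labelling[OF G F s]) blast
  define Kr where "Kr = 9 * real (card V) / 2 ^ (d * k) + real (32 * d * k + 1) * real (s + 1)"
  define K where "K = nat \<lfloor>Kr\<rfloor>"
  have Kr0: "Kr \<ge> 0" by (simp add: Kr_def)
  have fibK: "card {v \<in> V. f v = Z} \<le> K" for Z
    using fib[of Z] Kr0 unfolding K_def Kr_def[symmetric] by linarith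
  have "\<forall>Z. \<exists>h. bij_betw h {v \<in> V. f v = Z} {0..<card {v \<in> V. f v = Z}}"
    using finV by (intro allI ex_bij_betw_finite_nat) simp
  then obtain h where "\<forall>Z. bij_betw (h Z) {v \<in> V. f v = Z} {0..<card {v \<in> V. f v = Z}}"
    by (rule choice[THEN exE])
  note h = this[rule_format]
  \<comment> \<open>Within each fibre of \<open>f\<close> the vertices are numbered from 0. This
    makes \<open>A\<close> injective, and the second components of two vertices add up to less than
    \<open>2 * K\<close>.\<close>
  define A where "A v = (f v, int (h (f v) v))" for v
  have hK: "h (f v) v < K" if "v \<in> V" for v
  proof -
    have "h (f v) v \<in> {0..<card {w \<in> V. f w = f v}}"
      using that by (intro bij_betw_apply[OF h]) simp
    then show ?thesis using fibK[of "f v"] by simp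
  qed
  have injA: "inj_on A V"
  proof (rule inj_onI)
    fix u v assume uv: "u \<in> V" "v \<in> V" "A u = A v"
    then have "f u = f v" "h (f v) u = h (f v) v" by (auto simp: A_def)
    then show "u = v" using uv(1,2) bij_betw_imp_inj_on[OF h[of "f v"]] by (auto dest: inj_onD)
  qed
  define Y where "Y = {Z \<in> Pow ({..<d} \<times> {..<k}). \<exists>i<d. \<exists>j<d. i < j \<and>
    card {b. (i, b) \<in> Z} \<le> 1 \<and> card {b. (j, b) \<in> Z} \<le> 1}"
  let ?H = "symdiff_int_group :: ((nat \<times> nat) set \<times> int) monoid"
  have sum_number: "sum_number V E \<le> enat (card (edge_sums ?H E A))"
    by (intro sum_number_le_card[OF G comm_group_symdiff_int_group _ injA]) (auto simp: symdiff_int_group_def)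
  have sub: "edge_sums ?H E A \<subseteq> Y \<times> {0..<2 * int K}"
  proof
    fix z assume "z \<in> edge_sums ?H E A"
    then obtain u v where uv: "{u, v} \<in> E" "z = A u \<otimes>\<^bsub>?H\<^esub> A v" by (auto simp: edge_sums_def)
    have "u \<in> V" "v \<in> V" using uv(1) G by (auto simp: simple_graph_def doubleton_eq_iff)
    then have "int (h (f u) u) + int (h (f v) v) < 2 * int K" using hK[of u] hK[of v] by linarith
    moreover have "f u - f v \<union> (f v - f u) \<in> Y" using fE[OF uv(1)] fX[of u] fX[of v] unfolding Y_def by blast
    moreover have "z = (f u - f v \<union> (f v - f u), int (h (f u) u) + int (h (f v) v))"
      by (simp add: uv(2) A_def symdiff_int_group_def)
    ultimately show "z \<in> Y \<times> {0..<2 * int K}" by simp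
  qed
  have finY: "finite Y" by (simp add: Y_def)
  have "card (edge_sums ?H E A) \<le> card (Y \<times> {0..<2 * int K})" using sub finY by (intro card_mono) auto
  also have "\<dots> = card Y * (2 * K)" by (simp add: card_cartesian_product nat_mult_distrib)
  also have "\<dots> \<le> d\<^sup>2 * (k + 1)\<^sup>2 * 2 ^ ((d - 2) * k) * (2 * K)"
    unfolding Y_def by (intro mult_le_mono1 card_sparse_rows_le)
  finally have "real (card (edge_sums ?H E A)) \<le> real (d\<^sup>2 * (k + 1)\<^sup>2 * 2 ^ ((d - 2) * k) * (2 * K))"
    by (simp only: of_nat_le_iff)
  also have "\<dots> = (real d)\<^sup>2 * (real (k + 1))\<^sup>2 * 2 ^ ((d - 2) * k) * (2 * real K)"
    by (simp only: of_nat_mult of_nat_power of_nat_numeral)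
  also have "\<dots> \<le> (real d)\<^sup>2 * (real (k + 1))\<^sup>2 * 2 ^ ((d - 2) * k) * (2 * Kr)"
  proof -
    have "real K \<le> Kr" using Kr0 unfolding K_def by linarith
    then show ?thesis by (intro mult_left_mono) auto
  qed
  also have "\<dots> = 2 * (real d)\<^sup>2 * (real (k + 1))\<^sup>2 / 4 ^ k * (2 ^ (d * k) * Kr)"
  proof -
    have "(2::real) ^ (d * k) = 2 ^ ((d - 2) * k) * 2 ^ (2 * k)"
    proof -
      have "d * k = (d - 2) * k + 2 * k" using d by (metis add_mult_distrib le_add_diff_inverse2)
      then show ?thesis by (simp only: power_add)
    qed
    also have "(2::real) ^ (2 * k) = 4 ^ k" by (simp add: power_mult)
    finally show ?thesis by simp
  qed
  also have "2 ^ (d * k) * Kr = 9 * real (card V) + 2 ^ (d * k) * real (32 * d * k + 1) * real (s + 1)"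
    by (simp add: Kr_def distrib_left)
  finally show ?thesis by (rule that[OF sum_number])
qed

section \<open>The Sauer--Spencer bound\<close>

definition mod_add_group :: "nat \<Rightarrow> nat monoid" where
  "mod_add_group n = \<lparr>carrier = {..<n}, monoid.mult = (\<lambda>a b. (a + b) mod n), one = 0\<rparr>"

lemma comm_group_mod_add_group:
  assumes "n > 0"
  shows "comm_group (mod_add_group n)"
proof (rule comm_groupI)
  fix a assume "a \<in> carrier (mod_add_group n)"
  then show "\<exists>b\<in>carrier (mod_add_group n). b \<otimes>\<^bsub>mod_add_group n\<^esub> a = \<one>\<^bsub>mod_add_group n\<^esub>"
    using assms by (intro bexI[of _ "(n - a) mod n"]) (auto simp: mod_add_group_def mod_add_left_eq)
qed (use assms in \<open>auto simp: mod_add_group_def mod_simps add_ac\<close>)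

lemma mod_add_right_inj:
  fixes a b c n :: nat
  assumes "a < n" "b < n" "(a + c) mod n = (b + c) mod n"
  shows "a = b"
proof -
  have "a \<le> b" if "a < n" "(a + c) mod n = (b + c) mod n" for a b :: nat
  proof (rule ccontr)
    assume "\<not> a \<le> b"
    then have "n dvd a - b" "0 < a - b" using that(2) mod_eq_dvd_iff_nat[of "b + c" "a + c" n] by auto
    then have "n \<le> a - b" by (rule dvd_imp_le)
    then show False using that(1) by linarith
  qed
  from this[OF assms(1,3)] this[OF assms(2) assms(3)[symmetric]] show ?thesis by simp
qed

lemma card_neighbours_le:
  assumes "finite E"
  shows "card {z. {u, z} \<in> E} \<le> vertex_degree E u" "finite {z. {u, z} \<in> E}"
proof -
  have inj: "inj_on (\<lambda>z. {u, z}) {z. {u, z} \<in> E}" by (auto simp: inj_on_def doubleton_eq_iff)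
  have sub: "(\<lambda>z. {u, z}) ` {z. {u, z} \<in> E} \<subseteq> {e \<in> E. u \<in> e}" by auto
  show "finite {z. {u, z} \<in> E}" using inj_on_finite[OF inj sub] assms by simp
  show "card {z. {u, z} \<in> E} \<le> vertex_degree E u"
    unfolding vertex_degree_def using inj sub assms by (intro card_inj_on_le) auto
qed

text \<open>The Sauer--Spencer packing argument: in an arrangement with the fewest edges of forbidden sum,
  exchanging an endpoint of such an edge with a suitable vertex would remove it without creating
  another one.\<close>

lemma arrangement_avoiding_sums:
  assumes G: "simple_graph V E" and deg: "\<And>v. v \<in> V \<Longrightarrow> vertex_degree E v \<le> d"
    and t: "2 * d * t < card V"
  obtains A where "bij_betw A V {..<card V}" "\<And>u v. {u, v} \<in> E \<Longrightarrow> t \<le> (A u + A v) mod card V"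
proof -
  note fin = simple_graph_finite[OF G]
  define n where "n = card V"
  define Bad where "Bad A = {e \<in> E. \<exists>u v. e = {u, v} \<and> (A u + A v) mod n < t}" for A
  have finBad: "finite (Bad A)" for A using fin(2) by (simp add: Bad_def)
  have "\<exists>A. bij_betw A V {..<n}"
    using ex_bij_betw_finite_nat[OF fin(1)] by (simp add: n_def atLeast0LessThan)
  then obtain A where A: "bij_betw A V {..<n}"
    and min: "\<And>A'. bij_betw A' V {..<n} \<Longrightarrow> card (Bad A) \<le> card (Bad A')"
    using ex_has_least_nat[of "\<lambda>A. bij_betw A V {..<n}" _ "\<lambda>A. card (Bad A)"] by blast
  have EV: "u \<in> V \<and> v \<in> V \<and> u \<noteq> v" if "{u, v} \<in> E" for u v
    using that G by (auto simp: simple_graph_def doubleton_eq_iff)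
  have "Bad A = {}"
  proof (rule ccontr)
    assume "Bad A \<noteq> {}"
    then obtain u v where uv: "{u, v} \<in> E" "(A u + A v) mod n < t" by (auto simp: Bad_def)
    have uvV: "u \<in> V" "v \<in> V" "u \<noteq> v" using EV[OF uv(1)] by auto
    define N where "N z = {y. {z, y} \<in> E}" for z
    define S where "S z = {w \<in> V. (A w + A z) mod n < t}" for z
    have N: "finite (N z)" "z \<in> V \<Longrightarrow> card (N z) \<le> d" for z
      using card_neighbours_le[OF fin(2), of z] deg[of z] by (auto simp: N_def)
    have finS: "finite (S z)" for z using fin(1) by (simp add: S_def)
    have S: "card (S z) \<le> t" for z
    proof -
      have "inj_on (\<lambda>w. (A w + A z) mod n) (S z)"
      proof (rule inj_onI)
        fix w w' assume w: "w \<in> S z" "w' \<in> S z" "(A w + A z) mod n = (A w' + A z) mod n"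
        then have "A w < n" "A w' < n" using bij_betw_apply[OF A] by (auto simp: S_def)
        then have "A w = A w'" using w(3) by (rule mod_add_right_inj)
        then show "w = w'" using w bij_betw_imp_inj_on[OF A] by (auto simp: S_def dest: inj_onD)
      qed
      moreover have "(\<lambda>w. (A w + A z) mod n) ` S z \<subseteq> {..<t}" by (auto simp: S_def)
      ultimately show ?thesis using card_inj_on_le[of _ "S z" "{..<t}"] by simp
    qed
    \<comment> \<open>\<open>W1\<close> and \<open>W2\<close> collect the unsuitable partners for
      exchanging values with \<open>u\<close>: for \<open>w\<close> in \<open>W1\<close>, the value
      \<open>A w\<close> would be bad for an edge at \<open>u\<close>; for \<open>w\<close> in
      \<open>W2\<close>, the value \<open>A u\<close> would be bad for an edge at
      \<open>w\<close>.\<close>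
    define W1 where "W1 = (\<Union>z\<in>N u. S z)"
    define W2 where "W2 = (\<Union>z\<in>S u. N z)"
    have "card W1 \<le> (\<Sum>z\<in>N u. card (S z))" unfolding W1_def using N by (intro card_UN_le)
    also have "\<dots> \<le> (\<Sum>z\<in>N u. t)" by (intro sum_mono S)
    also have "\<dots> \<le> d * t" using N(2)[OF uvV(1)] by simp
    finally have W1: "card W1 \<le> d * t" .
    have "card W2 \<le> (\<Sum>z\<in>S u. card (N z))" unfolding W2_def using finS by (intro card_UN_le)
    also have "\<dots> \<le> (\<Sum>z\<in>S u. d)" by (intro sum_mono N) (simp add: S_def)
    also have "\<dots> \<le> d * t" using S[of u] by simp
    finally have W2: "card W2 \<le> d * t" .
    have finW: "finite W1" "finite W2" using N finS by (auto simp: W1_def W2_def)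
    \<comment> \<open>The bad edge puts \<open>u\<close> into both sets. This saves one in the count
      of the union and pays for excluding \<open>v\<close> as well: exchanging \<open>u\<close> with
      \<open>v\<close> would keep their sum.\<close>
    have "u \<in> W1" using uv uvV by (auto simp: W1_def N_def S_def)
    moreover have "u \<in> W2"
      using uv uvV by (auto simp: W2_def N_def S_def add.commute insert_commute intro!: bexI[of _ v])
    ultimately have "card (W1 \<inter> W2) \<ge> 1" using finW by (auto simp: Suc_le_eq card_gt_0_iff)
    then have "card (W1 \<union> W2) + 1 \<le> 2 * d * t" using card_Un_Int[OF finW] W1 W2 by linarith
    moreover have "card (insert v (W1 \<union> W2)) \<le> card (W1 \<union> W2) + 1"
      using finW by (simp add: card_insert_if)
    ultimately have "card (insert v (W1 \<union> W2)) < card V" using t by linarith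
    then have "\<not> V \<subseteq> insert v (W1 \<union> W2)" using finW by (meson card_mono finite_UnI finite_insert not_le)
    then obtain w where w: "w \<in> V" "w \<noteq> v" "w \<notin> W1" "w \<notin> W2" by blast
    have wu: "w \<noteq> u" using w \<open>u \<in> W1\<close> by blast
    define A' where "A' = A(u := A w, w := A u)"
    have "A' ` V = A ` V" using w(1) uvV(1) by (force simp: A'_def image_iff)
    moreover have "inj_on A' V"
      using bij_betw_imp_inj_on[OF A] w(1) uvV(1) by (auto simp: A'_def inj_on_def)
    ultimately have A': "bij_betw A' V {..<n}" using bij_betw_imp_surj_on[OF A] by (simp add: bij_betw_def)
    have at_u: "t \<le> (A' u + A' q) mod n" if "{u, q} \<in> E" "q \<noteq> w" for q
    proof (rule ccontr)
      assume "\<not> ?thesis"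
      then have "w \<in> S q" using that EV[OF that(1)] w wu by (auto simp: A'_def S_def)
      then show False using w(3) that(1) by (auto simp: W1_def N_def)
    qed
    have at_w: "t \<le> (A' w + A' q) mod n" if "{w, q} \<in> E" "q \<noteq> u" for q
    proof (rule ccontr)
      assume "\<not> ?thesis"
      then have "q \<in> S u" using that EV[OF that(1)] by (auto simp: A'_def S_def add.commute)
      moreover have "w \<in> N q" using that(1) by (simp add: N_def insert_commute)
      ultimately show False using w(4) by (auto simp: W2_def)
    qed
    have "Bad A' \<subseteq> Bad A - {{u, v}}"
    proof
      fix e assume "e \<in> Bad A'"
      then obtain p q where e: "e \<in> E" "e = {p, q}" "(A' p + A' q) mod n < t" by (auto simp: Bad_def)
      then have e': "{p, q} \<in> E" "{q, p} \<in> E" "(A' q + A' p) mod n < t" by (auto simp: insert_commute add.commute)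
      have "q = w" if "p = u"
        by (rule ccontr) (use at_u[of q] e'(1) e(3) that in simp)
      moreover have "p = w" if "q = u"
        by (rule ccontr) (use at_u[of p] e'(2,3) that in simp)
      moreover have "q = u" if "p = w"
        by (rule ccontr) (use at_w[of q] e'(1) e(3) that in simp)
      moreover have "p = u" if "q = w"
        by (rule ccontr) (use at_w[of p] e'(2,3) that in simp)
      \<comment> \<open>A bad edge after the exchange either avoids \<open>u\<close> and
        \<open>w\<close> or equals \<open>{u, w}\<close>. In both cases its sum is unchanged, so it
        was bad before.\<close>
      ultimately consider "p \<notin> {u, w}" "q \<notin> {u, w}" | "p = u" "q = w" | "p = w" "q = u"
        by (metis insertE singletonD)
      then show "e \<in> Bad A - {{u, v}}"
      proof cases
        case 1
        then have "(A p + A q) mod n < t" using e(3) by (simp add: A'_def)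
        then have "e \<in> Bad A" using e(1,2) unfolding Bad_def by blast
        moreover have "u \<notin> e" using 1 e(2) by auto
        ultimately show ?thesis by auto
      next
        case 2
        then have "(A p + A q) mod n < t" using e(3) wu by (simp add: A'_def add.commute)
        then have "e \<in> Bad A" using e(1,2) unfolding Bad_def by blast
        moreover have "v \<notin> e" using 2 e(2) w(2) uvV(3) by auto
        ultimately show ?thesis by auto
      next
        case 3
        then have "(A p + A q) mod n < t" using e(3) wu by (simp add: A'_def add.commute)
        then have "e \<in> Bad A" using e(1,2) unfolding Bad_def by blast
        moreover have "v \<notin> e" using 3 e(2) w(2) uvV(3) by auto
        ultimately show ?thesis by auto
      qed
    qed
    moreover have "{u, v} \<in> Bad A" using uv by (auto simp: Bad_def)
    ultimately have "Bad A' \<subset> Bad A" by blast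
    then have "card (Bad A') < card (Bad A)" using finBad by (intro psubset_card_mono) auto
    then show False using min[OF A'] by simp
  qed
  show ?thesis
  proof
    show "bij_betw A V {..<card V}" using A by (simp add: n_def)
    show "t \<le> (A u + A v) mod card V" if "{u, v} \<in> E" for u v
    proof (rule ccontr)
      assume "\<not> ?thesis"
      then have "(A u + A v) mod n < t" by (simp add: n_def not_le)
      then have "{u, v} \<in> Bad A" using that unfolding Bad_def by blast
      then show False using \<open>Bad A = {}\<close> by simp
    qed
  qed
qed

lemma sum_number_le_sauer_spencer:
  assumes G: "simple_graph V E" and deg: "\<And>v. v \<in> V \<Longrightarrow> vertex_degree E v \<le> d"
    and t: "2 * d * t < card V"
  shows "sum_number V E \<le> enat (card V - t)"
proof -
  obtain A where A: "bij_betw A V {..<card V}"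
    "\<And>u v. {u, v} \<in> E \<Longrightarrow> t \<le> (A u + A v) mod card V"
    using arrangement_avoiding_sums[OF G deg t] by blast
  have n: "card V > 0" using t by simp
  have "sum_number V E \<le> enat (card (edge_sums (mod_add_group (card V)) E A))"
    using A(1) by (intro sum_number_le_card[OF G comm_group_mod_add_group[OF n]])
      (auto simp: bij_betw_def mod_add_group_def)
  also have "edge_sums (mod_add_group (card V)) E A \<subseteq> {t..<card V}"
    using A(2) n by (auto simp: edge_sums_def mod_add_group_def)
  then have "card (edge_sums (mod_add_group (card V)) E A) \<le> card V - t"
    using card_mono[of "{t..<card V}"] by fastforce
  then have "enat (card (edge_sums (mod_add_group (card V)) E A)) \<le> enat (card V - t)" by simp
  finally show ?thesis .
qed

section \<open>The two bounds\<close>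

lemma vertex_degree_le_max_degree:
  assumes "finite V" "v \<in> V"
  shows "vertex_degree E v \<le> max_degree V E"
  unfolding max_degree_def using assms by (intro Max_ge) auto

lemma ereal_of_enat_le: "m \<le> enat k \<Longrightarrow> ereal_of_enat m \<le> ereal (real k)"
  by (metis ereal_of_enat_le_iff ereal_of_enat_simps(1))

text \<open>The cubic term of the exponential series suffices, as \<open>x / 3! \<ge> 1\<close>.
  With \<open>x = ln n\<close> this guarantees \<open>n / (ln n)^2 \<ge> 1\<close>, so that
  \<open>k\<close> below is well chosen.\<close>

lemma square_le_exp:
  fixes x :: real
  assumes "6 \<le> x"
  shows "x\<^sup>2 \<le> exp x"
proof -
  have "6 * x\<^sup>2 \<le> x * x\<^sup>2" using assms by (intro mult_right_mono) auto
  also have "\<dots> = fact 3 * (x ^ 3 / fact 3)" by (simp add: power2_eq_square power3_eq_cube)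
  also have "\<dots> \<le> fact 3 * exp x" using assms by (intro mult_left_mono power_div_fact_le_exp) auto
  also have "fact 3 = (6::real)" by (simp add: fact_numeral)
  finally show ?thesis by simp
qed

text \<open>\<open>k\<close> is the largest number with \<open>2 ^ (d * k) \<le> x\<close>, where
  \<open>x = n / L^2\<close>; rounding down costs a factor of at most 4 in \<open>4 ^ k\<close>. One
  factor \<open>L\<close> of \<open>L^2\<close> pays for the at most \<open>65 L\<close> colours,
  the other for \<open>s + 1 \<le> 7 L\<close>. The constant is
  \<open>33408 = 2 * 9 * 4 * 464\<close> with \<open>464 = 9 + 65 * 7\<close>.\<close>

lemma sum_number_le_powr:
  assumes G: "simple_graph V E" and deg: "\<And>v. v \<in> V \<Longrightarrow> vertex_degree E v \<le> d" and d: "d \<ge> 2"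
    and n: "card V = n" and L: "6 \<le> ln (real n)"
  shows "ereal_of_enat (sum_number V E) \<le>
    ereal (33408 * real n powr (1 - 2 / real d) * (real d)\<^sup>2 * ln (real n) powr (2 + 4 / real d))"
proof -
  define L where "L = ln (real n)"
  have L6: "6 \<le> L" using L by (simp add: L_def)
  have n0: "real n > 0" using L by (cases "n = 0") auto
  have expL: "exp L = real n" using n0 by (simp add: L_def)
  define x where "x = real n / L\<^sup>2"
  have L2: "L\<^sup>2 > 0" using L6 by simp
  have x1: "1 \<le> x" using square_le_exp[OF L6] expL L2 by (simp add: x_def pos_le_divide_eq)
  define y where "y = log 2 x / real d"
  define k where "k = nat \<lfloor>y\<rfloor>"
  have y0: "0 \<le> y" using x1 d by (simp add: y_def)
  have k: "real k \<le> y" "y < real k + 1" using y0 unfolding k_def by linarith+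
  have xpow: "2 powr (y * real d) = x" using x1 d by (simp add: y_def)
  have pow_dk: "2 ^ (d * k) \<le> x"
  proof -
    have "(2::real) ^ (d * k) = 2 powr (real k * real d)" by (simp add: powr_realpow[symmetric] mult.commute)
    also have "\<dots> \<le> 2 powr (y * real d)" using k by (intro powr_mono mult_right_mono) auto
    finally show ?thesis by (simp only: xpow)
  qed
  have pow4: "1 / 4 ^ k \<le> 4 * x powr (- 2 / real d)"
  proof -
    have "x powr (2 / real d) = 2 powr (2 * y)"
      using d by (simp add: xpow[symmetric] powr_powr mult.commute del: powr_mult_base)
    also have "\<dots> \<le> 2 powr (2 * (real k + 1))" using k by (intro powr_mono) auto
    also have "\<dots> = 4 * 4 ^ k"
    proof -
      have "(2::real) powr (2 * (real k + 1)) = 2 powr (real (2 * (k + 1)))" by (simp add: algebra_simps)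
      also have "\<dots> = 2 ^ (2 * (k + 1))" by (rule powr_realpow) simp
      also have "\<dots> = (2\<^sup>2) ^ (k + 1)" by (rule power_mult)
      finally show ?thesis by simp
    qed
    finally have "x powr (2 / real d) \<le> 4 * 4 ^ k" .
    then have "x powr (2 / real d) / x powr (2 / real d) / 4 ^ k \<le> 4 / x powr (2 / real d)"
      using x1 by (simp add: field_simps)
    then show ?thesis using x1 by (simp add: powr_minus_divide)
  qed
  have dk: "real (d * k) \<le> 2 * L"
  proof -
    have "real (d * k) = real d * real k" by simp
    also have "\<dots> \<le> real d * y" using k by (intro mult_left_mono) auto
    also have "\<dots> = log 2 x" using d by (simp add: y_def)
    also have "\<dots> \<le> log 2 (real n)"
    proof -
      have "1 \<le> L\<^sup>2" using L6 by (simp add: one_le_power)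
      then have "x \<le> real n" using n0 by (simp add: x_def divide_le_eq mult_le_cancel_left1)
      then show ?thesis using x1 by simp
    qed
    also have "\<dots> = L / ln 2" by (simp add: log_def L_def)
    also have "\<dots> \<le> L / (1 / 2)"
    proof -
      have "exp (1 / 2 :: real) ^ 2 \<le> 2 ^ 2"
        using exp_le by (simp add: exp_of_nat_mult[symmetric] power2_eq_square flip: exp_add)
      then have "exp (1 / 2 :: real) \<le> 2" by (rule power2_le_imp_le) simp
      then have "1 / 2 \<le> ln (2 :: real)" by (subst ln_ge_iff) auto
      then show ?thesis using L6 by (intro divide_left_mono) auto
    qed
    finally show ?thesis by simp
  qed
  have k1: "real (k + 1) \<le> 3 * L"
  proof -
    have "k \<le> d * k" using d by simp
    then have "real k \<le> real (d * k)" by (simp only: of_nat_le_iff)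
    then show ?thesis using dk L6 by simp
  qed
  have D: "real (32 * d * k + 1) \<le> 65 * L" using dk L6 by simp
  \<comment> \<open>\<open>3 ^ \<lceil>L\<rceil>\<close> is at least \<open>n\<close>, and the extra
    \<open>3 ^ 4 = 81\<close> exceeds the constant 65 in the bound on labels times colours.\<close>
  define s where "s = nat \<lceil>L\<rceil> + 4"
  have s1: "real (s + 1) \<le> 7 * L" using L6 unfolding s_def by linarith
  have s3: "81 * real n \<le> 3 ^ s"
  proof -
    have "real n = exp L" by (simp add: expL)
    also have "\<dots> \<le> exp (real (nat \<lceil>L\<rceil>))" using L6 by simp
    also have "\<dots> = exp 1 ^ nat \<lceil>L\<rceil>" by (simp add: exp_of_nat_mult[symmetric])
    also have "\<dots> \<le> 3 ^ nat \<lceil>L\<rceil>" using exp_le by (intro power_mono) auto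
    finally show ?thesis by (simp add: s_def power_add)
  qed
  have xD: "2 ^ (d * k) * real (32 * d * k + 1) \<le> 65 * real n / L"
  proof -
    have "2 ^ (d * k) * real (32 * d * k + 1) \<le> x * (65 * L)"
      using pow_dk D x1 by (intro mult_mono) auto
    also have "\<dots> = 65 * real n / L" using L6 by (simp add: x_def power2_eq_square)
    finally show ?thesis .
  qed
  have "65 * real n / L \<le> 65 * real n" using L6 n0 by (simp add: divide_le_eq mult_le_cancel_left1)
  then have "2 ^ (d * k) * real (32 * d * k + 1) < 3 ^ s" using xD s3 n0 by linarith
  then have "real (2 ^ (d * k) * (32 * d * k + 1)) < real (3 ^ s)"
    by (simp only: of_nat_mult of_nat_power of_nat_numeral)
  then have s: "2 ^ (d * k) * (32 * d * k + 1) < (3::nat) ^ s" by (simp only: of_nat_less_iff)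
  obtain N where N: "sum_number V E \<le> enat N"
    "real N \<le> 2 * (real d)\<^sup>2 * (real (k + 1))\<^sup>2 / 4 ^ k *
      (9 * real (card V) + 2 ^ (d * k) * real (32 * d * k + 1) * real (s + 1))"
    by (rule sum_number_le_spread[OF G deg d s])
  have last: "9 * real (card V) + 2 ^ (d * k) * real (32 * d * k + 1) * real (s + 1) \<le> 464 * real n"
  proof -
    have "2 ^ (d * k) * real (32 * d * k + 1) * real (s + 1) \<le> 65 * real n / L * (7 * L)"
      using xD s1 L6 by (intro mult_mono) auto
    also have "\<dots> = 455 * real n" using L6 by simp
    finally show ?thesis using n by simp
  qed
  have "2 * (real d)\<^sup>2 * (real (k + 1))\<^sup>2 * (1 / 4 ^ k) \<le>
      2 * (real d)\<^sup>2 * (3 * L)\<^sup>2 * (4 * x powr (- 2 / real d))"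
    using k1 by (intro mult_mono pow4 power_mono) auto
  then have "2 * (real d)\<^sup>2 * (real (k + 1))\<^sup>2 / 4 ^ k *
      (9 * real (card V) + 2 ^ (d * k) * real (32 * d * k + 1) * real (s + 1)) \<le>
      2 * (real d)\<^sup>2 * (3 * L)\<^sup>2 * (4 * x powr (- 2 / real d)) * (464 * real n)"
    using last by (intro mult_mono) auto
  with N(2) have "real N \<le> 2 * (real d)\<^sup>2 * (3 * L)\<^sup>2 * (4 * x powr (- 2 / real d)) * (464 * real n)"
    by (rule order_trans)
  also have "\<dots> = 33408 * (real n * x powr (- 2 / real d)) * (real d)\<^sup>2 * L\<^sup>2"
    by (simp add: power_mult_distrib)
  also have "real n * x powr (- 2 / real d) = real n powr (1 - 2 / real d) * L powr (4 / real d)"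
  proof -
    have "L\<^sup>2 = L powr 2" using L6 by simp
    then have "L\<^sup>2 powr (- 2 / real d) = L powr (- (4 / real d))" by (simp only: powr_powr) simp
    then have "x powr (- 2 / real d) = real n powr (- (2 / real d)) * L powr (4 / real d)"
      using n0 L6 by (simp add: x_def powr_divide powr_minus field_simps)
    moreover have "real n powr (1 - 2 / real d) = real n * real n powr (- (2 / real d))"
      using n0 powr_add[of "real n" 1 "- (2 / real d)"] by simp
    ultimately show ?thesis by simp
  qed
  also have "33408 * (real n powr (1 - 2 / real d) * L powr (4 / real d)) * (real d)\<^sup>2 * L\<^sup>2 =
      33408 * real n powr (1 - 2 / real d) * (real d)\<^sup>2 * L powr (2 + 4 / real d)"
    using L6 by (simp add: powr_add)
  finally have bound: "real N \<le> 33408 * real n powr (1 - 2 / real d) * (real d)\<^sup>2 * L powr (2 + 4 / real d)" .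
  have "ereal_of_enat (sum_number V E) \<le> ereal (real N)" using N(1) by (rule ereal_of_enat_le)
  also have "\<dots> \<le> ereal (33408 * real n powr (1 - 2 / real d) * (real d)\<^sup>2 * L powr (2 + 4 / real d))"
    using bound by simp
  finally show ?thesis by (simp only: L_def)
qed

lemma sum_number_le_linear:
  assumes G: "simple_graph {1..n} E" and d: "d > 0" and deg: "max_degree {1..n} E = d"
  shows "ereal_of_enat (sum_number {1..n} E) \<le>
    ereal (real n - real_of_int \<lceil>real n / (2 * real d)\<rceil> + 1)"
proof -
  have n: "n > 0" using d deg by (cases "n = 0") (auto simp: max_degree_def)
  define c where "c = \<lceil>real n / (2 * real d)\<rceil>"
  \<comment> \<open>\<open>\<lceil>n / (2 d)\<rceil> - 1\<close> is the largest \<open>t\<close>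
    with \<open>2 d t < n\<close>. This strict inequality is the source of the \<open>+ 1\<close> in
    the bound.\<close>
  define t where "t = nat (c - 1)"
  have c1: "1 \<le> c" using n d by (simp add: c_def)
  have tc: "real t = real_of_int c - 1" using c1 by (simp add: t_def)
  also have "\<dots> < real n / (2 * real d)" unfolding c_def by linarith
  finally have "real (2 * d * t) < real n" using d by (simp add: pos_less_divide_eq mult_ac)
  then have "2 * d * t < n" by (simp only: of_nat_less_iff)
  then have t: "2 * d * t < card {1..n}" by simp
  have tn: "t \<le> n"
  proof -
    have "t \<le> 2 * d * t" using d by simp
    also have "\<dots> \<le> n" using t by simp
    finally show ?thesis .
  qed
  have "sum_number {1..n} E \<le> enat (card {1..n} - t)"
    by (rule sum_number_le_sauer_spencer[OF G _ t])
      (use vertex_degree_le_max_degree[of "{1..n}" _ E] deg in auto)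
  then have "ereal_of_enat (sum_number {1..n} E) \<le> ereal (real (card {1..n} - t))"
    by (rule ereal_of_enat_le)
  also have "\<dots> = ereal (real n - real_of_int c + 1)" using tn tc by (simp add: of_nat_diff)
  finally show ?thesis by (simp only: c_def)
qed

theorem theorem1p2:
  shows "(\<exists>C::real. C > 0 \<and> (\<forall>\<^sub>F n::nat in sequentially.
            \<forall>(d::nat) (E :: nat set set).
              3 \<le> d \<and> real d \<le> ln (real n) / ln (ln (real n)) \<and>
              simple_graph {1..n} E \<and> max_degree {1..n} E = d \<longrightarrow>
              ereal_of_enat (sum_number {1..n} E) \<le>
                ereal (C * real n powr (1 - 2 / real d) * (real d)\<^sup>2 *
                       ln (real n) powr (2 + 4 / real d)))) \<and>
         (\<forall>(n::nat) (d::nat) (E :: nat set set).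
            3 \<le> d \<and> simple_graph {1..n} E \<and> max_degree {1..n} E = d \<longrightarrow>
            ereal_of_enat (sum_number {1..n} E) \<le>
              ereal (real n - real_of_int \<lceil>real n / (2 * real d)\<rceil> + 1))"
proof (intro conjI exI[of _ 33408] allI impI)
  have "\<forall>\<^sub>F n::nat in sequentially. exp 6 \<le> real n"
    using filterlim_real_sequentially by (simp add: filterlim_at_top)
  then show "\<forall>\<^sub>F n::nat in sequentially. \<forall>(d::nat) (E :: nat set set).
      3 \<le> d \<and> real d \<le> ln (real n) / ln (ln (real n)) \<and>
      simple_graph {1..n} E \<and> max_degree {1..n} E = d \<longrightarrow>
      ereal_of_enat (sum_number {1..n} E) \<le>
        ereal (33408 * real n powr (1 - 2 / real d) * (real d)\<^sup>2 *
               ln (real n) powr (2 + 4 / real d))"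
  proof (eventually_elim, intro allI impI, elim conjE)
    fix n d :: nat and E :: "nat set set"
    assume n: "exp 6 \<le> real n" and "3 \<le> d" "simple_graph {1..n} E" "max_degree {1..n} E = d"
    moreover have "6 \<le> ln (real n)"
    proof -
      have "0 < real n" using n by (rule less_le_trans[OF exp_gt_zero])
      then show ?thesis using n by (simp add: ln_ge_iff)
    qed
    ultimately show "ereal_of_enat (sum_number {1..n} E) \<le>
        ereal (33408 * real n powr (1 - 2 / real d) * (real d)\<^sup>2 *
               ln (real n) powr (2 + 4 / real d))"
      using vertex_degree_le_max_degree[of "{1..n}" _ E] by (intro sum_number_le_powr) auto
  qed
next
  fix n d :: nat and E :: "nat set set"
  assume "3 \<le> d \<and> simple_graph {1..n} E \<and> max_degree {1..n} E = d"
  then show "ereal_of_enat (sum_number {1..n} E) \<le>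
      ereal (real n - real_of_int \<lceil>real n / (2 * real d)\<rceil> + 1)"
    by (intro sum_number_le_linear) auto
qed simp

end
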